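(* Let $k\ge1$ and $n\geq 2k+8$ be integers. There is no function $\varphi:(0,1]\to\mathbb{R}^{+}$ having the following property: for every $u\in W^{1,k+1}(B_1,|x|^{1-k})$ that is a semistable radially increasing solution of a problem of the type $S_k(D^2u)=g(u)$ in $B_1\setminus\{0\}$ with $g\geq 0$, there exist $C>0$ and $\epsilon\in(0,1]$ such that $|u''(r)|\leq C\varphi(r)$ for every $r\in(0,\epsilon]$.
   Context: $B_1$ is the open unit ball of $\mathbb{R}^n$; a function is radial if $u(x)=u(r)$, $r=|x|$, $r\in(0,1]$, and primes denote derivatives in $r$. $W^{1,k+1}(B_1,|x|^{1-k})$ is the space of weakly differentiable $u\in L^{k+1}(B_1)$ with $\int_{B_1}|x|^{1-k}|\nabla u|^{k+1}dx<\infty$. $S_k(D^2u)$ is the $k$-th elementary symmetric function of the eigenvalues of the Hessian $D^2u$, and $S_k^{ij}(D^2u)=\frac{\partial}{\partial u_{ij}}S_k(D^2u)$ with $u_{ij}=u_{x_ix_j}$. That a radial $u$ is a solution of a problem of the type $S_k(D^2u)=g(u)$ in $B_1\setminus\{0\}$ with $g\ge0$ means that $u$ is $C^2$ in $r\in(0,1]$ and there is a nonnegative $C^1$ function $g:\mathbb{R}\to\mathbb{R}$ such that the equation holds pointwise in $B_1\setminus\{0\}$; it is semistable if $\int_{B_1}\{\sum\psi_i\psi_jS_k^{ij}(D^2u)+g'(u)\psi^2\}dx\ge0$ for all $\psi\in C_c^1(B_1\setminus\{0\})$, where $\psi_i=\psi_{x_i}$. Radially increasing means increasing in $r$. *)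

theory Defs
  imports
    "HOL-Analysis.Analysis"
    "HOL-Computational_Algebra.Fundamental_Theorem_Algebra"
begin

section \<open>Eigenvalues and their elementary symmetric functions\<close>

definition charpoly :: "real^'n^'n \<Rightarrow> complex poly" where
  "charpoly A = det (mat [:0, 1:] - map_matrix (\<lambda>a. [:complex_of_real a:]) A)"

text \<open>An enumeration, by the index type, of the eigenvalues repeated according to algebraic
  multiplicity. They are complex because the partial derivatives of \<open>S\<^sub>k\<close> with respect to
  single matrix entries leave the symmetric matrices. Lemma \<open>image_mset_eigenvalues\<close> below
  shows that such an enumeration exists.\<close>

definition eigenvalues :: "real^'n^'n \<Rightarrow> 'n \<Rightarrow> complex" where
  "eigenvalues A = (SOME l. image_mset l (mset_set UNIV) = proots (charpoly A))"

text \<open>The sum below is real, since the eigenvalues of a real matrix come in conjugate pairs,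
  and it is symmetric, so it does not depend on the enumeration.\<close>

definition S_op :: "nat \<Rightarrow> real^'n^'n \<Rightarrow> real" where
  "S_op k A = Re (\<Sum>X | card X = k. \<Prod>i\<in>X. eigenvalues A i)"

text \<open>The derivative of \<open>S\<^sub>k\<close> with respect to the \<open>(i, j)\<close> entry, the \<open>n\<^sup>2\<close> matrix entries being
  independent variables.\<close>

definition S_entry_deriv :: "nat \<Rightarrow> 'n \<Rightarrow> 'n \<Rightarrow> real^'n^'n \<Rightarrow> real" where
  "S_entry_deriv k i j A =
     deriv (\<lambda>t. S_op k (A + t *\<^sub>R (\<chi> a b. if a = i \<and> b = j then 1 else 0))) 0"

lemma degree_charpoly: "degree (charpoly (A :: real^'n^'n)) = CARD('n)"
proof -
  define M where "M = mat [:0, 1:] - map_matrix (\<lambda>a. [:complex_of_real a:]) A"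
  have M: "M $ i $ j = (if i = j then [:- complex_of_real (A $ i $ i), 1:]
                         else [:- complex_of_real (A $ i $ j):])" for i j
    by (simp add: M_def mat_def)
  define t where "t p = of_int (sign p) * (\<Prod>i\<in>UNIV. M $ i $ p i)" for p
  have id: "degree (t id) = CARD('n)"
    unfolding t_def by (simp add: M degree_prod_sum_eq sign_id)
  have other: "degree (t p) < CARD('n)" if p: "p \<noteq> id" for p
  proof -
    obtain i where i: "p i \<noteq> i" using p by (auto simp: fun_eq_iff)
    have "degree (t p) \<le> degree (\<Prod>i\<in>UNIV. M $ i $ p i)"
      unfolding t_def
      by (metis (no_types, lifting) degree_mult_le degree_of_int add_0)
    also have "\<dots> \<le> (\<Sum>i\<in>UNIV. degree (M $ i $ p i))"
      using degree_prod_sum_le[of UNIV "\<lambda>i. M $ i $ p i"] by (simp add: o_def)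
    also have "\<dots> < (\<Sum>i\<in>(UNIV :: 'n set). 1)"
      by (rule sum_strict_mono_ex1) (use i in \<open>auto simp: M intro!: exI[of _ i]\<close>)
    finally show ?thesis by simp
  qed
  have "charpoly A = (\<Sum>p | p permutes UNIV. t p)"
    unfolding charpoly_def det_def t_def M_def by simp
  also have "\<dots> = t id + (\<Sum>p\<in>{p. p permutes UNIV} - {id}. t p)"
    by (rule sum.remove) (auto simp: permutes_id)
  also have "degree \<dots> = CARD('n)"
  proof -
    have "degree (\<Sum>p\<in>{p. p permutes (UNIV :: 'n set)} - {id}. t p) < CARD('n)"
      by (rule degree_sum_less) (use other in auto)
    then show ?thesis using id by (simp add: degree_add_eq_left)
  qed
  finally show ?thesis .
qed

lemma image_mset_eigenvalues:
  "image_mset (eigenvalues (A :: real^'n^'n)) (mset_set UNIV) = proots (charpoly A)"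
proof -
  obtain xs where xs: "mset xs = proots (charpoly A)" using ex_mset by blast
  have len: "length xs = CARD('n)"
    by (metis xs size_mset size_proots_complex degree_charpoly)
  obtain h where h: "bij_betw h (UNIV :: 'n set) {0..<CARD('n)}"
    using ex_bij_betw_finite_nat[of "UNIV :: 'n set"] by auto
  have "image_mset (\<lambda>i. xs ! h i) (mset_set UNIV)
          = image_mset ((!) xs) (image_mset h (mset_set UNIV))"
    by (simp add: multiset.map_comp o_def)
  also have "image_mset h (mset_set UNIV) = mset_set {0..<length xs}"
    using h by (metis bij_betw_def image_mset_mset_set len)
  also have "image_mset ((!) xs) \<dots> = mset xs"
    by (metis map_nth mset_map mset_upt)
  finally show ?thesis
    unfolding eigenvalues_def using xs by (metis (mono_tags, lifting) someI)
qed

section \<open>Derivatives\<close>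

definition partial_deriv :: "'n \<Rightarrow> (real^'n \<Rightarrow> real) \<Rightarrow> real^'n \<Rightarrow> real" where
  "partial_deriv i f x = deriv (\<lambda>t. f (x + t *\<^sub>R axis i 1)) 0"

definition hessian :: "(real^'n \<Rightarrow> real) \<Rightarrow> real^'n \<Rightarrow> real^'n^'n" where
  "hessian u x = (\<chi> i j. partial_deriv j (partial_deriv i u) x)"

text \<open>The derivative in \<open>r \<in> (0,1]\<close>; it is one-sided at \<open>r = 1\<close>.\<close>

definition rderiv :: "(real \<Rightarrow> real) \<Rightarrow> real \<Rightarrow> real" where
  "rderiv v r = vector_derivative v (at r within {0<..1})"

definition C2_profile :: "(real \<Rightarrow> real) \<Rightarrow> bool" where
  "C2_profile v \<longleftrightarrow>
     v differentiable_on {0<..1} \<and> rderiv v differentiable_on {0<..1} \<and>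
     continuous_on {0<..1} (rderiv (rderiv v))"

text \<open>The space \<open>C\<^sub>c\<^sup>1(\<Omega>)\<close>, its elements being extended by zero to the whole space.\<close>

definition C1_c :: "(real^'n) set \<Rightarrow> (real^'n \<Rightarrow> real) set" where
  "C1_c \<Omega> = {\<psi>. (\<forall>x. \<psi> differentiable at x) \<and> (\<forall>i. continuous_on UNIV (partial_deriv i \<psi>)) \<and>
     compact (closure {x. \<psi> x \<noteq> 0}) \<and> closure {x. \<psi> x \<noteq> 0} \<subseteq> \<Omega>}"

section \<open>Weighted Sobolev spaces\<close>

definition weak_gradient ::
  "(real^'n) set \<Rightarrow> (real^'n \<Rightarrow> real) \<Rightarrow> (real^'n \<Rightarrow> real^'n) \<Rightarrow> bool" where
  "weak_gradient \<Omega> u G \<longleftrightarrow>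
     (\<forall>K. compact K \<and> K \<subseteq> \<Omega> \<longrightarrow> set_integrable lebesgue K u \<and> set_integrable lebesgue K G) \<and>
     (\<forall>\<psi>\<in>C1_c \<Omega>. \<forall>i. (LINT x:\<Omega>|lebesgue. u x * partial_deriv i \<psi> x)
        = - (LINT x:\<Omega>|lebesgue. G x $ i * \<psi> x))"

text \<open>\<open>W\<^sup>1\<^sup>,\<^sup>p(\<Omega>, w)\<close>: the weight is imposed on the gradient only.\<close>

definition weighted_sobolev ::
  "(real^'n) set \<Rightarrow> nat \<Rightarrow> (real^'n \<Rightarrow> real) \<Rightarrow> (real^'n \<Rightarrow> real) set" where
  "weighted_sobolev \<Omega> p w = {u. u \<in> borel_measurable (lebesgue_on \<Omega>) \<and>
     set_integrable lebesgue \<Omega> (\<lambda>x. \<bar>u x\<bar> ^ p) \<and>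
     (\<exists>G. weak_gradient \<Omega> u G \<and> set_integrable lebesgue \<Omega> (\<lambda>x. w x * norm (G x) ^ p))}"

section \<open>Semistable radial solutions\<close>

text \<open>\<open>v\<close> is the function of \<open>r = |x|\<close> which represents \<open>u\<close>.\<close>

definition radial_profile :: "(real^'n \<Rightarrow> real) \<Rightarrow> (real \<Rightarrow> real) \<Rightarrow> bool" where
  "radial_profile u v \<longleftrightarrow> (\<forall>x. 0 < norm x \<and> norm x \<le> 1 \<longrightarrow> u x = v (norm x))"

definition solves :: "nat \<Rightarrow> (real \<Rightarrow> real) \<Rightarrow> (real^'n \<Rightarrow> real) \<Rightarrow> bool" where
  "solves k g u \<longleftrightarrow> (\<forall>x\<in>ball 0 1 - {0}. S_op k (hessian u x) = g (u x))"

definition semistable :: "nat \<Rightarrow> (real \<Rightarrow> real) \<Rightarrow> (real^'n \<Rightarrow> real) \<Rightarrow> bool" where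
  "semistable k g u \<longleftrightarrow>
     (\<forall>\<psi>\<in>C1_c (ball 0 1 - {0}).
        (LINT x:ball 0 1|lebesgue.
           (\<Sum>i\<in>UNIV. \<Sum>j\<in>UNIV.
              partial_deriv i \<psi> x * partial_deriv j \<psi> x * S_entry_deriv k i j (hessian u x))
           + deriv g (u x) * (\<psi> x)\<^sup>2) \<ge> 0)"

definition semistable_radial_solution ::
  "nat \<Rightarrow> (real^'n \<Rightarrow> real) \<Rightarrow> (real \<Rightarrow> real) \<Rightarrow> bool" where
  "semistable_radial_solution k u v \<longleftrightarrow> radial_profile u v \<and> C2_profile v \<and>
     (\<exists>g. (\<forall>s. 0 \<le> g s) \<and> g C1_differentiable_on UNIV \<and> solves k g u \<and> semistable k g u)"

end

theory Submission
  imports Defs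
begin

text \<open>
Write \<open>w = u'\<close> for the radial derivative of a radial function \<open>u\<close>. The theorem holds because
semistability limits the size of \<open>w\<close> but not the size of \<open>w' = u''\<close>. Indeed, for radial test
functions \<open>\<psi> = w \<eta>\<close> the second variation is, with \<open>P = w^(k+1)\<close>, a positive multiple of

  \<open>\<integral> r^(n-k) P \<eta>'^2 - (n-k) r^(n-k-2) P \<eta>^2 - (k-1)/(k+1) r^(n-k-1) P' \<eta>^2 dr\<close>,

and an integration by parts removes \<open>P'\<close>. So once \<open>w\<close> stays close to an explicit function for which
the inequality holds with some room, it may be as steep as one likes. The condition \<open>g \<ge> 0\<close> says
that \<open>r^(n-k) w^k\<close> is nondecreasing, and a steep increase of \<open>w\<close> respects it.

The explicit function has to be chosen with care. The construction makes \<open>S\<^sub>k(D^2 u) = g(u)\<close>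
unbounded near the origin while \<open>g\<close> is \<open>C^1\<close> on the whole line, so \<open>u\<close> has to tend to \<open>-\<infinity>\<close> there
and \<open>w\<close> cannot be much smaller than \<open>1/r\<close>. For \<open>w = 1/r\<close> the inequality above is a Hardy
inequality that holds if and only if \<open>(s-2)^2/4 \<ge> s+1\<close>, where \<open>s = n-2k\<close>; for \<open>s > 2\<close> this means
\<open>s \<ge> 8\<close>, and there is no room if \<open>s = 8\<close>. Dividing by \<open>L r = 1 + ln (1 + 1/r)\<close> produces room of
relative order \<open>1/ln(1/r)\<close> and keeps \<open>u\<close> unbounded. The solutions are therefore given by

  \<open>w = exp (c S) / (r L)\<close>,

where \<open>c > 0\<close> is a small constant and \<open>S\<close> is a nondecreasing \<open>C^2\<close> staircase which increases by \<open>4^(-j)\<close>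
in a short interval around \<open>2^(-j)\<close> (lemma \<open>staircase\<close>). The bound \<open>S r \<le> 4 r\<close> makes the
perturbation fit into the room, and the slope of \<open>S\<close> at \<open>2^(-j)\<close> is at our disposal: given \<open>\<phi>\<close>, it is
chosen so that \<open>u''(2^(-j)) \<ge> j \<phi>(2^(-j))\<close>, which rules out every bound of the form \<open>C \<phi>\<close> near the origin.

Semistability against all test functions, radial or not, is derived from a differential inequality
of Riccati type in the variable \<open>r\<close> (lemma \<open>semistable_radial_solutionI\<close>): it makes the integrand
of the second variation pointwise at least the divergence of a compactly supported \<open>C^1\<close> vector
field, whose integral vanishes. The tangential derivatives of the test function only help, since
\<open>w' \<ge> - w/r\<close> makes the tangential eigenvalue of \<open>S\<^sub>k\<^sup>i\<^sup>j\<close> nonnegative. Lemma \<open>semistable_profile\<close>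
verifies the Riccati inequality for \<open>w\<close>; in the resulting inequality the derivative of \<open>S\<close> cancels.
\<close>

section \<open>The k-Hessian operator at a rank one perturbation of a scalar matrix\<close>

text \<open>The rows in \<open>S\<close> are \<open>e\<^sub>i + u\<^sub>i v\<close>; since \<open>v\<close> itself is row \<open>a\<close>, the summands \<open>u\<^sub>i v\<close> do not
change the determinant.\<close>

lemma det_identity_with_row:
  fixes u v :: "'a::comm_ring_1^'n"
  assumes "finite S" "a \<notin> S"
  shows "det (\<chi> i. if i = a then v else if i \<in> S then axis i 1 + u$i *s v else axis i 1) = v$a"
  using assms
proof (induction S rule: finite_induct)
  case empty
  have E: "v = (\<Sum>j\<in>UNIV. v$j *s axis j 1)"
    by (simp add: vec_eq_iff axis_def if_distrib[where f="\<lambda>x. _ * x"] cong: if_cong)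
  have z: "det (\<chi> i. if i = a then v$j *s axis j 1 else axis i 1) = (if j = a then v$j else 0)" for j
  proof (cases "j = a")
    case True
    have "det (\<chi> i. if i = a then v$a *s axis a (1::'a) else axis i 1)
        = v$a * det (\<chi> i. if i = a then axis a (1::'a) else axis i 1)"
      by (rule det_row_mul)
    also have "(\<chi> i. if i = a then axis a 1 else axis i 1) = (mat 1 :: 'a^'n^'n)"
      by (simp add: vec_eq_iff mat_def axis_def)
    finally show ?thesis unfolding True by simp
  next
    case False
    have "det (\<chi> i. if i = a then axis j (1::'a) else axis i 1) = 0"
      by (rule det_identical_rows[of a j]) (use False in \<open>auto simp: row_def vec_eq_iff\<close>)
    then show ?thesis using False det_row_mul[of a "v$j" "\<lambda>_. axis j (1::'a)" "\<lambda>i. axis i 1"] by simp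
  qed
  have "det (\<chi> i. if i = a then v else axis i 1)
      = det (\<chi> i. if i = a then (\<Sum>j\<in>UNIV. v$j *s axis j 1) else axis i 1)"
    by (subst E) (rule refl)
  also have "\<dots> = (\<Sum>j\<in>UNIV. det (\<chi> i. if i = a then v$j *s axis j 1 else axis i 1))"
    by (rule det_linear_row_sum) simp
  also have "\<dots> = v$a" unfolding z by simp
  finally show ?case by (simp cong: if_cong)
next
  case (insert b S)
  let ?c = "\<lambda>i. if i = a then v else if i \<in> S then axis i 1 + u$i *s v else axis i 1"
  have ab: "a \<noteq> b" using insert.prems by auto
  have "det (\<chi> i. if i = a then v else if i \<in> insert b S then axis i 1 + u$i *s v else axis i 1)
      = det (\<chi> i. if i = b then axis b 1 + u$b *s v else ?c i)"
    using ab insert.hyps by (intro arg_cong[where f=det]) (auto simp: vec_eq_iff)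
  also have "\<dots> = det (\<chi> i. if i = b then axis b 1 else ?c i)
      + det (\<chi> i. if i = b then u$b *s v else ?c i)"
    by (rule det_row_add)
  also have "det (\<chi> i. if i = b then u$b *s v else ?c i) = u$b * det (\<chi> i. if i = b then v else ?c i)"
    by (rule det_row_mul)
  also have "det (\<chi> i. if i = b then v else ?c i) = 0"
    by (rule det_identical_rows[OF ab]) (use ab in \<open>auto simp: row_def vec_eq_iff\<close>)
  also have "(\<chi> i. if i = b then axis b 1 else ?c i) = (\<chi> i. ?c i)"
    using ab insert.hyps by (auto simp: vec_eq_iff)
  finally show ?case using insert by simp
qed

text \<open>The matrix determinant lemma over a commutative ring, by multilinearity in the rows: two rows
that are both replaced by multiples of \<open>v\<close> contribute nothing, which leaves the identity matrix
with at most one row replaced by \<open>v\<close>.\<close>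

lemma det_identity_plus_rank_one:
  fixes u v :: "'a::comm_ring_1^'n"
  shows "det (\<chi> i j. (if i = j then 1 else 0) + u$i * v$j) = 1 + (\<Sum>i\<in>UNIV. u$i * v$i)"
proof -
  have *: "det (\<chi> i. if i \<in> S then axis i 1 + u$i *s v else axis i 1) = 1 + (\<Sum>i\<in>S. u$i * v$i)"
    if "finite S" for S
    using that
  proof (induction S rule: finite_induct)
    case empty
    have "(\<chi> i. axis i 1) = (mat 1 :: 'a^'n^'n)" by (simp add: vec_eq_iff mat_def axis_def)
    then show ?case by simp
  next
    case (insert b S)
    let ?c = "\<lambda>i. if i \<in> S then axis i 1 + u$i *s v else axis i 1"
    have "det (\<chi> i. if i \<in> insert b S then axis i 1 + u$i *s v else axis i 1)
        = det (\<chi> i. if i = b then axis b 1 + u$b *s v else ?c i)"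
      by (intro arg_cong[where f=det]) (auto simp: vec_eq_iff)
    also have "\<dots> = det (\<chi> i. if i = b then axis b 1 else ?c i)
        + det (\<chi> i. if i = b then u$b *s v else ?c i)"
      by (rule det_row_add)
    also have "det (\<chi> i. if i = b then u$b *s v else ?c i) = u$b * det (\<chi> i. if i = b then v else ?c i)"
      by (rule det_row_mul)
    also have "det (\<chi> i. if i = b then v else ?c i) = v$b"
      by (rule det_identity_with_row) (use insert in auto)
    also have "(\<chi> i. if i = b then axis b 1 else ?c i) = (\<chi> i. ?c i)"
      using insert.hyps by (auto simp: vec_eq_iff)
    finally show ?case using insert by (simp add: algebra_simps)
  qed
  have "(\<chi> i j. (if i = j then 1 else 0) + u$i * v$j) = (\<chi> i. if i \<in> UNIV then axis i 1 + u$i *s v else axis i 1)"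
    by (simp add: vec_eq_iff axis_def eq_commute)
  then show ?thesis using *[of UNIV] by simp
qed

text \<open>The derivative of \<open>S\<^sub>k\<close> with respect to a single entry is taken at a scalar matrix plus a multiple
of \<open>x x\<^sup>T\<close>, so the determinant of a scalar matrix minus two rank one matrices is needed. The
matrix \<open>M = s I - \<gamma> x x\<^sup>T\<close> is inverted explicitly, which turns the second rank one term into a
perturbation of the identity.\<close>

lemma det_scalar_minus_rank_two:
  fixes x :: "complex^'n"
  assumes x: "(\<Sum>a\<in>UNIV. x$a * x$a) = 1" and s: "s \<noteq> 0" "s \<noteq> \<gamma>" and n: "CARD('n) \<ge> 2"
  shows "det (\<chi> a b. (if a = b then s else 0) - \<gamma> * x$a * x$b - (if a = i \<and> b = j then t else 0))
    = s ^ (CARD('n) - 2) * (s * (s - \<gamma>) - t * ((if i = j then s - \<gamma> else 0) + \<gamma> * x$i * x$j))"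
proof -
  define M where "M = ((\<chi> a b. (if a = b then s else 0) - \<gamma> * x$a * x$b) :: complex^'n^'n)"
  \<comment> \<open>\<open>c\<close> is column \<open>i\<close> of the inverse of \<open>M\<close>.\<close>
  define c where "c = ((\<chi> a. ((if a = i then 1 else 0) + \<gamma> / (s - \<gamma>) * x$a * x$i) / s) :: complex^'n)"
  have sg: "s - \<gamma> \<noteq> 0" using s by auto
  have xc: "(\<Sum>b\<in>UNIV. x$b * c$b) = x$i / (s - \<gamma>)"
  proof -
    have "(\<Sum>b\<in>UNIV. x$b * c$b) = (\<Sum>b\<in>UNIV. (if b = i then x$i / s else 0) + (\<gamma> / (s - \<gamma>) * x$i / s) * (x$b * x$b))"
      by (intro sum.cong) (auto simp: c_def algebra_simps add_divide_distrib)
    also have "\<dots> = x$i / s + \<gamma> / (s - \<gamma>) * x$i / s"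
      unfolding sum.distrib sum_distrib_left[symmetric] x by simp
    also have "\<dots> = x$i / (s - \<gamma>)" using s sg by (simp add: divide_simps) (simp add: algebra_simps)
    finally show ?thesis .
  qed
  have Mc: "(\<Sum>b\<in>UNIV. M$a$b * c$b) = (if a = i then 1 else 0)" for a
  proof -
    have "(\<Sum>b\<in>UNIV. M$a$b * c$b) = (\<Sum>b\<in>UNIV. (if a = b then s * c$a else 0) - \<gamma> * x$a * (x$b * c$b))"
      by (intro sum.cong) (auto simp: M_def algebra_simps)
    also have "\<dots> = s * c$a - \<gamma> * x$a * (x$i / (s - \<gamma>))"
      by (simp add: sum_subtractf sum_distrib_left[symmetric] xc)
    also have "\<dots> = (if a = i then 1 else 0)"
      using s sg by (simp add: c_def)
    finally show ?thesis .
  qed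
  have detM: "det M = s ^ (CARD('n) - 1) * (s - \<gamma>)"
  proof -
    have "M = (\<chi> a. s *s ((\<chi> a b. (if a = b then 1 else 0) + ((- \<gamma> / s) *s x)$a * x$b) $ a))"
      using s by (auto simp: M_def vec_eq_iff field_simps)
    then have "det M = s ^ CARD('n) * det (\<chi> a b. (if a = b then 1 else 0) + ((- \<gamma> / s) *s x)$a * x$b)"
      using det_rows_mul[of "\<lambda>_. s" "\<lambda>a. (\<chi> a b. (if a = b then 1 else 0) + ((- \<gamma> / s) *s x)$a * x$b) $ a"]
      by simp
    also have "\<dots> = s ^ CARD('n) * (1 + (\<Sum>a\<in>UNIV. (- \<gamma> / s) * (x$a * x$a)))"
      by (subst det_identity_plus_rank_one) (simp add: mult.assoc)
    also have "\<dots> = s ^ CARD('n) * (1 - \<gamma> / s)"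
      unfolding sum_distrib_left[symmetric] x by simp
    also have "\<dots> = s ^ (CARD('n) - 1) * (s - \<gamma>)"
      using s n by (cases "CARD('n)") (auto simp: field_simps)
    finally show ?thesis .
  qed
  have "(\<chi> a b. (if a = b then s else 0) - \<gamma> * x$a * x$b - (if a = i \<and> b = j then t else 0))
    = M ** (\<chi> a b. (if a = b then 1 else 0) + ((- t) *s c)$a * (axis j 1)$b)" (is "?L = ?R")
  proof -
    have "?R $ a $ b = ?L $ a $ b" for a b
    proof -
      have "?R $ a $ b = (\<Sum>d\<in>UNIV. (if d = b then M$a$b else 0) - t * (if b = j then 1 else 0) * (M$a$d * c$d))"
        unfolding matrix_matrix_mult_def vec_lambda_beta
        by (intro sum.cong) (auto simp: axis_def algebra_simps)
      also have "\<dots> = M$a$b - t * (if b = j then 1 else 0) * (if a = i then 1 else 0)"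
        by (simp add: sum_subtractf sum_distrib_left[symmetric] Mc)
      finally show ?thesis by (simp add: M_def)
    qed
    then show ?thesis by (simp add: vec_eq_iff)
  qed
  then have "det ?L = det M * (1 + (\<Sum>a\<in>UNIV. ((- t) *s c)$a * (axis j 1)$a))"
    by (simp only: det_mul det_identity_plus_rank_one)
  also have "(\<Sum>a\<in>UNIV. ((- t) *s c)$a * (axis j 1)$a) = - t * c$j"
    by (simp add: axis_def if_distrib[where f="\<lambda>x. _ * x"] cong: if_cong)
  finally have D: "det ?L = det M * (1 - t * c$j)" by simp
  obtain m where m: "CARD('n) = Suc (Suc m)" using n by (metis add_2_eq_Suc le_Suc_ex)
  have sc: "s * (s - \<gamma>) * c$j = (if i = j then s - \<gamma> else 0) + \<gamma> * x$i * x$j"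
    using s sg by (auto simp: c_def field_simps)
  have "det ?L = s ^ (CARD('n) - 2) * (s * (s - \<gamma>) - t * (s * (s - \<gamma>) * c$j))"
    unfolding D detM m by (simp add: algebra_simps)
  then show ?thesis unfolding sc .
qed

lemma poly_charpoly:
  "poly (charpoly A) z = det (\<chi> a b. (if a = b then z else 0) - complex_of_real (A$a$b))"
proof -
  have 1: "poly ((mat [:0, 1:] - map_matrix (\<lambda>a. [:complex_of_real a:]) A) $ a $ b) z
      = (if a = b then z else 0) - complex_of_real (A$a$b)" for a b
    by (auto simp: mat_def)
  show ?thesis
    unfolding charpoly_def det_def poly_sum poly_mult poly_prod 1 by simp
qed

text \<open>Both sides agree outside the two eigenvalues of the unperturbed matrix, hence as polynomials.\<close>

lemma charpoly_radial:
  fixes x :: "real^'n"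
  assumes x: "norm x = 1" and n: "CARD('n) \<ge> 2"
  shows "charpoly ((\<chi> a b. (if a = b then \<beta> else 0) + \<gamma> * x$a * x$b) +
            t *\<^sub>R (\<chi> a b. if a = i \<and> b = j then 1 else 0))
    = [:- complex_of_real \<beta>, 1:] ^ (CARD('n) - 2) *
      ([:- complex_of_real \<beta>, 1:] * [:- complex_of_real (\<beta> + \<gamma>), 1:]
       - smult (complex_of_real t) ((if i = j then [:- complex_of_real (\<beta> + \<gamma>), 1:] else 0)
           + [:complex_of_real (\<gamma> * x$i * x$j):]))" (is "charpoly ?A = ?p")
proof -
  have xx: "(\<Sum>a\<in>UNIV. complex_of_real (x$a) * complex_of_real (x$a)) = 1"
  proof -
    have "x \<bullet> x = 1" using x by (simp add: norm_eq_1)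
    then have "(\<Sum>a\<in>UNIV. x$a * x$a) = 1" by (simp add: inner_vec_def)
    then have "complex_of_real (\<Sum>a\<in>UNIV. x$a * x$a) = 1" by simp
    then show ?thesis by simp
  qed
  have eq: "poly (charpoly ?A - ?p) z = 0" if z: "z \<noteq> of_real \<beta>" "z \<noteq> of_real (\<beta> + \<gamma>)" for z
  proof -
    have "poly (charpoly ?A) z = det (\<chi> a b. (if a = b then z - of_real \<beta> else 0)
       - of_real \<gamma> * (\<chi> a. complex_of_real (x$a))$a * (\<chi> a. complex_of_real (x$a))$b
       - (if a = i \<and> b = j then of_real t else 0))"
      unfolding poly_charpoly by (intro arg_cong[where f=det]) (auto simp: vec_eq_iff)
    also have "\<dots> = poly ?p z"
      by (subst det_scalar_minus_rank_two) (use z xx n in \<open>auto simp: algebra_simps\<close>)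
    finally show ?thesis by simp
  qed
  have "charpoly ?A - ?p = 0"
  proof (rule ccontr)
    assume "charpoly ?A - ?p \<noteq> 0"
    then have "finite {z. poly (charpoly ?A - ?p) z = 0}" by (rule poly_roots_finite)
    moreover have "UNIV - {of_real \<beta>, of_real (\<beta> + \<gamma>)} \<subseteq> {z. poly (charpoly ?A - ?p) z = 0}"
      using eq by blast
    ultimately have "finite (UNIV - {of_real \<beta>, of_real (\<beta> + \<gamma>)} :: complex set)"
      by (rule finite_subset[rotated])
    then show False by (simp add: infinite_UNIV_char_0)
  qed
  then show ?thesis by simp
qed

text \<open>Vieta's formula.\<close>

lemma S_op_eq_coeff:
  fixes A :: "real^'n^'n"
  assumes monic: "lead_coeff (charpoly A) = 1" and k: "k \<le> CARD('n)"
  shows "S_op k A = Re ((-1) ^ k * coeff (charpoly A) (CARD('n) - k))"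
proof -
  let ?l = "eigenvalues A"
  have "charpoly A = (\<Prod>x\<in>#proots (charpoly A). [:- x, 1:])"
    using complex_poly_decompose_multiset[of "charpoly A"] monic by simp
  also have "\<dots> = (\<Prod>a\<in>UNIV. [:- ?l a, 1:])"
    unfolding image_mset_eigenvalues[symmetric] by (simp add: prod_unfold_prod_mset multiset.map_comp o_def)
  also have "\<dots> = (\<Prod>a\<in>UNIV. [:- ?l a:] + [:0, 1:])" by simp
  also have "\<dots> = (\<Sum>X\<in>Pow UNIV. (\<Prod>a\<in>X. [:- ?l a:]) * (\<Prod>a\<in>UNIV - X. [:0, 1:]))"
    by (rule prod_add) simp
  also have "\<dots> = (\<Sum>X\<in>UNIV. monom ((-1) ^ card X * (\<Prod>a\<in>X. ?l a)) (CARD('n) - card X))"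
  proof (rule sum.cong)
    fix X :: "'n set"
    have "(\<Prod>a\<in>X. [:- ?l a:]) = [:\<Prod>a\<in>X. - ?l a:]"
      by (induction X rule: infinite_finite_induct) auto
    moreover have "(\<Prod>a\<in>X. - ?l a) = (-1) ^ card X * (\<Prod>a\<in>X. ?l a)"
      by (rule prod_uminus)
    moreover have "(\<Prod>a\<in>UNIV - X. [:0, 1::complex:]) = monom 1 (CARD('n) - card X)"
      by (simp add: card_Diff_subset monom_altdef)
    ultimately show "(\<Prod>a\<in>X. [:- ?l a:]) * (\<Prod>a\<in>UNIV - X. [:0, 1:])
        = monom ((-1) ^ card X * (\<Prod>a\<in>X. ?l a)) (CARD('n) - card X)"
      by (simp add: smult_monom)
  qed simp
  finally have "coeff (charpoly A) (CARD('n) - k)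
      = (\<Sum>X\<in>UNIV. if card X = k then (-1) ^ card X * (\<Prod>a\<in>X. ?l a) else 0)"
  proof -
    assume *: "charpoly A = (\<Sum>X\<in>UNIV. monom ((-1) ^ card X * (\<Prod>a\<in>X. ?l a)) (CARD('n) - card X))"
    have "CARD('n) - card X = CARD('n) - k \<longleftrightarrow> card X = k" for X :: "'n set"
      using k card_mono[of UNIV X] by auto
    then show ?thesis by (subst *) (simp add: coeff_sum)
  qed
  also have "\<dots> = (\<Sum>X | card X = k. (-1) ^ k * (\<Prod>a\<in>X. ?l a))"
    by (simp add: sum.If_cases)
  also have "\<dots> = (-1) ^ k * (\<Sum>X | card X = k. \<Prod>a\<in>X. ?l a)"
    by (simp add: sum_distrib_left)
  finally show ?thesis
    unfolding S_op_def by (simp add: mult.assoc[symmetric] power_mult_distrib[symmetric])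
qed

lemma coeff_shift_power:
  fixes b :: complex
  shows "coeff ([:- b, 1:] ^ m) i = of_nat (m choose i) * (- b) ^ (m - i)"
proof (cases "i \<le> m")
  case True
  then show ?thesis by (simp add: coeff_linear_poly_power)
next
  case False
  then have "degree ([:- b, 1:] ^ m) < i" by (simp add: degree_linear_power)
  then show ?thesis using False by (simp add: coeff_eq_0 binomial_eq_0)
qed

text \<open>The characteristic polynomial is affine in \<open>t\<close> and a combination of powers of \<open>X - \<beta>\<close>, so \<open>S\<^sub>k\<close> is
affine in \<open>t\<close> as well and binomial coefficients give it explicitly. The coefficient
\<open>n-2 choose n-k\<close> is the usual \<open>n-2 choose k-2\<close> for \<open>k \<ge> 2\<close>; it is written in this form because it
then vanishes for \<open>k = 1\<close>, where \<open>k - 2\<close> is truncated to \<open>0\<close>.\<close>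

lemma S_op_radial_perturbed:
  fixes x :: "real^'n"
  assumes x: "norm x = 1" and n: "CARD('n) \<ge> 2" and k: "1 \<le> k" "k \<le> CARD('n) - 1"
  shows "S_op k ((\<chi> a b. (if a = b then \<beta> else 0) + \<gamma> * x$a * x$b) +
            t *\<^sub>R (\<chi> a b. if a = i \<and> b = j then 1 else 0))
    = real (CARD('n) choose k) * \<beta>^k + \<gamma> * real ((CARD('n) - 1) choose (k - 1)) * \<beta>^(k-1)
      + t * ((if i = j then real ((CARD('n) - 1) choose (k - 1)) * \<beta>^(k-1) else 0)
          + \<gamma> * (if i = j then 1 else 0) * real ((CARD('n) - 2) choose (CARD('n) - k)) * \<beta>^(k-2)
          - \<gamma> * (x$i * x$j) * real ((CARD('n) - 2) choose (CARD('n) - k)) * \<beta>^(k-2))"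
  (is "S_op k ?A = ?rhs")
proof -
  let ?n = "CARD('n)"
  let ?l = "[:- complex_of_real \<beta>, 1:]"
  define d where "d = (if i = j then 1 else 0 :: real)"
  obtain m where m: "?n = Suc (Suc m)" using n by (metis add_2_eq_Suc le_Suc_ex)
  obtain l where l: "k = Suc l" using k by (cases k) auto
  have lm: "l \<le> m" using k m l by auto
  have "charpoly ?A = ?l ^ m * (?l * (?l - [:of_real \<gamma>:])
      - smult (of_real t) (smult (of_real d) (?l - [:of_real \<gamma>:]) + [:of_real (\<gamma> * x$i * x$j):]))"
    unfolding charpoly_radial[OF x n] by (simp add: m d_def)
  also have "\<dots> = ?l ^ (m + 2) - smult (of_real (\<gamma> + t * d)) (?l ^ (m + 1))
      + smult (of_real (t * \<gamma> * (d - x$i * x$j))) (?l ^ m)"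
    by (subst poly_eq_poly_eq_iff[symmetric], rule ext) (simp add: algebra_simps)
  finally have cp: "charpoly ?A = \<dots>" .
  have monic: "lead_coeff (charpoly ?A) = 1"
  proof -
    have "coeff (charpoly ?A) ?n = 1"
      unfolding cp by (simp only: coeff_add coeff_diff coeff_smult coeff_shift_power m) (simp add: binomial_eq_0)
    then show ?thesis by (simp add: degree_charpoly)
  qed
  have "S_op k ?A = Re ((-1) ^ k * coeff (charpoly ?A) (?n - k))"
    by (rule S_op_eq_coeff[OF monic]) (use k in auto)
  also have "?n - k = m + 1 - l" using m l by simp
  also have "(-1) ^ k * coeff (charpoly ?A) (m + 1 - l) = of_real ?rhs"
  proof -
    have e1: "(m + 2) choose (m + 1 - l) = ?n choose k"
      using binomial_symmetric[of k ?n] k m l by simp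
    have e2: "(m + 1) choose (m + 1 - l) = (?n - 1) choose (k - 1)"
      using binomial_symmetric[of l "m+1"] lm m l by simp
    have e3: "m choose (m + 1 - l) = (?n - 2) choose (?n - k)" using m l by simp
    have p1: "m + 2 - (m + 1 - l) = k" "m + 1 - (m + 1 - l) = k - 1" using lm l by auto
    have q: "(- 1) ^ k * (- complex_of_real \<beta>) ^ k = of_real (\<beta> ^ k)" for k
      by (simp add: power_mult_distrib[symmetric])
    have q1: "(- 1) ^ k * (- complex_of_real \<beta>) ^ (k - 1) = - of_real (\<beta> ^ (k - 1))"
      using q[of l] l by simp
    have q2: "complex_of_real (real (m choose (m + 1 - l))) * ((- 1) ^ k * (- complex_of_real \<beta>) ^ (m - (m + 1 - l)))
        = of_real (real (m choose (m + 1 - l)) * \<beta> ^ (k - 2))"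
    proof (cases l)
      case 0
      then show ?thesis by (simp add: binomial_eq_0)
    next
      case (Suc l')
      then have "m - (m + 1 - l) = l'" using lm by simp
      then show ?thesis using q[of l'] l Suc by simp
    qed
    have "(-1) ^ k * coeff (charpoly ?A) (m + 1 - l)
       = of_nat (?n choose k) * ((- 1) ^ k * (- complex_of_real \<beta>) ^ k)
         - of_real (\<gamma> + t * d) * of_nat ((?n - 1) choose (k - 1)) * ((- 1) ^ k * (- complex_of_real \<beta>) ^ (k - 1))
         + of_real (t * \<gamma> * (d - x$i * x$j)) * (complex_of_real (real (m choose (m + 1 - l))) * ((- 1) ^ k * (- complex_of_real \<beta>) ^ (m - (m + 1 - l))))"
      unfolding cp coeff_add coeff_diff coeff_smult coeff_shift_power e1 e2 p1
      by (simp add: algebra_simps)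
    also have "\<dots> = of_real (real (?n choose k) * \<beta>^k + (\<gamma> + t * d) * real ((?n - 1) choose (k - 1)) * \<beta>^(k-1)
       + t * \<gamma> * (d - x$i * x$j) * (real ((?n - 2) choose (?n - k)) * \<beta> ^ (k - 2)))"
      unfolding q q1 q2 e3[symmetric] by simp
    also have "\<dots> = of_real ?rhs"
      by (rule arg_cong[where f=of_real]) (auto simp: d_def algebra_simps)
    finally show ?thesis .
  qed
  finally show ?thesis by simp
qed

lemma S_op_radial:
  fixes x :: "real^'n"
  assumes x: "norm x = 1" and n: "CARD('n) \<ge> 2" and k: "1 \<le> k" "k \<le> CARD('n) - 1"
  shows "S_op k (\<chi> a b. (if a = b then \<beta> else 0) + \<gamma> * x$a * x$b)
    = real (CARD('n) choose k) * \<beta>^k + \<gamma> * real ((CARD('n) - 1) choose (k - 1)) * \<beta>^(k-1)"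
  using S_op_radial_perturbed[OF assms, of \<beta> \<gamma> 0] by simp

lemma S_entry_deriv_radial:
  fixes x :: "real^'n"
  assumes x: "norm x = 1" and n: "CARD('n) \<ge> 2" and k: "1 \<le> k" "k \<le> CARD('n) - 1"
  shows "S_entry_deriv k i j (\<chi> a b. (if a = b then \<beta> else 0) + \<gamma> * x$a * x$b)
    = (if i = j then real ((CARD('n) - 1) choose (k - 1)) * \<beta>^(k-1) else 0)
          + \<gamma> * (if i = j then 1 else 0) * real ((CARD('n) - 2) choose (CARD('n) - k)) * \<beta>^(k-2)
          - \<gamma> * (x$i * x$j) * real ((CARD('n) - 2) choose (CARD('n) - k)) * \<beta>^(k-2)"
  unfolding S_entry_deriv_def S_op_radial_perturbed[OF assms]
  by (rule DERIV_imp_deriv) (auto intro!: derivative_eq_intros)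

lemma binomial_Suc_ratio: "Suc j * (m choose Suc j) = (m - j) * (m choose j)"
  by (simp only: binomial_absorption binomial_absorb_comp)

lemma binomial_le_Suc:
  assumes "2 * j + 1 \<le> m"
  shows "(m choose j) \<le> (m choose Suc j)"
proof -
  have "Suc j * (m choose j) \<le> (m - j) * (m choose j)" using assms by (intro mult_right_mono) auto
  then have "Suc j * (m choose j) \<le> Suc j * (m choose Suc j)" by (simp only: binomial_Suc_ratio)
  then show ?thesis by (rule mult_left_le_imp_le) simp
qed

text \<open>The form \<open>S\<^sub>k\<^sup>i\<^sup>j\<close> has the radial direction \<open>x\<close> as an eigenvector, and it is a multiple of the
identity on the orthogonal complement of \<open>x\<close>. The lemma says that this multiple is nonnegative;
it holds because \<open>\<gamma> \<ge> - 2 \<beta>\<close> and \<open>n-2 choose k-2\<close> is at most \<open>n-2 choose k-1\<close>.\<close>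

lemma S_quadratic_form_lower_bound:
  fixes x :: "real^'n" and p :: "'n \<Rightarrow> real"
  assumes x: "norm x = 1" and k: "k \<ge> 1" "2 * k \<le> CARD('n)" and n: "CARD('n) \<ge> 2"
    and b: "\<beta> > 0" and g: "\<gamma> \<ge> - 2 * \<beta>"
  shows "real ((CARD('n) - 1) choose (k - 1)) * \<beta> ^ (k - 1) * (\<Sum>i\<in>UNIV. p i * x$i)\<^sup>2
    \<le> (\<Sum>i\<in>UNIV. \<Sum>j\<in>UNIV. p i * p j *
        S_entry_deriv k i j (\<chi> a b. (if a = b then \<beta> else 0) + \<gamma> * x$a * x$b))"
proof -
  define K where "K = real ((CARD('n) - 1) choose (k - 1))"
  define E where "E = \<gamma> * real ((CARD('n) - 2) choose (CARD('n) - k)) * \<beta>^(k-2)"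
  define q where "q = (\<Sum>i\<in>UNIV. p i * x$i)"
  define s where "s = (\<Sum>i\<in>UNIV. p i * p i)"
  have kn: "k \<le> CARD('n) - 1" using k n by auto
  have inner: "(\<Sum>j\<in>UNIV. p i * p j * S_entry_deriv k i j (\<chi> a b. (if a = b then \<beta> else 0) + \<gamma> * x$a * x$b))
      = (K * \<beta>^(k-1) + E) * (p i * p i) - E * (p i * x$i) * q" for i
  proof -
    have "(\<Sum>j\<in>UNIV. p i * p j * S_entry_deriv k i j (\<chi> a b. (if a = b then \<beta> else 0) + \<gamma> * x$a * x$b))
      = (\<Sum>j\<in>UNIV. (if i = j then (K * \<beta>^(k-1) + E) * (p i * p j) else 0) - E * (p i * x$i) * (p j * x$j))"
      unfolding S_entry_deriv_radial[OF x n k(1) kn] K_def[symmetric]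
      by (intro sum.cong refl) (simp add: E_def algebra_simps)
    also have "\<dots> = (K * \<beta>^(k-1) + E) * (p i * p i) - E * (p i * x$i) * q"
      unfolding sum_subtractf sum_distrib_left[symmetric] q_def by simp
    finally show ?thesis .
  qed
  have tot: "(\<Sum>i\<in>UNIV. \<Sum>j\<in>UNIV. p i * p j * S_entry_deriv k i j (\<chi> a b. (if a = b then \<beta> else 0) + \<gamma> * x$a * x$b))
     = (K * \<beta>^(k-1) + E) * s - E * q * q"
  proof -
    have "(\<Sum>i\<in>UNIV. E * (p i * x$i) * q) = E * q * q"
      unfolding sum_distrib_right[symmetric] sum_distrib_left[symmetric] q_def[symmetric] ..
    moreover have "(\<Sum>i\<in>UNIV. (K * \<beta>^(k-1) + E) * (p i * p i)) = (K * \<beta>^(k-1) + E) * s"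
      unfolding sum_distrib_left[symmetric] s_def ..
    ultimately show ?thesis unfolding inner sum_subtractf by simp
  qed
  have cs: "q\<^sup>2 \<le> s"
  proof -
    have "q = (\<chi> i. p i) \<bullet> x" by (simp add: q_def inner_vec_def)
    moreover have "((\<chi> i. p i) \<bullet> x)\<^sup>2 \<le> ((\<chi> i. p i) \<bullet> (\<chi> i. p i)) * (x \<bullet> x)"
      by (rule Cauchy_Schwarz_ineq)
    moreover have "x \<bullet> x = 1" using x by (simp add: norm_eq_1)
    ultimately show ?thesis by (simp add: s_def inner_vec_def)
  qed
  have KE: "K * \<beta>^(k-1) + E \<ge> 0"
  proof (cases "k = 1")
    case True
    then have "((CARD('n) - 2) choose (CARD('n) - k)) = 0" using n by (intro binomial_eq_0) auto
    then have "E = 0" by (simp only: E_def)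
    then show ?thesis using b by (simp add: K_def)
  next
    case False
    then have "k = (k - 2) + 2" using k(1) by simp
    then obtain l where l: "k = l + 2" by blast
    have "CARD('n) = (CARD('n) - 2) + 2" using n by simp
    then obtain m where m: "CARD('n) = m + 2" by blast
    define C where "C = real (m choose l)"
    have lm: "2 * l + 1 \<le> m" using k l m by simp
    have e1: "((CARD('n) - 2) choose (CARD('n) - k)) = m choose l"
      using binomial_symmetric[of l m] lm l m by simp
    have "K = real (m choose Suc l) + C" by (simp add: K_def l m C_def)
    moreover have "real (m choose Suc l) \<ge> C" using binomial_le_Suc[OF lm] by (simp add: C_def)
    ultimately have "K \<ge> 2 * C" by simp
    then have "K * \<beta> ^ Suc l \<ge> (2 * C) * \<beta> ^ Suc l" using b by (intro mult_right_mono) auto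
    moreover have "(2 * C) * \<beta> ^ Suc l = - ((- 2 * \<beta>) * (C * \<beta> ^ l))" by simp
    moreover have "\<gamma> * (C * \<beta> ^ l) \<ge> (- 2 * \<beta>) * (C * \<beta> ^ l)"
      using g b by (intro mult_right_mono) (auto simp: C_def)
    ultimately have "K * \<beta> ^ Suc l + \<gamma> * (C * \<beta> ^ l) \<ge> 0" by linarith
    moreover have "E = \<gamma> * (C * \<beta> ^ l)" unfolding E_def e1 by (simp add: l C_def)
    moreover have "k - 1 = Suc l" using l by simp
    ultimately show ?thesis by (simp only:)
  qed
  have "(K * \<beta>^(k-1) + E) * (s - q\<^sup>2) \<ge> 0" using KE cs by simp
  then show ?thesis unfolding tot K_def[symmetric] q_def[symmetric] by (simp add: algebra_simps power2_eq_square)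
qed

section \<open>Continuously differentiable functions on open sets\<close>

text \<open>The factors by which test functions are multiplied below are singular at the origin or defined on
an open set only; this is \<open>C^1\<close> regularity on that set in terms of partial derivatives.\<close>

definition C1_fun :: "(real^'n) set \<Rightarrow> (real^'n \<Rightarrow> real) \<Rightarrow> bool" where
  "C1_fun \<Omega> h \<longleftrightarrow> (\<forall>x\<in>\<Omega>. h differentiable at x) \<and> (\<forall>i. continuous_on \<Omega> (partial_deriv i h))"

lemma has_derivative_line:
  fixes f :: "real^'n \<Rightarrow> real"
  assumes "(f has_derivative f') (at (x + t *\<^sub>R axis i 1))"
  shows "((\<lambda>t. f (x + t *\<^sub>R axis i 1)) has_real_derivative f' (axis i 1)) (at t)"
proof -
  interpret bounded_linear f' using assms by (rule has_derivative_bounded_linear)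
  have "((\<lambda>t. f (x + t *\<^sub>R axis i 1)) has_derivative (\<lambda>h. f' (h *\<^sub>R axis i 1))) (at t)"
    by (rule has_derivative_compose[of "\<lambda>t. x + t *\<^sub>R axis i 1" _ _ _ f, OF _ assms])
       (auto intro!: derivative_eq_intros)
  then show ?thesis
    by (simp add: has_field_derivative_def scaleR mult.commute[of _ "f' (axis i 1)"])
qed

lemma partial_deriv_eq:
  fixes f :: "real^'n \<Rightarrow> real"
  assumes "(f has_derivative f') (at x)"
  shows "partial_deriv i f x = f' (axis i 1)"
  unfolding partial_deriv_def by (rule DERIV_imp_deriv, rule has_derivative_line) (use assms in simp)

lemma DERIV_partial_deriv:
  fixes f :: "real^'n \<Rightarrow> real"
  assumes "f differentiable at (x + t *\<^sub>R axis i 1)"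
  shows "((\<lambda>t. f (x + t *\<^sub>R axis i 1)) has_real_derivative partial_deriv i f (x + t *\<^sub>R axis i 1)) (at t)"
proof -
  obtain f' where f': "(f has_derivative f') (at (x + t *\<^sub>R axis i 1))"
    using assms by (auto simp: differentiable_def)
  show ?thesis using has_derivative_line[OF f'] partial_deriv_eq[OF f'] by simp
qed

lemma partial_deriv_mult:
  fixes f g :: "real^'n \<Rightarrow> real"
  assumes "f differentiable at x" "g differentiable at x"
  shows "partial_deriv i (\<lambda>x. f x * g x) x = f x * partial_deriv i g x + partial_deriv i f x * g x"
proof -
  obtain f' g' where d: "(f has_derivative f') (at x)" "(g has_derivative g') (at x)"
    using assms by (auto simp: differentiable_def)
  show ?thesis
    using partial_deriv_eq[OF has_derivative_mult[OF d], of i] partial_deriv_eq[OF d(1), of i]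
      partial_deriv_eq[OF d(2), of i] by simp
qed

lemma partial_deriv_cong_open:
  fixes f g :: "real^'n \<Rightarrow> real"
  assumes "open U" "x \<in> U" "\<And>y. y \<in> U \<Longrightarrow> f y = g y" "g differentiable at x"
  shows "partial_deriv i f x = partial_deriv i g x" "f differentiable at x"
proof -
  obtain g' where g: "(g has_derivative g') (at x)" using assms by (auto simp: differentiable_def)
  have f: "(f has_derivative g') (at x)"
    by (rule has_derivative_transform_within_open[OF g assms(1,2)]) (simp add: assms(3))
  show "partial_deriv i f x = partial_deriv i g x"
    using partial_deriv_eq[OF f] partial_deriv_eq[OF g] by simp
  show "f differentiable at x" using f by (auto simp: differentiable_def)
qed

lemma C1_fun_mult:
  assumes "C1_fun \<Omega> f" "C1_fun \<Omega> g"
  shows "C1_fun \<Omega> (\<lambda>x. f x * g x)"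
proof -
  have "continuous_on \<Omega> f" "continuous_on \<Omega> g"
    using assms unfolding C1_fun_def
    by (auto intro!: continuous_at_imp_continuous_on differentiable_imp_continuous_within)
  then have "continuous_on \<Omega> (\<lambda>x. f x * partial_deriv i g x + partial_deriv i f x * g x)" for i
    using assms unfolding C1_fun_def by (intro continuous_on_add continuous_on_mult) auto
  then have "continuous_on \<Omega> (partial_deriv i (\<lambda>x. f x * g x))" for i
    by (rule continuous_on_eq) (use assms in \<open>auto simp: C1_fun_def partial_deriv_mult\<close>)
  then show ?thesis using assms by (auto simp: C1_fun_def)
qed

lemma C1_c_imp_C1_fun:
  assumes "\<psi> \<in> C1_c \<Omega>"
  shows "C1_fun U \<psi>"
proof -
  have "\<psi> differentiable at x" "continuous_on UNIV (partial_deriv i \<psi>)" for x i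
    using assms by (simp_all add: C1_c_def)
  then show ?thesis
    unfolding C1_fun_def by (auto intro: continuous_on_subset[OF _ subset_UNIV])
qed

lemma zero_off_support: "x \<notin> closure {x. \<psi> x \<noteq> 0} \<Longrightarrow> \<psi> x = (0::real)"
  using closure_subset[of "{x. \<psi> x \<noteq> 0}"] by auto

lemma partial_deriv_zero_off_support:
  fixes \<psi> :: "real^'n \<Rightarrow> real"
  assumes x: "x \<notin> closure {x. \<psi> x \<noteq> 0}"
  shows "partial_deriv i \<psi> x = 0" "\<psi> differentiable at x"
proof -
  define U where "U = - closure {x. \<psi> x \<noteq> 0}"
  have U: "open U" "x \<in> U" using x by (auto simp: U_def)
  have eq: "\<psi> y = (\<lambda>_. 0) y" if "y \<in> U" for y
    using zero_off_support[of y \<psi>] that by (simp add: U_def)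
  have z: "((\<lambda>_::real^'n. 0::real) has_derivative (\<lambda>_. 0)) (at x)" by simp
  then have dz: "(\<lambda>_::real^'n. 0::real) differentiable at x" by (auto simp: differentiable_def)
  show "partial_deriv i \<psi> x = 0"
    using partial_deriv_cong_open(1)[OF U eq dz] partial_deriv_eq[OF z] by simp
  show "\<psi> differentiable at x"
    using partial_deriv_cong_open(2)[OF U eq dz] .
qed

text \<open>Near the complement of the support of \<open>\<psi>\<close> the product vanishes, whatever \<open>h\<close> does there; the open
sets \<open>\<Omega>\<close> and \<open>- supp \<psi>\<close> cover the space.\<close>

lemma C1_c_mult:
  fixes \<psi> :: "real^'n \<Rightarrow> real"
  assumes \<Omega>: "open \<Omega>" and psi: "\<psi> \<in> C1_c \<Omega>" and h: "C1_fun \<Omega> h"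
  shows "(\<lambda>x. \<psi> x * h x) \<in> C1_c \<Omega>"
proof -
  let ?f = "\<lambda>x. \<psi> x * h x"
  let ?K = "closure {x. \<psi> x \<noteq> 0}"
  have sub: "closure {x. ?f x \<noteq> 0} \<subseteq> ?K" by (rule closure_mono) auto
  have K: "compact ?K" "?K \<subseteq> \<Omega>" using psi by (auto simp: C1_c_def)
  have C: "C1_fun \<Omega> ?f" by (rule C1_fun_mult[OF C1_c_imp_C1_fun[OF psi] h])
  have off: "partial_deriv i ?f x = 0" "?f differentiable at x" if "x \<in> - ?K" for i x
    using partial_deriv_zero_off_support[of x ?f] that sub by auto
  have "continuous_on (\<Omega> \<union> - ?K) (partial_deriv i ?f)" for i
  proof (rule continuous_on_open_Un)
    show "continuous_on (- ?K) (partial_deriv i ?f)"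
      by (rule continuous_on_eq[of _ "\<lambda>_. 0"]) (use off in auto)
  qed (use C \<Omega> in \<open>auto simp: C1_fun_def\<close>)
  moreover have U: "\<Omega> \<union> - ?K = UNIV" using K by auto
  ultimately have "continuous_on UNIV (partial_deriv i ?f)" for i by simp
  moreover have "?f differentiable at x" for x
    using C off U unfolding C1_fun_def by blast
  moreover have "compact (closure {x. ?f x \<noteq> 0})"
    using bounded_subset[OF compact_imp_bounded[OF K(1)] sub] by (simp add: compact_eq_bounded_closed)
  moreover have "closure {x. ?f x \<noteq> 0} \<subseteq> \<Omega>" using sub K by auto
  ultimately show ?thesis by (simp add: C1_c_def)
qed

lemma integrable_continuous_compact_support:
  fixes f :: "'a::euclidean_space \<Rightarrow> real"
  assumes c: "continuous_on UNIV f" and K: "compact K" "\<And>x. x \<notin> K \<Longrightarrow> f x = 0"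
  shows "integrable lborel f"
proof -
  obtain B where B: "\<And>x. x \<in> K \<Longrightarrow> norm (f x) \<le> B"
    using compact_imp_bounded[OF compact_continuous_image[OF continuous_on_subset[OF c] K(1)]]
    by (auto simp: bounded_iff)
  show ?thesis
  proof (rule Bochner_Integration.integrable_bound)
    show "integrable lborel (\<lambda>x. indicator K x * B)"
      using K(1) emeasure_compact_finite[OF K(1)] borel_compact[OF K(1)]
      by (intro integrable_mult_left integrable_real_indicator) auto
    show "f \<in> borel_measurable lborel"
      using c by (simp add: borel_measurable_continuous_onI)
    show "AE x in lborel. norm (f x) \<le> norm (indicator K x * B)"
    proof (rule AE_I2)
      fix x
      show "norm (f x) \<le> norm (indicator K x * B)"
        using B[of x] K(2)[of x] by (cases "x \<in> K") auto
    qed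
  qed
qed

text \<open>The divergence theorem for compactly supported fields. Lebesgue measure is translation invariant,
so the difference quotients in a coordinate direction integrate to \<open>0\<close>; they converge boundedly,
within a fixed ball, to the partial derivative.\<close>

lemma integral_partial_deriv_eq_0:
  fixes f :: "real^'n \<Rightarrow> real"
  assumes f: "f \<in> C1_c \<Omega>"
  shows "integrable lborel (partial_deriv i f)" "(LINT x|lborel. partial_deriv i f x) = 0"
proof -
  let ?K = "closure {x. f x \<noteq> 0}"
  let ?g = "partial_deriv i f"
  have K: "compact ?K" and d: "\<And>x. f differentiable at x" and cg: "continuous_on UNIV ?g"
    using f by (auto simp: C1_c_def)
  have cf: "continuous_on UNIV f"
    using d by (auto intro!: continuous_at_imp_continuous_on differentiable_imp_continuous_within)
  have g0: "?g x = 0" if "x \<notin> ?K" for x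
    using partial_deriv_zero_off_support that by blast
  show intg: "integrable lborel ?g"
    by (rule integrable_continuous_compact_support[OF cg K g0])
  have intf: "integrable lborel f"
    by (rule integrable_continuous_compact_support[OF cf K]) (rule zero_off_support)
  obtain B0 where B0: "\<And>x. x \<in> ?K \<Longrightarrow> norm (?g x) \<le> B0"
    using compact_imp_bounded[OF compact_continuous_image[OF continuous_on_subset[OF cg] K]]
    by (auto simp: bounded_iff)
  define B where "B = max 0 B0"
  have B: "\<bar>?g x\<bar> \<le> B" for x
    using B0[of x] g0[of x] by (cases "x \<in> ?K") (auto simp: B_def max_def)
  obtain R where R: "?K \<subseteq> cball 0 R" using compact_imp_bounded[OF K] bounded_subset_ballD[of ?K 0] by (meson ball_subset_cball order_trans)
  define e where "e = (axis i 1 :: real^'n)"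
  have ne: "norm e = 1" by (simp add: e_def)
  define D where "D m x = real (Suc m) * (f (x + (1 / real (Suc m)) *\<^sub>R e) - f x)" for m x
  have lip: "\<bar>f (x + h *\<^sub>R e) - f x\<bar> \<le> B * h" if h: "h > 0" for x h
  proof -
    have "\<exists>z. 0 < z \<and> z < h \<and> f (x + h *\<^sub>R e) - f (x + 0 *\<^sub>R e) = (h - 0) * ?g (x + z *\<^sub>R e)"
      by (rule MVT2[OF h]) (use DERIV_partial_deriv[OF d] in \<open>auto simp: e_def\<close>)
    then obtain z where "f (x + h *\<^sub>R e) - f x = h * ?g (x + z *\<^sub>R e)" by auto
    then show ?thesis using B[of "x + z *\<^sub>R e"] h by (simp add: abs_mult)
  qed
  have Dbound: "norm (D m x) \<le> indicator (cball 0 (R + 1)) x * B" for m x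
  proof (cases "x \<in> cball 0 (R + 1)")
    case True
    have "\<bar>D m x\<bar> = real (Suc m) * \<bar>f (x + (1 / real (Suc m)) *\<^sub>R e) - f x\<bar>"
      by (simp add: D_def abs_mult)
    also have "\<dots> \<le> real (Suc m) * (B * (1 / real (Suc m)))"
      by (rule mult_left_mono[OF lip]) auto
    finally show ?thesis using True by simp
  next
    case False
    have n: "norm x > R + 1" using False by auto
    have "x \<notin> ?K" using R n by auto
    moreover have "x + (1 / real (Suc m)) *\<^sub>R e \<notin> ?K"
    proof
      assume "x + (1 / real (Suc m)) *\<^sub>R e \<in> ?K"
      then have "norm (x + (1 / real (Suc m)) *\<^sub>R e) \<le> R" using R by auto
      moreover have "norm ((1 / real (Suc m)) *\<^sub>R e) \<le> 1"
        unfolding norm_scaleR ne by (simp add: divide_le_eq_1)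
      ultimately show False
        using n norm_triangle_ineq4[of "x + (1 / real (Suc m)) *\<^sub>R e" "(1 / real (Suc m)) *\<^sub>R e"]
        unfolding add_diff_cancel_right' by linarith
    qed
    ultimately show ?thesis using zero_off_support[of x f] zero_off_support[of "x + (1 / real (Suc m)) *\<^sub>R e" f] by (simp add: D_def B_def)
  qed
  have transl: "integrable lborel (\<lambda>x. f (x + a))" "(LINT x|lborel. f (x + a)) = (LINT x|lborel. f x)" for a
  proof -
    have m: "f \<in> borel_measurable borel" using cf by (simp add: borel_measurable_continuous_onI)
    have "integrable (distr lborel borel ((+) a)) f" using intf by (subst lborel_distr_plus)
    then show "integrable lborel (\<lambda>x. f (x + a))"
      by (subst (asm) integrable_distr_eq) (use m in \<open>auto simp: add.commute\<close>)
    have "(LINT x|lborel. f x) = (LINT x|distr lborel borel ((+) a). f x)" by (subst lborel_distr_plus) simp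
    then show "(LINT x|lborel. f (x + a)) = (LINT x|lborel. f x)"
      by (subst (asm) integral_distr) (use m in \<open>auto simp: add.commute\<close>)
  qed
  have D0: "(LINT x|lborel. D m x) = 0" for m
    unfolding D_def using transl intf by simp
  have "(\<lambda>m. LINT x|lborel. D m x) \<longlonglongrightarrow> (LINT x|lborel. ?g x)"
  proof (rule integral_dominated_convergence)
    show "?g \<in> borel_measurable lborel" using intg by simp
    show "D m \<in> borel_measurable lborel" for m
      unfolding D_def using transl(1) intf by (auto intro!: borel_measurable_times borel_measurable_diff)
    show "integrable lborel (\<lambda>x. indicator (cball 0 (R + 1)) x * B)"
      by (intro integrable_mult_left integrable_real_indicator emeasure_compact_finite) auto
    show "AE x in lborel. (\<lambda>m. D m x) \<longlonglongrightarrow> ?g x"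
    proof (rule AE_I2)
      fix x
      have "((\<lambda>t. f (x + t *\<^sub>R e)) has_real_derivative ?g x) (at 0)"
        using DERIV_partial_deriv[OF d, where x=x and t=0 and i=i] by (simp add: e_def)
      then have "((\<lambda>h. (f (x + h *\<^sub>R e) - f x) / h) \<longlongrightarrow> ?g x) (at 0)"
        by (simp add: DERIV_def)
      moreover have "filterlim (\<lambda>m. 1 / real (Suc m)) (at 0) sequentially"
        by (rule filterlim_atI) (use LIMSEQ_inverse_real_of_nat in \<open>auto simp: inverse_eq_divide\<close>)
      ultimately have "(\<lambda>m. (f (x + (1 / real (Suc m)) *\<^sub>R e) - f x) / (1 / real (Suc m))) \<longlonglongrightarrow> ?g x"
        by (rule filterlim_compose)
      then show "(\<lambda>m. D m x) \<longlonglongrightarrow> ?g x" by (simp add: D_def mult.commute)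
    qed
    show "AE x in lborel. norm (D m x) \<le> indicator (cball 0 (R + 1)) x * B" for m
      using Dbound by simp
  qed
  then show "(LINT x|lborel. ?g x) = 0" unfolding D0 using LIMSEQ_unique tendsto_const by blast
qed

lemma C1_fun_Un:
  assumes "open U" "open W" "C1_fun U f" "C1_fun W f"
  shows "C1_fun (U \<union> W) f"
  using assms unfolding C1_fun_def by (auto intro: continuous_on_open_Un)

lemma C1_fun_zero_open:
  assumes "open U" "\<And>x. x \<in> U \<Longrightarrow> f x = 0"
  shows "C1_fun U (f :: real^'n \<Rightarrow> real)"
proof -
  have z: "((\<lambda>_::real^'n. 0::real) has_derivative (\<lambda>_. 0)) (at x)" for x by simp
  have dz: "(\<lambda>_::real^'n. 0::real) differentiable at x" for x by simp
  have d: "partial_deriv i f x = 0" "f differentiable at x" if "x \<in> U" for x i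
    using partial_deriv_cong_open[OF assms(1) that _ dz, of f] assms(2) partial_deriv_eq[OF z, of i] by auto
  have "continuous_on U (partial_deriv i f)" for i
    by (rule continuous_on_eq[of _ "\<lambda>_. 0"]) (use d in auto)
  then show ?thesis using d by (auto simp: C1_fun_def)
qed

section \<open>Radial functions\<close>

lemma radial_has_derivative:
  fixes x :: "real^'n"
  assumes "x \<noteq> 0" "(q has_real_derivative d) (at (norm x))"
  shows "((\<lambda>x. q (norm x)) has_derivative (\<lambda>h. d * (x \<bullet> h) / norm x)) (at x)"
proof -
  have "(q has_derivative (\<lambda>h. d * h)) (at (norm x))"
    using assms(2) by (simp add: has_field_derivative_def)
  from has_derivative_compose[OF has_derivative_norm[OF assms(1)] this]
  show ?thesis by (simp add: sgn_div_norm inner_commute divide_inverse algebra_simps)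
qed

lemma radial_partial_deriv:
  fixes x :: "real^'n"
  assumes "x \<noteq> 0" "(q has_real_derivative d) (at (norm x))"
  shows "partial_deriv i (\<lambda>x. q (norm x)) x = d * x$i / norm x"
  using partial_deriv_eq[OF radial_has_derivative[OF assms], of i] by (simp add: inner_axis)

lemma radial_C1_fun:
  fixes \<Omega> :: "(real^'n) set"
  assumes "\<And>x. x \<in> \<Omega> \<Longrightarrow> x \<noteq> 0" "\<And>x. x \<in> \<Omega> \<Longrightarrow> (q has_real_derivative q' (norm x)) (at (norm x))"
    "\<And>x. x \<in> \<Omega> \<Longrightarrow> isCont q' (norm x)"
  shows "C1_fun \<Omega> (\<lambda>x. q (norm x))"
proof -
  have "continuous_on \<Omega> (\<lambda>x. q' (norm x) * x$i / norm x)" for i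
  proof -
    have "isCont (\<lambda>x. q' (norm x)) x" if "x \<in> \<Omega>" for x
      by (rule isCont_o2[where f=norm and g=q' and a=x, OF _ assms(3)[OF that]]) simp
    then have "continuous_on \<Omega> (\<lambda>x. q' (norm x))" by (simp add: continuous_at_imp_continuous_on)
    then show ?thesis using assms(1) by (intro continuous_intros) auto
  qed
  then have "continuous_on \<Omega> (partial_deriv i (\<lambda>x. q (norm x)))" for i
    by (rule continuous_on_eq) (rule radial_partial_deriv[OF assms(1,2), symmetric])
  moreover have "(\<lambda>x. q (norm x)) differentiable at x" if "x \<in> \<Omega>" for x
    using radial_has_derivative[OF assms(1,2), OF that that] unfolding differentiable_def by blast
  ultimately show ?thesis by (auto simp: C1_fun_def)
qed

lemma coord_C1_fun: "C1_fun (\<Omega> :: (real^'n) set) (\<lambda>x. x$i)"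
  and coord_partial_deriv: "partial_deriv j (\<lambda>x :: real^'n. x$i) x = (if i = j then 1 else 0)"
proof -
  have d: "((\<lambda>x. x$i) has_derivative (\<lambda>h. h$i)) (at x)" for x :: "real^'n"
    by (rule bounded_linear.has_derivative[OF bounded_linear_vec_nth]) auto
  have p: "partial_deriv j (\<lambda>x. x$i) x = (if i = j then 1 else 0)" for x :: "real^'n" and j
    using partial_deriv_eq[OF d, of j] by (simp add: axis_def)
  then show "partial_deriv j (\<lambda>x. x$i) x = (if i = j then 1 else 0)" .
  have "partial_deriv j (\<lambda>x::real^'n. x$i) = (\<lambda>x. if i = j then 1 else 0)" for j by (rule ext) (rule p)
  then show "C1_fun \<Omega> (\<lambda>x. x$i)"
    using d by (auto simp: C1_fun_def differentiable_def)
qed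

text \<open>The Hessian has the eigenvalue \<open>q''\<close> in the radial direction and \<open>q'/r\<close> in the others.\<close>

lemma radial_hessian:
  fixes x :: "real^'n"
  assumes x: "x \<noteq> 0"
    and q: "\<And>r. r > 0 \<Longrightarrow> (q has_real_derivative q1 r) (at r)"
    and q1: "\<And>r. r > 0 \<Longrightarrow> (q1 has_real_derivative q2 r) (at r)"
  shows "hessian (\<lambda>x. q (norm x)) x = (\<chi> a b. (if a = b then q1 (norm x) / norm x else 0) +
    (q2 (norm x) - q1 (norm x) / norm x) * (x /\<^sub>R norm x)$a * (x /\<^sub>R norm x)$b)"
proof -
  define p where "p r = q1 r / r" for r
  define p' where "p' r = (q2 r - q1 r / r) / r" for r
  have p: "(p has_real_derivative p' r) (at r)" if "r > 0" for r
    unfolding p_def using q1[OF that] that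
    by (auto intro!: derivative_eq_intros simp: p'_def field_simps power2_eq_square)
  have nx: "norm x > 0" using x by simp
  have e: "partial_deriv i (\<lambda>x. q (norm x)) y = y$i * p (norm y)" if "y \<in> - {0}" for i y
    using radial_partial_deriv[OF _ q, of y i] that by (simp add: p_def)
  have dp: "(\<lambda>y. p (norm y)) differentiable at x"
    using radial_has_derivative[OF x p[OF nx]] by (auto simp: differentiable_def)
  have dc: "(\<lambda>y::real^'n. y$i) differentiable at x" for i using coord_C1_fun[of UNIV i] by (simp add: C1_fun_def)
  have "hessian (\<lambda>x. q (norm x)) x $ i $ j
     = x$i * (p' (norm x) * x$j / norm x) + (if i = j then 1 else 0) * p (norm x)" for i j
  proof -
    have "hessian (\<lambda>x. q (norm x)) x $ i $ j = partial_deriv j (partial_deriv i (\<lambda>x. q (norm x))) x"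
      by (simp add: hessian_def)
    also have "\<dots> = partial_deriv j (\<lambda>y. y$i * p (norm y)) x"
      by (rule partial_deriv_cong_open(1)[of "- {0}"]) (use x e dp dc in auto)
    also have "\<dots> = x$i * partial_deriv j (\<lambda>y. p (norm y)) x + partial_deriv j (\<lambda>y. y$i) x * p (norm x)"
      by (rule partial_deriv_mult[OF dc dp])
    also have "\<dots> = x$i * (p' (norm x) * x$j / norm x) + (if i = j then 1 else 0) * p (norm x)"
      unfolding radial_partial_deriv[OF x p[OF nx]] coord_partial_deriv by simp
    finally show ?thesis .
  qed
  then show ?thesis
    using nx by (auto simp: vec_eq_iff p_def p'_def divide_inverse)
qed

lemma rderiv_eq:
  assumes r: "r \<in> {0<..1}" and q: "(q has_real_derivative d) (at r)"
    and eq: "\<And>s. s \<in> {0<..1} \<Longrightarrow> p s = q s"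
  shows "rderiv p r = d" "p differentiable at r within {0<..1}"
proof -
  have "r islimpt {r/2..r}" using r by simp
  then have "r islimpt {0<..1}" by (rule islimpt_subset) (use r in auto)
  then have nb: "at r within {0<..1} \<noteq> bot" by (simp add: trivial_limit_within)
  have "(q has_vector_derivative d) (at r within {0<..1})"
    using q by (simp add: has_real_derivative_iff_has_vector_derivative has_vector_derivative_at_within)
  then have p: "(p has_vector_derivative d) (at r within {0<..1})"
    using has_vector_derivative_transform[OF r, of p q] eq by blast
  then show "rderiv p r = d" unfolding rderiv_def by (rule vector_derivative_within[OF nb])
  show "p differentiable at r within {0<..1}" using p by (rule differentiableI_vector)
qed

text \<open>An increasing solution defines its nonlinearity through \<open>g(u) = S\<^sub>k(D\<^sup>2 u)\<close>; this inverse function is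
used to do so on the whole line.\<close>

lemma increasing_C1_inverse:
  fixes v w :: "real \<Rightarrow> real"
  assumes v: "\<And>r. r > 0 \<Longrightarrow> (v has_real_derivative w r) (at r)"
    and w: "\<And>r. r > 0 \<Longrightarrow> w r > 0"
    and surj: "\<And>s. \<exists>r>0. v r = s"
  obtains R where "\<And>s. R s > 0" "\<And>s. v (R s) = s" "\<And>r. r > 0 \<Longrightarrow> R (v r) = r"
    "\<And>s. (R has_real_derivative 1 / w (R s)) (at s)"
proof -
  have mono: "v r < v s" if "0 < r" "r < s" for r s
  proof (rule DERIV_pos_imp_increasing[OF that(2)])
    fix x assume "r \<le> x" "x \<le> s"
    then have "x > 0" using that by simp
    then show "\<exists>y. DERIV v x :> y \<and> y > 0" using v w by blast
  qed
  define R where "R s = (SOME r. r > 0 \<and> v r = s)" for s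
  have R: "R s > 0 \<and> v (R s) = s" for s
    unfolding R_def by (rule someI_ex) (use surj in auto)
  have Rv: "R (v r) = r" if "r > 0" for r
    using mono[of r "R (v r)"] mono[of "R (v r)" r] R[of "v r"] that
    by (cases r "R (v r)" rule: linorder_cases) auto
  have cont: "isCont R s" for s
  proof -
    let ?x = "R s"
    have x: "?x > 0" using R by simp
    have "isCont R (v ?x)"
      by (rule isCont_inverse_function2[of "?x / 2" ?x "2 * ?x"])
         (use x Rv in \<open>auto intro!: DERIV_isCont[OF v]\<close>)
    then show ?thesis using R by simp
  qed
  have "(R has_real_derivative inverse (w (R s))) (at s)" for s
    by (rule DERIV_inverse_function[where f=v and g=R and x=s and D="w (R s)" and a="s - 1" and b="s + 1"])
       (use v[of "R s"] R[of s] R cont w[of "R s"] in auto)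
  then have "(R has_real_derivative 1 / w (R s)) (at s)" for s by (simp add: inverse_eq_divide)
  then show ?thesis using that[of R] R Rv by blast
qed

section \<open>Radial functions in the weighted Sobolev space\<close>

text \<open>On the dyadic shell with \<open>2^(-j-1) \<le> |x| < 2^(-j)\<close> the integrand is at most \<open>2^((j+1) m)\<close>, and the
volume of the ball of radius \<open>2^(-j)\<close> is proportional to \<open>2^(-j n)\<close>; as \<open>m < n\<close>, these bounds sum
to a convergent geometric series.\<close>

lemma integrable_inverse_norm_power:
  assumes m: "m < CARD('n)"
  shows "integrable lborel (\<lambda>x::real^'n. indicator (ball 0 1) x / norm x ^ m)"
proof -
  define c where "c j = (2::real) ^ ((j + 1) * m)" for j
  define V where "V = unit_ball_vol (real CARD('n))"
  let ?b = "\<lambda>j. ball (0::real^'n) ((1/2) ^ j)"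
  have le: "ennreal (norm (indicator (ball 0 1) x / norm x ^ m)) \<le> (\<Sum>j. ennreal (c j) * indicator (?b j) x)"
    if x0: "x \<noteq> 0" for x :: "real^'n"
  proof (cases "x \<in> ball 0 1")
    case True
    have nx: "norm x > 0" using x0 by simp
    have ex: "\<exists>j. (1/2::real) ^ (j + 1) \<le> norm x"
    proof -
      obtain N where N: "(1/2::real) ^ N < norm x" using real_arch_pow_inv[OF nx, of "1/2"] by auto
      have "(1/2::real) ^ (N + 1) = (1/2) ^ N / 2" by simp
      then have "(1/2::real) ^ (N + 1) \<le> norm x" using N nx by linarith
      then show ?thesis by blast
    qed
    define j where "j = (LEAST j. (1/2::real) ^ (j + 1) \<le> norm x)"
    have j1: "(1/2::real) ^ (j + 1) \<le> norm x" unfolding j_def using ex by (rule LeastI_ex)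
    have j2: "norm x < (1/2) ^ j"
    proof (cases j)
      case 0
      then show ?thesis using True by simp
    next
      case (Suc i)
      then have "\<not> (1/2::real) ^ (i + 1) \<le> norm x" unfolding j_def using not_less_Least by (metis lessI)
      then show ?thesis using Suc by simp
    qed
    have "1 / norm x ^ m \<le> c j"
    proof -
      have "1 / norm x ^ m \<le> 1 / ((1/2) ^ (j + 1)) ^ m"
        by (intro divide_left_mono power_mono j1 mult_pos_pos) (use nx in auto)
      then show ?thesis by (simp add: c_def power_mult power_add power_one_over)
    qed
    then have "ennreal (norm (indicator (ball 0 1) x / norm x ^ m)) \<le> ennreal (c j)"
      using True by (intro ennreal_leI) simp
    also have "\<dots> = (\<Sum>i\<in>{j}. ennreal (c i) * indicator (?b i) x)" using j2 by simp
    also have "\<dots> \<le> (\<Sum>j. ennreal (c j) * indicator (?b j) x)" by (rule sum_le_suminf) auto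
    finally show ?thesis .
  qed simp
  have meas: "(\<lambda>x::real^'n. indicator (ball 0 1) x / norm x ^ m :: real) \<in> borel_measurable borel"
    by (intro borel_measurable_divide borel_measurable_indicator borel_measurable_power) auto
  have "(\<integral>\<^sup>+x. ennreal (norm (indicator (ball (0::real^'n) 1) x / norm x ^ m)) \<partial>lborel)
      \<le> (\<integral>\<^sup>+x. (\<Sum>j. ennreal (c j) * indicator (?b j) x) \<partial>lborel)"
  proof (rule nn_integral_mono_AE)
    have "AE x in lborel. x \<noteq> (0::real^'n)" by (rule AE_lborel_singleton)
    then show "AE x in lborel. ennreal (norm (indicator (ball 0 1) x / norm x ^ m)) \<le> (\<Sum>j. ennreal (c j) * indicator (?b j) x)"
      using le by (auto elim!: eventually_mono)
  qed
  also have "\<dots> = (\<Sum>j. ennreal (c j) * emeasure lborel (?b j))"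
    by (subst nn_integral_suminf)
       (auto simp: nn_integral_cmult_indicator intro!: borel_measurable_times_ennreal borel_measurable_indicator)
  also have "\<dots> = (\<Sum>j. ennreal (c j * (V * ((1/2) ^ j) ^ CARD('n))))"
    by (intro suminf_cong) (simp add: emeasure_ball V_def ennreal_mult'' c_def)
  also have "\<dots> \<le> (\<Sum>j. ennreal (2 ^ m * V * (1/2) ^ j))"
  proof (intro suminf_le)
    fix j
    have V0: "V \<ge> 0" by (simp add: V_def)
    obtain d where d: "CARD('n) = m + 1 + d" using m by (metis Suc_eq_plus1 less_iff_Suc_add add_Suc add.commute)
    have "c j * ((1/2) ^ j) ^ CARD('n) = 2 ^ m * ((1/2) ^ j * (((1/2) ^ j) ^ d))"
      unfolding c_def d by (simp add: power_add power_mult[symmetric] power_divide field_simps)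
    also have "\<dots> \<le> 2 ^ m * ((1/2) ^ j * 1)"
      by (intro mult_left_mono) (auto intro!: power_le_one)
    finally have "V * (c j * ((1/2) ^ j) ^ CARD('n)) \<le> V * (2 ^ m * (1/2) ^ j)" using V0 by (intro mult_left_mono) auto
    then show "ennreal (c j * (V * ((1/2) ^ j) ^ CARD('n))) \<le> ennreal (2 ^ m * V * (1/2) ^ j)"
      by (intro ennreal_leI) (simp add: algebra_simps)
  qed auto
  also have "\<dots> < \<infinity>"
  proof -
    have "summable (\<lambda>j. 2 ^ m * V * (1/2::real) ^ j)" by (intro summable_mult summable_geometric) simp
    then have "(\<Sum>j. ennreal (2 ^ m * V * (1/2) ^ j)) \<noteq> top"
      by (subst suminf_ennreal2) (auto simp: V_def)
    then show ?thesis by (simp add: less_top)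
  qed
  finally show ?thesis using meas by (simp add: integrable_iff_bounded)
qed

lemma DERIV_max_0_power:
  fixes x :: real
  assumes m: "m \<ge> 1"
  shows "((\<lambda>z. (max 0 z) ^ Suc m) has_real_derivative real (Suc m) * (max 0 x) ^ m) (at x)"
proof (cases x "0::real" rule: linorder_cases)
  case less
  have "((\<lambda>z. (max 0 z) ^ Suc m) has_real_derivative 0) (at x)"
    by (rule has_field_derivative_transform_within_open[of "\<lambda>_. 0" 0 x "{..<0}"])
       (use less in \<open>auto simp: max_def\<close>)
  then show ?thesis using less m by (cases m) auto
next
  case greater
  have "((\<lambda>z. z ^ Suc m) has_real_derivative real (Suc m) * x ^ m) (at x)"
    by (rule DERIV_pow[THEN DERIV_cong]) simp
  then have "((\<lambda>z. (max 0 z) ^ Suc m) has_real_derivative real (Suc m) * x ^ m) (at x)"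
    by (rule has_field_derivative_transform_within_open[where S="{0<..}"])
       (use greater in \<open>auto simp: max_def\<close>)
  then show ?thesis using greater by (simp add: max_def)
next
  case equal
  have "((\<lambda>h::real. (max 0 h) ^ Suc m / h) \<longlongrightarrow> 0) (at 0)"
  proof (rule Lim_null_comparison[where g="\<lambda>h. \<bar>h\<bar> ^ m"])
    show "eventually (\<lambda>h. norm ((max 0 h) ^ Suc m / h) \<le> \<bar>h\<bar> ^ m) (at (0::real))"
      by (rule always_eventually) (auto simp: max_def)
    show "((\<lambda>h::real. \<bar>h\<bar> ^ m) \<longlongrightarrow> 0) (at 0)"
      using m by (auto intro!: tendsto_eq_intros)
  qed
  then show ?thesis using equal m by (cases m) (simp_all add: DERIV_def)
qed

text \<open>A \<open>C^1\<close> function of \<open>r > 0\<close> that vanishes for \<open>r \<le> \<epsilon>\<close>, tends to \<open>1\<close> as \<open>\<epsilon> \<rightarrow> 0\<close>, and whose derivative is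
bounded by \<open>4/r\<close> uniformly in \<open>\<epsilon>\<close>. The quotient is \<open>0\<close> at \<open>r = 0\<close> by the convention
\<open>x / 0 = 0\<close>, as it should be.\<close>

definition cutoff :: "real \<Rightarrow> real \<Rightarrow> real" where
  "cutoff \<epsilon> r = (max 0 ((r\<^sup>2 - \<epsilon>\<^sup>2) / r\<^sup>2))\<^sup>2"

definition cutoff' :: "real \<Rightarrow> real \<Rightarrow> real" where
  "cutoff' \<epsilon> r = 4 * max 0 ((r\<^sup>2 - \<epsilon>\<^sup>2) / r\<^sup>2) * (\<epsilon>\<^sup>2 / r ^ 3)"

lemma cutoff_deriv:
  assumes r: "r > 0"
  shows "(cutoff \<epsilon> has_real_derivative cutoff' \<epsilon> r) (at r)"
proof -
  have "((\<lambda>r. (r\<^sup>2 - \<epsilon>\<^sup>2) / r\<^sup>2) has_real_derivative 2 * \<epsilon>\<^sup>2 / r ^ 3) (at r)"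
    using r by (auto intro!: derivative_eq_intros simp: field_simps power2_eq_square power3_eq_cube power4_eq_xxxx)
  from DERIV_chain2[OF DERIV_max_0_power[of 1] this]
  show ?thesis by (simp add: cutoff_def[abs_def] cutoff'_def numeral_2_eq_2 ac_simps)
qed

lemma cutoff'_cont: "r > 0 \<Longrightarrow> isCont (cutoff' \<epsilon>) r"
  unfolding cutoff'_def[abs_def] by (intro continuous_intros) auto

lemma cutoff_le: "r > 0 \<Longrightarrow> 0 \<le> cutoff \<epsilon> r \<and> cutoff \<epsilon> r \<le> 1"
  unfolding cutoff_def by (auto simp: max_def divide_le_eq zero_le_divide_iff intro!: power_le_one)

lemma cutoff'_le: 
  assumes "r > 0" shows "\<bar>cutoff' \<epsilon> r\<bar> \<le> 4 / r"
proof (cases "r\<^sup>2 \<le> \<epsilon>\<^sup>2")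
  case True
  then have "(r\<^sup>2 - \<epsilon>\<^sup>2) / r\<^sup>2 \<le> 0" using assms by (simp add: divide_le_0_iff)
  then show ?thesis using assms by (simp add: cutoff'_def max_def)
next
  case False
  have a: "max 0 ((r\<^sup>2 - \<epsilon>\<^sup>2) / r\<^sup>2) \<le> 1" "max 0 ((r\<^sup>2 - \<epsilon>\<^sup>2) / r\<^sup>2) \<ge> 0"
    using assms by (auto simp: divide_le_eq)
  have b: "\<epsilon>\<^sup>2 / r ^ 3 \<le> 1 / r" using False assms
    by (simp add: power2_eq_square power3_eq_cube divide_simps mult.commute)
  have "max 0 ((r\<^sup>2 - \<epsilon>\<^sup>2) / r\<^sup>2) * (\<epsilon>\<^sup>2 / r ^ 3) \<le> 1 * (1 / r)"
    by (rule mult_mono[OF a(1) b]) (use assms in auto)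
  moreover have "0 \<le> max 0 ((r\<^sup>2 - \<epsilon>\<^sup>2) / r\<^sup>2) * (\<epsilon>\<^sup>2 / r ^ 3)"
    using a(2) assms by simp
  ultimately show ?thesis by (simp add: cutoff'_def abs_if)
qed

lemma cutoff_zero: "r \<le> \<epsilon> \<Longrightarrow> 0 \<le> r \<Longrightarrow> cutoff \<epsilon> r = 0"
proof -
  assume "r \<le> \<epsilon>" "0 \<le> r"
  then have "r\<^sup>2 \<le> \<epsilon>\<^sup>2" by (intro power_mono) auto
  then have "(r\<^sup>2 - \<epsilon>\<^sup>2) / r\<^sup>2 \<le> 0" by (simp add: divide_le_0_iff)
  then show ?thesis by (simp add: cutoff_def max_def)
qed

lemma cutoff_limits:
  assumes "r > 0"
  shows "(\<lambda>m. cutoff (1 / real (Suc m)) r) \<longlonglongrightarrow> 1" "(\<lambda>m. cutoff' (1 / real (Suc m)) r) \<longlonglongrightarrow> 0"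
proof -
  have e: "(\<lambda>m. 1 / real (Suc m)) \<longlonglongrightarrow> 0" using LIMSEQ_inverse_real_of_nat by (simp add: inverse_eq_divide)
  have "(\<lambda>m. (max 0 ((r\<^sup>2 - (1 / real (Suc m))\<^sup>2) / r\<^sup>2))\<^sup>2) \<longlonglongrightarrow> (max 0 ((r\<^sup>2 - 0\<^sup>2) / r\<^sup>2))\<^sup>2"
    by (intro tendsto_intros e) (use assms in auto)
  then show "(\<lambda>m. cutoff (1 / real (Suc m)) r) \<longlonglongrightarrow> 1" using assms by (simp add: cutoff_def)
  have "(\<lambda>m. 4 * max 0 ((r\<^sup>2 - (1 / real (Suc m))\<^sup>2) / r\<^sup>2) * ((1 / real (Suc m))\<^sup>2 / r ^ 3)) \<longlonglongrightarrow>
     4 * max 0 ((r\<^sup>2 - 0\<^sup>2) / r\<^sup>2) * (0\<^sup>2 / r ^ 3)"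
    by (intro tendsto_intros e) (use assms in auto)
  then show "(\<lambda>m. cutoff' (1 / real (Suc m)) r) \<longlonglongrightarrow> 0" using assms by (simp add: cutoff'_def)
qed
lemma integrable_lebesgue_iff_lborel:
  fixes f :: "real^'n \<Rightarrow> 'b::{banach, second_countable_topology}"
  assumes "f \<in> borel_measurable borel"
  shows "integrable lebesgue f \<longleftrightarrow> integrable lborel f" "integral\<^sup>L lebesgue f = integral\<^sup>L lborel f"
  using assms by (auto intro!: integrable_completion integral_completion)

text \<open>Apply \<open>ln x \<le> x\<close> to \<open>x = r powr (- 1 / (k+1))\<close>.\<close>

lemma ln_power_le:
  fixes r :: real
  assumes r: "0 < r" "r < 1"
  shows "(- ln r) ^ Suc k \<le> real (Suc k) ^ Suc k / r"
proof -
  define x where "x = r powr (- 1 / real (Suc k))"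
  have x: "x > 0" using r by (simp add: x_def)
  have "- ln r = real (Suc k) * ln x" using r by (simp add: x_def ln_powr)
  moreover have "ln x \<le> x" using ln_le_minus_one[OF x] by simp
  ultimately have 1: "- ln r \<le> real (Suc k) * x" by (simp add: mult_left_mono del: of_nat_Suc)
  have "x ^ Suc k = 1 / r"
  proof -
    have "x ^ Suc k = x powr real (Suc k)" by (rule powr_realpow[OF x, symmetric])
    also have "\<dots> = r powr ((- 1 / real (Suc k)) * real (Suc k))" by (simp only: x_def powr_powr)
    also have "(- 1 / real (Suc k)) * real (Suc k) = - 1" by simp
    finally show ?thesis using r by (simp add: powr_minus_divide)
  qed
  moreover have "(- ln r) ^ Suc k \<le> (real (Suc k) * x) ^ Suc k"
    by (rule power_mono[OF 1]) (use r in auto)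
  ultimately show ?thesis by (simp add: power_mult_distrib del: power_Suc of_nat_Suc)
qed

text \<open>A point is removable for functions with these bounds: for a test function \<open>\<psi>\<close> on the whole ball,
the product of \<open>\<psi>\<close>, \<open>u\<close> and a cutoff around the origin is a \<open>C^1\<close> function with compact support, so
its partial derivatives have integral \<open>0\<close>. When the cutoff is removed, the term containing its
derivative tends to \<open>0\<close> pointwise and is dominated by a multiple of \<open>|x|^(-2)\<close>. The weighted
gradient norm is of order \<open>|x|^(-2k)\<close>, which is integrable as \<open>2k < n\<close>.\<close>

lemma radial_weighted_sobolev:
  fixes v w :: "real \<Rightarrow> real" and M :: real and k :: nat
  assumes v: "\<And>r. r > 0 \<Longrightarrow> (v has_real_derivative w r) (at r)"
    and w: "\<And>r. r > 0 \<Longrightarrow> isCont w r"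
    and wM: "\<And>r. 0 < r \<Longrightarrow> r < 1 \<Longrightarrow> \<bar>w r\<bar> \<le> M / r"
    and vM: "\<And>r. 0 < r \<Longrightarrow> r < 1 \<Longrightarrow> \<bar>v r\<bar> \<le> M * (- ln r)"
    and k: "k \<ge> 1" "2 * k < CARD('n)" "3 \<le> CARD('n)"
  shows "(\<lambda>x::real^'n. v (norm x)) \<in> weighted_sobolev (ball 0 1) (k + 1) (\<lambda>x. norm x powr (1 - real k))"
proof -
  let ?B = "ball 0 1 :: (real^'n) set"
  let ?u = "\<lambda>x::real^'n. v (norm x)"
  define G where "G x = (w (norm x) / norm x) *\<^sub>R x" for x :: "real^'n"
  have M0: "M \<ge> 0" using wM[of "1/2"] by simp
  have cont: "continuous_on (- {0}) (\<lambda>x::real^'n. q (norm x))" if "\<And>r. r > 0 \<Longrightarrow> isCont q r" for q :: "real \<Rightarrow> real"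
    by (intro continuous_at_imp_continuous_on ballI)
       (rule isCont_o2[where f=norm and g=q], auto intro: that)
  have vc: "isCont v r" if "r > 0" for r using v[OF that] by (rule DERIV_isCont)
  have um: "?u \<in> borel_measurable borel"
    by (rule borel_measurable_continuous_countable_exceptions[where X="{0}"]) (use cont vc in auto)
  have wm: "(\<lambda>x::real^'n. w (norm x)) \<in> borel_measurable borel"
    by (rule borel_measurable_continuous_countable_exceptions[where X="{0}"]) (use cont w in auto)
  have Gm: "G \<in> borel_measurable borel" unfolding G_def[abs_def] using wm by measurable
  have uB: "\<bar>?u x\<bar> \<le> M / norm x" if "x \<in> ?B" "x \<noteq> 0" for x
  proof -
    have n: "0 < norm x" "norm x < 1" using that by auto
    have "ln (1 / norm x) \<le> 1 / norm x" using ln_le_minus_one[of "1 / norm x"] n by simp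
    then have "- ln (norm x) \<le> 1 / norm x" using n by (simp add: ln_div)
    then have "M * (- ln (norm x)) \<le> M * (1 / norm x)" using M0 by (rule mult_left_mono)
    then show ?thesis using vM[OF n] by simp
  qed
  have GB: "norm (G x) \<le> M / norm x" if "x \<in> ?B" "x \<noteq> 0" for x
    using wM[of "norm x"] that by (simp add: G_def)
  have AE0: "AE x in lborel. x \<noteq> (0::real^'n)" by (rule AE_lborel_singleton)
  have dom: "integrable lborel f"
    if fm: "f \<in> borel_measurable borel" and p: "p < CARD('n)"
      and le: "\<And>x. x \<in> ?B \<Longrightarrow> x \<noteq> 0 \<Longrightarrow> norm (f x) \<le> C / norm x ^ p" and off: "\<And>x. x \<notin> ?B \<Longrightarrow> f x = 0"
    for f :: "real^'n \<Rightarrow> 'b::{banach, second_countable_topology}" and C p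
  proof (rule Bochner_Integration.integrable_bound)
    show "integrable lborel (\<lambda>x::real^'n. C * (indicator ?B x / norm x ^ p))"
      by (intro integrable_mult_right integrable_inverse_norm_power p)
    show "f \<in> borel_measurable lborel" using fm by simp
    have "norm (f x) \<le> norm (C * (indicator ?B x / norm x ^ p))" if "x \<noteq> 0" for x
    proof (cases "x \<in> ?B")
      case True
      then have "norm (f x) \<le> \<bar>C / norm x ^ p\<bar>" using le[OF True that] by linarith
      then show ?thesis using True by simp
    qed (use off in simp)
    then show "AE x in lborel. norm (f x) \<le> norm (C * (indicator ?B x / norm x ^ p))"
      using AE0 by (auto elim!: eventually_mono)
  qed
  have indm: "(\<lambda>x. indicator A x *\<^sub>R f x) \<in> borel_measurable borel"
    if "f \<in> borel_measurable borel" "A \<in> sets borel"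
    for f :: "real^'n \<Rightarrow> 'b::{banach, second_countable_topology}" and A
    using that by simp
  have setint: "set_integrable lebesgue A f"
    if "f \<in> borel_measurable borel" "A \<in> sets borel" "A \<subseteq> ?B" "p < CARD('n)"
      "\<And>x. x \<in> ?B \<Longrightarrow> x \<noteq> 0 \<Longrightarrow> norm (f x) \<le> C / norm x ^ p"
    for f :: "real^'n \<Rightarrow> 'b::{banach, second_countable_topology}" and A C p
    unfolding set_integrable_def integrable_lebesgue_iff_lborel(1)[OF indm[OF that(1,2)]]
  proof (rule dom[of _ p C])
    fix x assume x: "x \<in> ?B" "x \<noteq> 0"
    have "norm (f x) \<le> C / norm x ^ p" by (rule that(5)[OF x])
    moreover have "0 \<le> C / norm x ^ p" using order_trans[OF norm_ge_zero that(5)[OF x]] .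
    ultimately show "norm (indicator A x *\<^sub>R f x) \<le> C / norm x ^ p"
      by (cases "x \<in> A") auto
  qed (use that indm in \<open>auto simp: indicator_def\<close>)
  have p1: "1 < CARD('n)" and p2: "2 < CARD('n)" using k by auto
  have A: "?u \<in> borel_measurable (lebesgue_on ?B)"
    using um by (simp add: measurable_completion measurable_restrict_space1)
  have B: "set_integrable lebesgue ?B (\<lambda>x. \<bar>?u x\<bar> ^ (k + 1))"
  proof (rule setint[of _ _ 1 "M ^ Suc k * real (Suc k) ^ Suc k"])
    fix x assume x: "x \<in> ?B" "x \<noteq> 0"
    then have n: "0 < norm x" "norm x < 1" by auto
    have "\<bar>?u x\<bar> ^ Suc k \<le> (M * (- ln (norm x))) ^ Suc k" by (rule power_mono[OF vM[OF n]]) simp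
    also have "\<dots> = M ^ Suc k * (- ln (norm x)) ^ Suc k" by (rule power_mult_distrib)
    also have "\<dots> \<le> M ^ Suc k * (real (Suc k) ^ Suc k / norm x)"
      by (rule mult_left_mono[OF ln_power_le[OF n]]) (use M0 in simp)
    finally show "norm (\<bar>?u x\<bar> ^ (k + 1)) \<le> M ^ Suc k * real (Suc k) ^ Suc k / norm x ^ 1"
      by (simp add: power_abs)
  qed (use um p1 in auto)
  have C: "set_integrable lebesgue ?B (\<lambda>x. norm x powr (1 - real k) * norm (G x) ^ (k + 1))"
  proof (rule setint[of _ _ "2 * k" "M ^ Suc k"])
    fix x assume x: "x \<in> ?B" "x \<noteq> 0"
    then have n: "0 < norm x" by auto
    have "norm x powr (1 - real k) * norm (G x) ^ Suc k \<le> norm x powr (1 - real k) * (M / norm x) ^ Suc k"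
      by (intro mult_left_mono power_mono GB x) auto
    also have "\<dots> = M ^ Suc k / norm x ^ (2 * k)"
    proof -
      have "norm x powr (1 - real k) = norm x / norm x ^ k"
        using n by (simp add: powr_diff powr_realpow)
      then show ?thesis using n by (simp add: power_divide mult_2 power_add)
    qed
    finally show "norm (norm x powr (1 - real k) * norm (G x) ^ (k + 1)) \<le> M ^ Suc k / norm x ^ (2 * k)"
      by simp
  qed (use Gm k in auto)
  have weak: "weak_gradient ?B ?u G"
    unfolding weak_gradient_def
  proof (intro conjI allI impI ballI)
    fix K assume K: "compact K \<and> K \<subseteq> ?B"
    show "set_integrable lebesgue K ?u"
      by (rule setint[of _ _ 1 M]) (use um K p1 uB in \<open>auto simp: borel_compact\<close>)
    show "set_integrable lebesgue K G"
      by (rule setint[of _ _ 1 M]) (use Gm K p1 GB in \<open>auto simp: borel_compact\<close>)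
  next
    fix \<psi> :: "real^'n \<Rightarrow> real" and i
    assume psi: "\<psi> \<in> C1_c ?B"
    let ?S = "closure {x. \<psi> x \<noteq> 0}"
    let ?d = "partial_deriv i \<psi>"
    have S: "compact ?S" "?S \<subseteq> ?B" using psi by (auto simp: C1_c_def)
    have dpsi: "\<psi> differentiable at x" and cd: "continuous_on UNIV ?d" for x
      using psi by (auto simp: C1_c_def)
    have cpsi: "continuous_on UNIV \<psi>"
      using dpsi by (auto intro!: continuous_at_imp_continuous_on differentiable_imp_continuous_within)
    have off: "\<psi> x = 0" "?d x = 0" if "x \<notin> ?S" for x
      using zero_off_support[OF that] partial_deriv_zero_off_support(1)[OF that] by auto
    have offB: "\<psi> x = 0" "?d x = 0" if "x \<notin> ?B" for x
    proof -
      have "x \<notin> ?S" using S(2) that by blast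
      then show "\<psi> x = 0" "?d x = 0" by (rule off)+
    qed
    have bdd: "\<exists>b\<ge>0. \<forall>x. \<bar>f x\<bar> \<le> b" if c: "continuous_on UNIV f" and z: "\<And>x. x \<notin> ?S \<Longrightarrow> f x = 0" for f :: "real^'n \<Rightarrow> real"
    proof -
      obtain b where b: "\<And>x. x \<in> ?S \<Longrightarrow> norm (f x) \<le> b"
        using compact_imp_bounded[OF compact_continuous_image[OF continuous_on_subset[OF c] S(1)]]
        by (auto simp: bounded_iff)
      have "\<bar>f x\<bar> \<le> max 0 b" for x
        using b[of x] z[of x] by (cases "x \<in> ?S") auto
      then show ?thesis by (intro exI[of _ "max 0 b"]) auto
    qed
    obtain b1 where b1: "b1 \<ge> 0" "\<And>x. \<bar>\<psi> x\<bar> \<le> b1" using bdd[OF cpsi off(1)] by auto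
    obtain b2 where b2: "b2 \<ge> 0" "\<And>x. \<bar>?d x\<bar> \<le> b2" using bdd[OF cd off(2)] by auto
    have psim: "\<psi> \<in> borel_measurable borel" "?d \<in> borel_measurable borel"
      using cpsi cd by (auto intro: borel_measurable_continuous_onI)
    have vnm: "(\<lambda>x::real^'n. x $ i) \<in> borel_measurable borel"
      by (rule borel_measurable_continuous_onI) (intro continuous_intros)
    define \<epsilon> where "\<epsilon> m = 1 / real (Suc m)" for m
    define F where "F m x = \<psi> x * ((cutoff' (\<epsilon> m) (norm x) * v (norm x) + cutoff (\<epsilon> m) (norm x) * w (norm x)) * x$i / norm x)
        + ?d x * (cutoff (\<epsilon> m) (norm x) * v (norm x))" for m x
    define F0 where "F0 x = \<psi> x * (w (norm x) * x$i / norm x) + ?d x * v (norm x)" for x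
    have F0': "F0 x = G x $ i * \<psi> x + ?u x * ?d x" for x by (simp add: F0_def G_def)
    have cm: "(\<lambda>x::real^'n. q (norm x)) \<in> borel_measurable borel" if "\<And>r. r > 0 \<Longrightarrow> isCont q r" for q :: "real \<Rightarrow> real"
      by (rule borel_measurable_continuous_countable_exceptions[where X="{0}"]) (use cont that in auto)
    have cutm: "(\<lambda>x::real^'n. cutoff e (norm x)) \<in> borel_measurable borel"
         "(\<lambda>x::real^'n. cutoff' e (norm x)) \<in> borel_measurable borel" for e
      using cm[OF DERIV_isCont[OF cutoff_deriv]] cm[OF cutoff'_cont] by auto
    \<comment> \<open>\<open>F m\<close> is the partial derivative of \<open>\<psi>\<close> times cutoff times \<open>u\<close>, written out away from the origin.\<close>
    have F_int: "(LINT x|lborel. F m x) = 0" for m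
    proof -
      define P where "P r = cutoff (\<epsilon> m) r * v r" for r
      define P' where "P' r = cutoff' (\<epsilon> m) r * v r + cutoff (\<epsilon> m) r * w r" for r
      have e0: "\<epsilon> m > 0" by (simp add: \<epsilon>_def)
      have P: "(P has_real_derivative P' r) (at r)" if "r > 0" for r
        unfolding P_def P'_def using DERIV_mult'[OF cutoff_deriv[OF that] v[OF that]] by (simp add: add.commute)
      have P'c: "isCont P' r" if "r > 0" for r
        unfolding P'_def
        by (intro continuous_intros cutoff'_cont that vc w DERIV_isCont[OF cutoff_deriv])
      have C1: "C1_fun (- {0}) (\<lambda>x::real^'n. P (norm x))"
        by (rule radial_C1_fun[of _ P P']) (use P P'c in auto)
      have C2: "C1_fun (ball 0 (\<epsilon> m)) (\<lambda>x::real^'n. P (norm x))"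
        by (rule C1_fun_zero_open) (auto simp: P_def cutoff_zero)
      have "- {0} \<union> ball (0::real^'n) (\<epsilon> m) = UNIV" using e0 by auto
      then have C3: "C1_fun (UNIV :: (real^'n) set) (\<lambda>x. P (norm x))" using C1_fun_Un[OF open_Compl[OF closed_singleton] open_ball C1 C2] by simp
      have dP: "(\<lambda>x::real^'n. P (norm x)) differentiable at x" for x using C3 by (simp add: C1_fun_def)
      have "C1_fun ?B (\<lambda>x. P (norm x))" using C3 by (auto simp: C1_fun_def intro: continuous_on_subset[OF _ subset_UNIV])
      then have C4: "(\<lambda>x. \<psi> x * P (norm x)) \<in> C1_c ?B" by (rule C1_c_mult[OF open_ball psi])
      have eq: "partial_deriv i (\<lambda>x. \<psi> x * P (norm x)) x = F m x" if "x \<noteq> 0" for x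
        using radial_partial_deriv[OF that P, of i] that
        by (subst partial_deriv_mult[OF dpsi dP]) (simp add: F_def P_def P'_def)
      have "(LINT x|lborel. F m x) = (LINT x|lborel. partial_deriv i (\<lambda>x. \<psi> x * P (norm x)) x)"
      proof (rule integral_cong_AE)
        show "F m \<in> borel_measurable lborel" unfolding F_def[abs_def]
          using psim vnm cutm um wm by measurable
        show "partial_deriv i (\<lambda>x. \<psi> x * P (norm x)) \<in> borel_measurable lborel"
          using integral_partial_deriv_eq_0(1)[OF C4, of i] by simp
        show "AE x in lborel. F m x = partial_deriv i (\<lambda>x. \<psi> x * P (norm x)) x"
          using AE0 by (rule eventually_mono) (simp add: eq)
      qed
      then show ?thesis using integral_partial_deriv_eq_0(2)[OF C4, of i] by simp
    qed
    let ?D = "b1 * (5 * M) + b2 * M"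
    have "(\<lambda>m. LINT x|lborel. F m x) \<longlonglongrightarrow> (LINT x|lborel. F0 x)"
    proof (rule integral_dominated_convergence)
      show "F0 \<in> borel_measurable lborel" unfolding F0_def[abs_def] using psim vnm um wm by measurable
      show "F m \<in> borel_measurable lborel" for m
        unfolding F_def[abs_def] using psim vnm cutm um wm by measurable
      show "integrable lborel (\<lambda>x::real^'n. ?D * (indicator ?B x / norm x ^ 2))"
        by (intro integrable_mult_right integrable_inverse_norm_power p2)
      show "AE x in lborel. (\<lambda>m. F m x) \<longlonglongrightarrow> F0 x"
      proof (rule eventually_mono[OF AE0])
        fix x :: "real^'n" assume x: "x \<noteq> 0"
        have "(\<lambda>m. F m x) \<longlonglongrightarrow> \<psi> x * ((0 * v (norm x) + 1 * w (norm x)) * x$i / norm x) + ?d x * (1 * v (norm x))"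
          unfolding F_def \<epsilon>_def using x by (intro tendsto_intros cutoff_limits) auto
        then show "(\<lambda>m. F m x) \<longlonglongrightarrow> F0 x" by (simp add: F0_def)
      qed
      show "AE x in lborel. norm (F m x) \<le> ?D * (indicator ?B x / norm x ^ 2)" for m
      proof (rule eventually_mono[OF AE0])
        fix x :: "real^'n" assume x: "x \<noteq> 0"
        show "norm (F m x) \<le> ?D * (indicator ?B x / norm x ^ 2)"
        proof (cases "x \<in> ?B")
          case False
          then show ?thesis using offB[OF False] by (simp add: F_def)
        next
          case True
          define r where "r = norm x"
          have r: "0 < r" "r < 1" using x True by (auto simp: r_def)
          have u: "\<bar>v r\<bar> \<le> M / r" using uB[OF True x] by (simp add: r_def)
          have ww: "\<bar>w r\<bar> \<le> M / r" by (rule wM[OF r])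
          have rr: "1 / r \<le> 1 / r\<^sup>2" using r by (simp add: divide_simps power2_eq_square)
          have xi: "\<bar>x$i / r\<bar> \<le> 1" using component_le_norm_cart[of x i] r by (simp add: r_def)
          have t1: "\<bar>cutoff' (\<epsilon> m) r * v r\<bar> \<le> (4 / r) * (M / r)"
            unfolding abs_mult by (rule mult_mono[OF cutoff'_le u]) (use r in auto)
          have c: "\<bar>cutoff (\<epsilon> m) r\<bar> \<le> 1" using cutoff_le[of r "\<epsilon> m"] r by auto
          have t2: "\<bar>cutoff (\<epsilon> m) r * w r\<bar> \<le> 1 * (M / r)"
            unfolding abs_mult by (rule mult_mono[OF c ww]) auto
          have t3: "\<bar>cutoff (\<epsilon> m) r * v r\<bar> \<le> 1 * (M / r)"
            unfolding abs_mult by (rule mult_mono[OF c u]) auto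
          have Mr: "M / r \<le> M / r\<^sup>2" using mult_left_mono[OF rr M0] by simp
          have t4: "\<bar>cutoff' (\<epsilon> m) r * v r + cutoff (\<epsilon> m) r * w r\<bar> \<le> 5 * M / r\<^sup>2"
            using abs_triangle_ineq[of "cutoff' (\<epsilon> m) r * v r" "cutoff (\<epsilon> m) r * w r"] t1 t2 Mr
            by (simp add: power2_eq_square)
          have "\<bar>(cutoff' (\<epsilon> m) r * v r + cutoff (\<epsilon> m) r * w r) * (x$i / r)\<bar> \<le> (5 * M / r\<^sup>2) * 1"
            unfolding abs_mult by (rule mult_mono[OF t4 xi]) (use M0 in auto)
          then have t5: "\<bar>\<psi> x * ((cutoff' (\<epsilon> m) r * v r + cutoff (\<epsilon> m) r * w r) * (x$i / r))\<bar> \<le> b1 * (5 * M / r\<^sup>2)"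
            unfolding abs_mult by (intro mult_mono b1) (auto simp: abs_mult)
          have t6: "\<bar>?d x * (cutoff (\<epsilon> m) r * v r)\<bar> \<le> b2 * (M / r\<^sup>2)"
            unfolding abs_mult[of "?d x"] using t3 Mr by (intro mult_mono b2) auto
          have "\<bar>F m x\<bar> \<le> b1 * (5 * M / r\<^sup>2) + b2 * (M / r\<^sup>2)"
            using abs_triangle_ineq[of "\<psi> x * ((cutoff' (\<epsilon> m) r * v r + cutoff (\<epsilon> m) r * w r) * (x$i / r))"
               "?d x * (cutoff (\<epsilon> m) r * v r)"] t5 t6
            unfolding F_def r_def[symmetric] by simp
          also have "\<dots> = ?D * (indicator ?B x / r ^ 2)" using True by (simp add: add_divide_distrib)
          finally show ?thesis by (simp add: r_def)
        qed
      qed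
    qed
    then have F0_int: "(LINT x|lborel. F0 x) = 0" unfolding F_int using LIMSEQ_unique tendsto_const by blast
    have i1: "integrable lborel (\<lambda>x. G x $ i * \<psi> x)"
    proof (rule dom[of _ 1 "M * b1"])
      show "(\<lambda>x. G x $ i * \<psi> x) \<in> borel_measurable borel"
        by (intro borel_measurable_times measurable_compose[OF Gm vnm] psim)
      fix x assume x: "x \<in> ?B" "x \<noteq> 0"
      have "\<bar>G x $ i\<bar> \<le> M / norm x" using component_le_norm_cart[of "G x" i] GB[OF x] by linarith
      then have "\<bar>G x $ i * \<psi> x\<bar> \<le> M / norm x * b1" unfolding abs_mult by (intro mult_mono b1) (use M0 in auto)
      then show "norm (G x $ i * \<psi> x) \<le> M * b1 / norm x ^ 1" by simp
    qed (use p1 offB in auto)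
    have i2: "integrable lborel (\<lambda>x. ?u x * ?d x)"
    proof (rule dom[of _ 1 "M * b2"])
      show "(\<lambda>x. ?u x * ?d x) \<in> borel_measurable borel" using um psim by measurable
      fix x assume x: "x \<in> ?B" "x \<noteq> 0"
      have "\<bar>?u x * ?d x\<bar> \<le> M / norm x * b2" unfolding abs_mult by (intro mult_mono b2 uB x) (use M0 in auto)
      then show "norm (?u x * ?d x) \<le> M * b2 / norm x ^ 1" by simp
    qed (use p1 offB in auto)
    have "(LINT x|lborel. F0 x) = (LINT x|lborel. G x $ i * \<psi> x) + (LINT x|lborel. ?u x * ?d x)"
      unfolding F0' using i1 i2 by simp
    moreover have setL: "(LINT x:?B|lebesgue. f x) = (LINT x|lborel. f x)"
      if fm: "integrable lborel f" and z: "\<And>x. x \<notin> ?B \<Longrightarrow> f x = 0" for f :: "real^'n \<Rightarrow> real"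
    proof -
      have "(\<lambda>x. indicator ?B x *\<^sub>R f x) = f" by (rule ext) (use z in \<open>auto simp: indicator_def\<close>)
      then show ?thesis using integrable_lebesgue_iff_lborel(2)[of f] fm
        by (simp add: set_lebesgue_integral_def)
    qed
    moreover have "(LINT x:?B|lebesgue. G x $ i * \<psi> x) = (LINT x|lborel. G x $ i * \<psi> x)"
      by (rule setL[OF i1]) (use offB in auto)
    moreover have "(LINT x:?B|lebesgue. ?u x * ?d x) = (LINT x|lborel. ?u x * ?d x)"
      by (rule setL[OF i2]) (use offB in auto)
    ultimately show "(LINT x:?B|lebesgue. ?u x * ?d x) = - (LINT x:?B|lebesgue. G x $ i * \<psi> x)"
      using F0_int by linarith
  qed
  show ?thesis unfolding weighted_sobolev_def using A B C weak by blast
qed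

section \<open>A Riccati criterion for semistability\<close>

lemma ratio_power_deriv:
  fixes w w1 :: "real \<Rightarrow> real"
  assumes k: "k \<ge> 1" and r: "r > 0" and w0: "w r > 0" and w: "(w has_real_derivative w1 r) (at r)"
  shows "((\<lambda>r. (w r / r) ^ (k - 1)) has_real_derivative
      (w r / r) ^ (k - 1) * ((real k - 1) * (w1 r / w r - 1 / r))) (at r)"
proof (cases "k - 1")
  case 0
  then have "k = 1" using k by simp
  then show ?thesis by simp
next
  case (Suc m)
  have b: "((\<lambda>r. w r / r) has_real_derivative (w1 r / r - w r / r\<^sup>2)) (at r)"
    using w r by (auto intro!: derivative_eq_intros simp: field_simps power2_eq_square)
  have rk: "real k - 1 = 1 + real m" using Suc by simp
  show ?thesis
    unfolding Suc rk
    by (rule DERIV_cong[OF DERIV_power_Suc[OF b]]) (use r w0 in \<open>simp add: field_simps power2_eq_square\<close>)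
qed

text \<open>With \<open>c = (n-k)/k\<close> and \<open>K = (n-1 choose k-1)\<close> the function differentiated here is the operator \<open>S\<^sub>k\<close>
of the Hessian of a radial function whose radial derivative is \<open>w\<close>.\<close>

lemma radial_S_op_deriv:
  fixes w w1 w2 :: "real \<Rightarrow> real"
  assumes k: "k \<ge> 1" and r: "r > 0" and w0: "w r > 0"
    and w: "(w has_real_derivative w1 r) (at r)" and w1: "(w1 has_real_derivative w2 r) (at r)"
  shows "((\<lambda>r. K * (w r / r) ^ (k - 1) * (c * (w r / r) + w1 r)) has_real_derivative
     K * (w r / r) ^ (k - 1) * ((real k - 1) * (w1 r / w r - 1 / r) * (c * (w r / r) + w1 r)
        + c * (w1 r / r - w r / r\<^sup>2) + w2 r)) (at r)"
proof -
  have b: "((\<lambda>r. w r / r) has_real_derivative (w1 r / r - w r / r\<^sup>2)) (at r)"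
    using w r by (auto intro!: derivative_eq_intros simp: field_simps power2_eq_square)
  note bp = ratio_power_deriv[where w=w and ?w1.0=w1, OF k r w0 w]
  show ?thesis
    by (rule DERIV_cong[OF DERIV_mult[OF DERIV_mult[OF DERIV_const bp] DERIV_add[OF DERIV_mult[OF DERIV_const b] w1]]])
       (simp add: algebra_simps add_divide_distrib diff_divide_distrib)
qed

text \<open>Let \<open>A = (n-1 choose k-1) (w/r)^(k-1)\<close>, the radial eigenvalue of \<open>S\<^sub>k\<^sup>i\<^sup>j\<close>, and let \<open>\<psi>\<^sub>r\<close> be the
radial derivative of a test function \<open>\<psi>\<close>. The integrand of the second variation is at least
\<open>A \<psi>\<^sub>r\<^sup>2 + g'(u) \<psi>\<^sup>2\<close>. From \<open>A (\<psi>\<^sub>r - F \<psi>)\<^sup>2 \<ge> 0\<close> one gets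

  \<open>A \<psi>\<^sub>r\<^sup>2 \<ge> div (\<psi>\<^sup>2 A F x/r) - (r\<^sup>1\<^sup>-\<^sup>n (r\<^sup>n\<^sup>-\<^sup>1 A F)' + A F\<^sup>2) \<psi>\<^sup>2\<close>,

so it suffices that \<open>g'(u)\<close> is at least \<open>r\<^sup>1\<^sup>-\<^sup>n (r\<^sup>n\<^sup>-\<^sup>1 A F)' + A F\<^sup>2\<close>. Divided by \<open>A\<close>, this is
assumption \<open>riccati\<close>; its right-hand side is \<open>g'(u)/A\<close>, expressed by the logarithmic derivative
\<open>w1/w\<close> and its derivative \<open>w2/w - (w1/w)\<^sup>2\<close>. Since \<open>v\<close> maps \<open>(0,\<infinity>)\<close> onto the real line, \<open>g\<close> is
defined everywhere by composing \<open>S\<^sub>k\<close> with the inverse of \<open>v\<close>.\<close>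

lemma semistable_radial_solutionI:
  fixes v w w1 w2 F F1 :: "real \<Rightarrow> real" and k :: nat
  assumes k: "k \<ge> 1" "2 * k \<le> CARD('n)" and n: "CARD('n) \<ge> 2"
    and v: "\<And>r. r > 0 \<Longrightarrow> (v has_real_derivative w r) (at r)"
    and w: "\<And>r. r > 0 \<Longrightarrow> (w has_real_derivative w1 r) (at r)"
    and w1: "\<And>r. r > 0 \<Longrightarrow> (w1 has_real_derivative w2 r) (at r)"
    and w2: "\<And>r. r > 0 \<Longrightarrow> isCont w2 r"
    and w0: "\<And>r. r > 0 \<Longrightarrow> w r > 0"
    and surj: "\<And>s. \<exists>r>0. v r = s"
    and slope: "\<And>r. r > 0 \<Longrightarrow> w1 r \<ge> - (w r / r)"
    and F: "\<And>r. r > 0 \<Longrightarrow> (F has_real_derivative F1 r) (at r)"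
    and F1: "\<And>r. r > 0 \<Longrightarrow> isCont F1 r"
    and riccati: "\<And>r. 0 < r \<Longrightarrow> r < 1 \<Longrightarrow>
       (real CARD('n) - 1) * F r / r + (real k - 1) * (w1 r / w r - 1 / r) * F r + F1 r + (F r)\<^sup>2
       \<le> real k * (w1 r / w r)\<^sup>2 + (real CARD('n) - 2 * real k + 1) * (w1 r / w r) / r
          - (real CARD('n) - real k) / r\<^sup>2 + (w2 r / w r - (w1 r / w r)\<^sup>2)"
  shows "semistable_radial_solution k (\<lambda>x::real^'n. v (norm x)) v"
proof -
  let ?u = "\<lambda>x::real^'n. v (norm x)"
  let ?B = "ball 0 1 - {0} :: (real^'n) set"
  define n where "n = real CARD('n)"
  define K where "K = real ((CARD('n) - 1) choose (k - 1))"
  define c where "c = (n - real k) / real k"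
  define A where "A r = K * (w r / r) ^ (k - 1)" for r
  define \<sigma> where "\<sigma> r = A r * (c * (w r / r) + w1 r)" for r
  define \<sigma>1 where "\<sigma>1 r = A r * ((real k - 1) * (w1 r / w r - 1 / r) * (c * (w r / r) + w1 r)
        + c * (w1 r / r - w r / r\<^sup>2) + w2 r)" for r
  have k0: "real k > 0" using k by simp
  have nk: "n \<ge> 2 * real k" using k by (simp add: n_def)
  have c1: "c \<ge> 1" using nk k0 by (simp add: c_def le_divide_eq)
  have kn: "k \<le> CARD('n) - 1" using k n by auto
  have K0: "K > 0" using kn by (simp add: K_def)
  have A0: "A r > 0" if "r > 0" for r using K0 w0[OF that] that by (simp add: A_def)
  have \<sigma>_pos: "\<sigma> r \<ge> 0" if r: "r > 0" for r
  proof -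
    have "1 * (w r / r) \<le> c * (w r / r)" by (rule mult_right_mono[OF c1]) (use w0[OF r] r in simp)
    then have "c * (w r / r) + w1 r \<ge> 0" using slope[OF r] by linarith
    then show ?thesis using A0[OF r] by (simp add: \<sigma>_def)
  qed
  have \<sigma>_deriv: "(\<sigma> has_real_derivative \<sigma>1 r) (at r)" if r: "r > 0" for r
    unfolding \<sigma>_def[abs_def] \<sigma>1_def A_def
    by (rule radial_S_op_deriv[where w=w and ?w1.0=w1 and ?w2.0=w2, OF k(1) r w0[OF r] w[OF r] w1[OF r]])
  have cont: "isCont v r" "isCont w r" "isCont w1 r" "isCont F r" if "r > 0" for r
    using DERIV_isCont[OF v] DERIV_isCont[OF w] DERIV_isCont[OF w1] DERIV_isCont[OF F] that by auto
  have \<sigma>1_cont: "isCont \<sigma>1 r" if r: "r > 0" for r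
    unfolding \<sigma>1_def[abs_def] A_def
    by (intro continuous_intros cont w2 r) (use w0[OF r] r in auto)
  obtain R where R: "\<And>s. R s > 0" "\<And>s. v (R s) = s" "\<And>r. r > 0 \<Longrightarrow> R (v r) = r"
    "\<And>s. (R has_real_derivative 1 / w (R s)) (at s)"
    using increasing_C1_inverse[OF v w0 surj] by blast
  define g where "g s = \<sigma> (R s)" for s
  have g_deriv: "(g has_real_derivative \<sigma>1 (R s) / w (R s)) (at s)" for s
    unfolding g_def[abs_def] using DERIV_chain2[OF \<sigma>_deriv[OF R(1)] R(4)] by simp
  have g_pos: "0 \<le> g s" for s using \<sigma>_pos[OF R(1)] by (simp add: g_def)
  have g_C1: "g C1_differentiable_on UNIV"
  proof -
    have Rc: "isCont R s" for s using DERIV_isCont[OF R(4)] .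
    have "isCont (\<lambda>s. \<sigma>1 (R s) / w (R s)) s" for s
      using isCont_o2[OF Rc \<sigma>1_cont[OF R(1)]] isCont_o2[OF Rc cont(2)[OF R(1)]] w0[OF R(1)]
      by (intro continuous_divide) (simp_all add: less_imp_neq[OF w0[OF R(1)], symmetric])
    then show ?thesis
      unfolding C1_differentiable_on_def
      using g_deriv by (intro exI[of _ "\<lambda>s. \<sigma>1 (R s) / w (R s)"])
        (auto simp: has_real_derivative_iff_has_vector_derivative continuous_at_imp_continuous_on)
  qed
  have hess: "hessian ?u x = (\<chi> a b. (if a = b then w (norm x) / norm x else 0) +
    (w1 (norm x) - w (norm x) / norm x) * (x /\<^sub>R norm x)$a * (x /\<^sub>R norm x)$b)" if "x \<noteq> 0" for x :: "real^'n"
    by (rule radial_hessian[OF that v w])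
  have unit: "norm (x /\<^sub>R norm x) = 1" if "x \<noteq> 0" for x :: "real^'n" using that by simp
  have solves: "solves k g ?u"
    unfolding solves_def
  proof
    fix x :: "real^'n" assume "x \<in> ?B"
    then have x: "x \<noteq> 0" and r: "norm x > 0" by auto
    let ?b = "w (norm x) / norm x"
    have "real k * real ((CARD('n) - 1) choose k) = real (CARD('n) - 1 - (k - 1)) * K"
    proof -
      obtain j where j: "k = Suc j" using k(1) by (cases k) auto
      have "real (Suc j * ((CARD('n) - 1) choose Suc j)) = real ((CARD('n) - 1 - j) * ((CARD('n) - 1) choose j))"
        by (simp only: binomial_Suc_ratio)
      then show ?thesis by (simp only: j K_def of_nat_mult diff_Suc_1)
    qed
    also have "real (CARD('n) - 1 - (k - 1)) = n - real k" using k by (simp add: n_def of_nat_diff)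
    finally have "real ((CARD('n) - 1) choose k) = c * K" using k0 by (simp add: c_def field_simps)
    moreover have "(CARD('n) choose k) = ((CARD('n) - 1) choose (k - 1)) + ((CARD('n) - 1) choose k)"
      using k n by (intro choose_reduce_nat) auto
    ultimately have C: "real (CARD('n) choose k) = K + c * K" by (simp add: K_def)
    have bk: "?b ^ k = ?b * ?b ^ (k - 1)" using k(1) by (cases k) auto
    have "S_op k (hessian ?u x) = real (CARD('n) choose k) * ?b ^ k + (w1 (norm x) - ?b) * K * ?b ^ (k - 1)"
      unfolding hess[OF x] K_def by (rule S_op_radial[OF unit[OF x] n k(1) kn])
    also have "\<dots> = \<sigma> (norm x)" unfolding C bk \<sigma>_def A_def by (simp add: algebra_simps add_divide_distrib)
    finally show "S_op k (hessian ?u x) = g (?u x)" using R(3)[OF r] by (simp add: g_def)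
  qed
  have profile: "C2_profile v"
  proof -
    have rv: "rderiv v r = w r" "v differentiable at r within {0<..1}" if "r \<in> {0<..1}" for r
      using rderiv_eq[OF that v] that by auto
    have rw: "rderiv (rderiv v) r = w1 r" "rderiv v differentiable at r within {0<..1}" if "r \<in> {0<..1}" for r
      using rderiv_eq[OF that w, of "rderiv v"] rv that by auto
    have "continuous_on {0<..1} (rderiv (rderiv v))"
      by (rule continuous_on_eq[of _ w1]) (use rw cont in \<open>auto intro!: continuous_at_imp_continuous_on\<close>)
    then show ?thesis using rv rw by (auto simp: C2_profile_def differentiable_on_def)
  qed
  have stable: "semistable k g ?u"
    unfolding semistable_def
  proof
    fix \<psi> :: "real^'n \<Rightarrow> real"
    assume psi: "\<psi> \<in> C1_c ?B"
    let ?d = "\<lambda>i. partial_deriv i \<psi>"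
    have oB: "open ?B" by (intro open_Diff) auto
    have off: "\<psi> x = 0" "?d i x = 0" if "x \<notin> ?B" for x i
    proof -
      have "x \<notin> closure {x. \<psi> x \<noteq> 0}" using psi that by (auto simp: C1_c_def)
      then show "\<psi> x = 0" "?d i x = 0" by (rule zero_off_support, rule partial_deriv_zero_off_support(1))
    qed
    have dpsi: "\<psi> differentiable at x" for x using psi by (simp add: C1_c_def)
    define A1 where "A1 r = A r * ((real k - 1) * (w1 r / w r - 1 / r))" for r
    \<comment> \<open>The vector field is \<open>\<psi>\<^sup>2 b(|x|) x\<close>.\<close>
    define b where "b r = A r * F r / r" for r
    define b1 where "b1 r = (A1 r * F r + A r * F1 r) / r - A r * F r / r\<^sup>2" for r
    have A_deriv: "(A has_real_derivative A1 r) (at r)" if r: "r > 0" for r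
      unfolding A_def[abs_def] A1_def
      by (rule DERIV_cong[OF DERIV_mult[OF DERIV_const
            ratio_power_deriv[where w=w and ?w1.0=w1, OF k(1) r w0[OF r] w[OF r]]]]) simp
    have b_deriv: "(b has_real_derivative b1 r) (at r)" if r: "r > 0" for r
      unfolding b_def[abs_def] b1_def
      by (rule DERIV_cong[OF DERIV_divide[OF DERIV_mult[OF A_deriv[OF r] F[OF r]] DERIV_ident]])
         (use r in \<open>simp_all add: field_simps power2_eq_square\<close>)
    have b1_cont: "isCont b1 r" if r: "r > 0" for r
      unfolding b1_def[abs_def] A1_def A_def
      by (intro continuous_intros cont F1 r) (use w0[OF r] r in auto)
    define h where "h i x = b (norm x) * x$i" for i and x :: "real^'n"
    have bC: "C1_fun ?B (\<lambda>x. b (norm x))"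
      by (rule radial_C1_fun[of _ b b1]) (use b_deriv b1_cont in auto)
    have hC: "C1_fun ?B (h i)" for i
      unfolding h_def[abs_def] by (rule C1_fun_mult[OF bC coord_C1_fun])
    define \<Phi> where "\<Phi> i x = \<psi> x * (\<psi> x * h i x)" for i x
    have PhiC: "\<Phi> i \<in> C1_c ?B" for i
    proof -
      have "C1_fun ?B (\<lambda>x. \<psi> x * h i x)"
        by (rule C1_fun_mult[OF C1_c_imp_C1_fun[OF psi] hC])
      then show ?thesis unfolding \<Phi>_def[abs_def] by (rule C1_c_mult[OF oB psi])
    qed
    define D where "D x = (\<Sum>i\<in>UNIV. partial_deriv i (\<Phi> i) x)" for x
    have D_int: "integrable lborel D" "(LINT x|lborel. D x) = 0"
      unfolding D_def using integral_partial_deriv_eq_0[OF PhiC]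
      by (auto simp: Bochner_Integration.integral_sum)
    have D_off: "D x = 0" if "x \<notin> ?B" for x
    proof -
      have "x \<notin> closure {x. \<Phi> i x \<noteq> 0}" for i using PhiC[of i] that by (auto simp: C1_c_def)
      then have "partial_deriv i (\<Phi> i) x = 0" for i by (rule partial_deriv_zero_off_support(1))
      then show ?thesis by (simp add: D_def)
    qed
    let ?f = "\<lambda>x. (\<Sum>i\<in>UNIV. \<Sum>j\<in>UNIV. ?d i x * ?d j x * S_entry_deriv k i j (hessian ?u x))
           + deriv g (?u x) * (\<psi> x)\<^sup>2"
    have D_le: "D x \<le> ?f x" if "x \<in> ?B" for x
    proof -
      define r where "r = norm x"
      define p where "p = (\<Sum>i\<in>UNIV. ?d i x * x$i) / r"
      define W where "W = w1 r / w r"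
      have x: "x \<noteq> 0" and r: "0 < r" "r < 1" using that by (auto simp: r_def)
      have hd: "h i differentiable at x" for i using hC[of i] that by (simp add: C1_fun_def)
      have bd: "(\<lambda>x. b (norm x)) differentiable at x" using bC that by (simp add: C1_fun_def)
      have cd: "(\<lambda>x. x$i) differentiable at x" for i
        using coord_C1_fun[of UNIV i] by (simp add: C1_fun_def)
      have xx: "(\<Sum>i\<in>UNIV. x$i * x$i) = r * r"
      proof -
        have "(\<Sum>i\<in>UNIV. x$i * x$i) = x \<bullet> x" by (simp add: inner_vec_def)
        also have "\<dots> = r * r" by (simp add: r_def dot_square_norm power2_eq_square)
        finally show ?thesis .
      qed
      have ph: "partial_deriv i (h i) x = b1 r / r * (x$i * x$i) + b r" for i
        unfolding h_def[abs_def] partial_deriv_mult[OF bd cd]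
        using radial_partial_deriv[OF x b_deriv[of "norm x"]] x coord_partial_deriv[of i i x]
        by (simp add: r_def)
      have "partial_deriv i (\<Phi> i) x = 2 * \<psi> x * b r * (?d i x * x$i)
          + (\<psi> x)\<^sup>2 * (b1 r / r * (x$i * x$i)) + (\<psi> x)\<^sup>2 * b r" for i
      proof -
        have ph': "(\<lambda>x. \<psi> x * h i x) differentiable at x" by (rule differentiable_mult[OF dpsi hd])
        show ?thesis
          unfolding \<Phi>_def[abs_def] partial_deriv_mult[OF dpsi ph'] partial_deriv_mult[OF dpsi hd] ph
          by (simp add: h_def r_def[symmetric] algebra_simps power2_eq_square)
      qed
      then have "D x = 2 * \<psi> x * b r * (\<Sum>i\<in>UNIV. ?d i x * x$i)
          + (\<psi> x)\<^sup>2 * (b1 r / r * (\<Sum>i\<in>UNIV. x$i * x$i)) + n * ((\<psi> x)\<^sup>2 * b r)"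
        unfolding D_def by (simp add: sum.distrib sum_distrib_left n_def)
      also have "\<dots> = 2 * \<psi> x * b r * (p * r) + (\<psi> x)\<^sup>2 * (b1 r * r + n * b r)"
        using r unfolding xx by (simp add: p_def algebra_simps)
      also have "b1 r * r + n * b r = A1 r * F r + A r * F1 r + (n - 1) * (A r * F r) / r"
        using r by (simp add: b1_def b_def field_simps power2_eq_square)
      also have "2 * \<psi> x * b r * (p * r) = 2 * A r * F r * \<psi> x * p"
        using r by (simp add: b_def)
      finally have Dx: "D x = 2 * A r * F r * \<psi> x * p
         + (\<psi> x)\<^sup>2 * (A1 r * F r + A r * F1 r + (n - 1) * (A r * F r) / r)" .
      have gd: "deriv g (?u x) = \<sigma>1 r / w r"
        using DERIV_imp_deriv[OF g_deriv[of "v r"]] R(3)[OF r(1)] by (simp add: r_def)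
      have s1: "\<sigma>1 r / w r = A r * (real k * W\<^sup>2 + (n - 2 * real k + 1) * W / r - (n - real k) / r\<^sup>2 + (w2 r / w r - W\<^sup>2))"
      proof -
        have ck: "c * real k = n - real k" using k0 by (simp add: c_def)
        have wW: "w1 r = W * w r" using w0[OF r(1)] by (simp add: W_def)
        have "\<sigma>1 r / w r = A r * ((real k - 1) * (W - 1 / r) * (c / r + W) + c * (W / r - 1 / r\<^sup>2) + w2 r / w r)"
          unfolding \<sigma>1_def W_def[symmetric] wW using w0[OF r(1)] r by (simp add: field_simps)
        also have "(real k - 1) * (W - 1 / r) * (c / r + W) + c * (W / r - 1 / r\<^sup>2)
           = (real k - 1) * W\<^sup>2 + (c * real k - real k + 1) * W / r - (c * real k) / r\<^sup>2"
          using r by (simp add: field_simps power2_eq_square)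
        finally show ?thesis unfolding ck by (simp add: algebra_simps)
      qed
      have quad: "A r * p\<^sup>2 \<le> (\<Sum>i\<in>UNIV. \<Sum>j\<in>UNIV. ?d i x * ?d j x * S_entry_deriv k i j (hessian ?u x))"
      proof -
        have pp: "p = (\<Sum>i\<in>UNIV. ?d i x * (x /\<^sub>R norm x)$i)"
          by (simp add: p_def r_def sum_distrib_left divide_inverse mult_ac)
        have "w1 (norm x) - w (norm x) / norm x \<ge> - 2 * (w (norm x) / norm x)"
          using slope[OF r(1)] by (simp add: r_def)
        then show ?thesis
          unfolding hess[OF x] pp A_def r_def K_def
          by (intro S_quadratic_form_lower_bound[OF unit[OF x] k n]) (use w0[OF r(1)] x in \<open>auto simp: r_def\<close>)
      qed
      have key: "A1 r * F r + A r * F1 r + (n - 1) * (A r * F r) / r + A r * (F r)\<^sup>2 \<le> \<sigma>1 r / w r"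
      proof -
        have "A r * ((n - 1) * F r / r + (real k - 1) * (W - 1 / r) * F r + F1 r + (F r)\<^sup>2)
          \<le> A r * (real k * W\<^sup>2 + (n - 2 * real k + 1) * W / r - (n - real k) / r\<^sup>2 + (w2 r / w r - W\<^sup>2))"
          using riccati[OF r] A0[OF r(1)] unfolding n_def W_def by (intro mult_left_mono) auto
        then show ?thesis unfolding s1 A1_def W_def[symmetric] by (simp add: algebra_simps)
      qed
      have "D x \<le> A r * p\<^sup>2 + (\<sigma>1 r / w r) * (\<psi> x)\<^sup>2"
      proof -
        have "0 \<le> A r * (p - F r * \<psi> x)\<^sup>2" using A0[OF r(1)] by simp
        moreover have "(A1 r * F r + A r * F1 r + (n - 1) * (A r * F r) / r + A r * (F r)\<^sup>2) * (\<psi> x)\<^sup>2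
            \<le> (\<sigma>1 r / w r) * (\<psi> x)\<^sup>2" by (rule mult_right_mono[OF key]) simp
        ultimately show ?thesis unfolding Dx by (simp add: algebra_simps power2_eq_square)
      qed
      then show ?thesis using quad unfolding gd by linarith
    qed
    have le: "D x \<le> indicator (ball 0 1) x *\<^sub>R ?f x" for x
    proof (cases "x \<in> ?B")
      case True
      then show ?thesis using D_le[OF True] by simp
    next
      case False
      then show ?thesis using D_off[OF False] off[OF False] by simp
    qed
    have Dl: "integrable lebesgue D" "(LINT x|lebesgue. D x) = 0"
      using integrable_completion[of D lborel] integral_completion[of D lborel] D_int by auto
    \<comment> \<open>If the integrand is not integrable, the integral is \<open>0\<close> by convention.\<close>
    show "0 \<le> (LINT x:ball 0 1|lebesgue. ?f x)"
    proof (cases "integrable lebesgue (\<lambda>x. indicator (ball 0 1) x *\<^sub>R ?f x)")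
      case True
      have "(LINT x|lebesgue. D x) \<le> (LINT x|lebesgue. indicator (ball 0 1) x *\<^sub>R ?f x)"
        by (rule integral_mono[OF Dl(1) True le])
      then show ?thesis using Dl(2) by (simp add: set_lebesgue_integral_def)
    next
      case False
      then show ?thesis unfolding set_lebesgue_integral_def by (simp add: not_integrable_integral_eq)
    qed
  qed
  have "radial_profile ?u v" by (simp add: radial_profile_def)
  then show ?thesis
    unfolding semistable_radial_solution_def using profile g_pos g_C1 solves stable by blast
qed

section \<open>Staircases with prescribed slopes\<close>

text \<open>The distribution function of the quadratic B-spline on \<open>[0,3]\<close>: a monotone \<open>C\<^sup>2\<close> transition from \<open>0\<close> to
\<open>1\<close>, steepest at \<open>3/2\<close>.\<close>

definition cubic_step :: "real \<Rightarrow> real" where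
  "cubic_step x = (max 0 x ^ 3 - 3 * max 0 (x - 1) ^ 3 + 3 * max 0 (x - 2) ^ 3 - max 0 (x - 3) ^ 3) / 6"

definition cubic_step1 :: "real \<Rightarrow> real" where
  "cubic_step1 x = (max 0 x ^ 2 - 3 * max 0 (x - 1) ^ 2 + 3 * max 0 (x - 2) ^ 2 - max 0 (x - 3) ^ 2) / 2"

definition cubic_step2 :: "real \<Rightarrow> real" where
  "cubic_step2 x = max 0 x - 3 * max 0 (x - 1) + 3 * max 0 (x - 2) - max 0 (x - 3)"

lemma cubic_step_deriv: "(cubic_step has_real_derivative cubic_step1 x) (at x)"
proof -
  have d: "((\<lambda>x. max 0 (x - a) ^ 3) has_real_derivative 3 * max 0 (x - a) ^ 2) (at x)" for a :: real
    using DERIV_chain2[OF DERIV_max_0_power[of 2 "x - a"] DERIV_diff[OF DERIV_ident DERIV_const]]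
    by (simp add: eval_nat_numeral)
  have d0: "((\<lambda>x. max 0 x ^ 3) has_real_derivative 3 * max 0 x ^ 2) (at x)" using d[of 0] by simp
  show ?thesis
    unfolding cubic_step_def[abs_def] cubic_step1_def
    by (rule derivative_eq_intros d d0 refl | simp)+
qed

lemma cubic_step1_deriv: "(cubic_step1 has_real_derivative cubic_step2 x) (at x)"
proof -
  have d: "((\<lambda>x. max 0 (x - a) ^ 2) has_real_derivative 2 * max 0 (x - a)) (at x)" for a :: real
    using DERIV_chain2[OF DERIV_max_0_power[of 1 "x - a"] DERIV_diff[OF DERIV_ident DERIV_const]]
    by (simp add: numeral_2_eq_2)
  have d0: "((\<lambda>x. max 0 x ^ 2) has_real_derivative 2 * max 0 x) (at x)" using d[of 0] by simp
  show ?thesis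
    unfolding cubic_step1_def[abs_def] cubic_step2_def
    by (rule derivative_eq_intros d d0 refl | simp)+
qed

lemma cubic_step2_cont: "isCont cubic_step2 x"
  unfolding cubic_step2_def[abs_def] by (intro continuous_intros)

lemma cubic_step1_nonneg: "cubic_step1 x \<ge> 0"
proof -
  consider "x \<le> 0" | "0 < x" "x \<le> 1" | "1 < x" "x \<le> 2" | "2 < x" "x \<le> 3" | "3 < x" by linarith
  then show ?thesis
  proof cases
    case 3
    have "(x - 1) * (2 - x) \<ge> 0" using 3 by simp
    then show ?thesis using 3 by (simp add: cubic_step1_def max_def power2_eq_square algebra_simps)
  next
    case 4
    have "(3 - x) * (3 - x) \<ge> 0" by simp
    then show ?thesis using 4 by (simp add: cubic_step1_def max_def power2_eq_square algebra_simps)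
  qed (auto simp: cubic_step1_def max_def power2_eq_square algebra_simps)
qed

lemma cubic_step_low: "x \<le> 0 \<Longrightarrow> cubic_step x = 0"
  by (simp add: cubic_step_def max_def)

lemma cubic_step_high:
  assumes "x \<ge> 3" shows "cubic_step x = 1" "cubic_step1 x = 0" "cubic_step2 x = 0"
  using assms by (simp_all add: cubic_step_def cubic_step1_def cubic_step2_def max_def power2_eq_square power3_eq_cube algebra_simps)

lemma cubic_step_bounds: "0 \<le> cubic_step x" "cubic_step x \<le> 1"
proof -
  have mono: "cubic_step a \<le> cubic_step b" if "a \<le> b" for a b
    by (rule DERIV_nonneg_imp_nondecreasing[OF that]) (use cubic_step_deriv cubic_step1_nonneg in blast)
  show "0 \<le> cubic_step x" using mono[of "min 0 x" x] cubic_step_low[of "min 0 x"] by simp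
  show "cubic_step x \<le> 1" using mono[of x "max 3 x"] cubic_step_high(1)[of "max 3 x"] by simp
qed

lemma cubic_step1_mid: "cubic_step1 (3/2) = 3/4"
  by (simp add: cubic_step1_def max_def power2_eq_square)

lemma suminf_eventually_constant:
  fixes f :: "nat \<Rightarrow> real \<Rightarrow> real"
  assumes c: "summable c" and J: "\<And>j. j \<ge> J \<Longrightarrow> f j r = c j"
  shows "summable (\<lambda>j. f j r)" "(\<Sum>j. f j r) = (\<Sum>j<J. f j r) + (\<Sum>j. c (j + J))"
proof -
  show s: "summable (\<lambda>j. f j r)"
    by (rule summable_cong[THEN iffD2, OF _ c]) (use J in \<open>auto simp: eventually_sequentially\<close>)
  have "(\<Sum>j. f (j + J) r) = (\<Sum>j. c (j + J))" using J by (intro suminf_cong) simp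
  then show "(\<Sum>j. f j r) = (\<Sum>j<J. f j r) + (\<Sum>j. c (j + J))"
    using suminf_split_initial_segment[OF s, of J] by (simp add: add.commute)
qed

text \<open>On each half-line \<open>(a,\<infinity>)\<close> with \<open>a > 0\<close> the series is a finite sum plus a constant.\<close>

lemma locally_constant_series_deriv:
  fixes f f' :: "nat \<Rightarrow> real \<Rightarrow> real"
  assumes d: "\<And>j r. (f j has_real_derivative f' j r) (at r)"
    and c: "summable c"
    and loc: "\<And>a. a > 0 \<Longrightarrow> \<exists>J. \<forall>j\<ge>J. \<forall>r>a. f j r = c j \<and> f' j r = 0"
    and r: "r > 0"
  shows "((\<lambda>r. \<Sum>j. f j r) has_real_derivative (\<Sum>j. f' j r)) (at r)"
proof -
  obtain J where J: "\<And>j s. j \<ge> J \<Longrightarrow> s > r/2 \<Longrightarrow> f j s = c j \<and> f' j s = 0"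
    using loc[of "r/2"] r by auto
  have "((\<lambda>s. (\<Sum>j<J. f j s) + (\<Sum>j. c (j + J))) has_real_derivative (\<Sum>j<J. f' j r)) (at r)"
    using d by (auto intro!: derivative_eq_intros)
  moreover have "(\<Sum>j. f' j r) = (\<Sum>j<J. f' j r)"
    by (rule suminf_finite) (use J[of _ r] r in \<open>auto simp: not_less\<close>)
  ultimately have "((\<lambda>s. (\<Sum>j<J. f j s) + (\<Sum>j. c (j + J))) has_real_derivative (\<Sum>j. f' j r)) (at r)" by simp
  then show ?thesis
    by (rule has_field_derivative_transform_within_open[where S="{r/2<..}"])
       (use r suminf_eventually_constant(2)[OF c, of J f] J in auto)
qed

lemma locally_zero_series_cont:
  fixes f :: "nat \<Rightarrow> real \<Rightarrow> real"
  assumes cont: "\<And>j r. isCont (f j) r"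
    and loc: "\<And>a. a > 0 \<Longrightarrow> \<exists>J. \<forall>j\<ge>J. \<forall>r>a. f j r = 0"
    and r: "r > 0"
  shows "isCont (\<lambda>r. \<Sum>j. f j r) r"
proof -
  obtain J where J: "\<And>j s. j \<ge> J \<Longrightarrow> s > r/2 \<Longrightarrow> f j s = 0" using loc[of "r/2"] r by auto
  have "continuous_on {r/2<..} (\<lambda>s. \<Sum>j<J. f j s)"
    by (intro continuous_at_imp_continuous_on ballI continuous_sum cont)
  then have "continuous_on {r/2<..} (\<lambda>s. \<Sum>j. f j s)"
    by (rule continuous_on_eq) (rule suminf_finite[symmetric], use J in \<open>auto simp: not_less\<close>)
  then show ?thesis using r by (simp add: continuous_on_eq_continuous_at)
qed

text \<open>Step number \<open>j\<close> has height \<open>4^(-j)\<close> and is centred at \<open>2^(-j)\<close>; the parameter \<open>M j\<close> is the reciprocal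
of its width, up to a factor. The lower bound on \<open>M j\<close> confines the step to the interval from
\<open>2^(-j)/2\<close> to \<open>2 * 2^(-j)\<close>. Hence a step that has begun at \<open>r\<close> satisfies \<open>2^(-j) < 2 r\<close>, so its height
is at most \<open>2 r 2^(-j)\<close>, and summing over \<open>j\<close> gives \<open>S r \<le> 4 r\<close>. All steps are increasing, so
the slope at \<open>2^(-j)\<close> is at least that of step \<open>j\<close> alone.\<close>

lemma staircase:
  fixes M :: "nat \<Rightarrow> real"
  assumes M: "\<And>j. M j \<ge> 3 * 2 ^ j"
  obtains S S1 S2 where
    "\<And>r. r > 0 \<Longrightarrow> (S has_real_derivative S1 r) (at r)"
    "\<And>r. r > 0 \<Longrightarrow> (S1 has_real_derivative S2 r) (at r)"
    "\<And>r. r > 0 \<Longrightarrow> isCont S2 r"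
    "\<And>r. r > 0 \<Longrightarrow> S1 r \<ge> 0" "\<And>r. r > 0 \<Longrightarrow> 0 \<le> S r"
    "\<And>r. r > 0 \<Longrightarrow> S r \<le> 4 * r" "\<And>r. r > 0 \<Longrightarrow> S r \<le> 2"
    "\<And>j. S1 ((1/2) ^ j) \<ge> (1/4) ^ j * M j * (3/4)"
proof -
  define y where "y j r = M j * (r - (1/2) ^ j) + 3/2" for j and r :: real
  define f where "f j r = (1/4) ^ j * cubic_step (y j r)" for j r
  define f1 where "f1 j r = (1/4) ^ j * M j * cubic_step1 (y j r)" for j r
  define f2 where "f2 j r = (1/4) ^ j * (M j)\<^sup>2 * cubic_step2 (y j r)" for j r
  have M0: "M j > 0" for j using M[of j] by (smt (verit) zero_less_power)
  have yd: "(y j has_real_derivative M j) (at r)" for j r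
    unfolding y_def[abs_def] by (auto intro!: derivative_eq_intros)
  have fd: "(f j has_real_derivative f1 j r) (at r)" for j r
    unfolding f_def[abs_def] f1_def
    by (rule DERIV_cong[OF DERIV_mult[OF DERIV_const DERIV_chain2[OF cubic_step_deriv yd]]]) simp
  have f1d: "(f1 j has_real_derivative f2 j r) (at r)" for j r
    unfolding f1_def[abs_def] f2_def
    by (rule DERIV_cong[OF DERIV_mult[OF DERIV_const DERIV_chain2[OF cubic_step1_deriv yd]]]) (simp add: power2_eq_square)
  have f2c: "isCont (f2 j) r" for j r
    unfolding f2_def[abs_def]
    by (intro continuous_intros isCont_o2[OF DERIV_isCont[OF yd] cubic_step2_cont])
  have high: "y j r \<ge> 3" if "r \<ge> 2 * (1/2) ^ j" for j r
  proof -
    have "3 = (3 * 2 ^ j) * (1/2::real) ^ j" by (simp add: power_one_over)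
    also have "\<dots> \<le> M j * (r - (1/2) ^ j)"
      by (rule mult_mono[OF M]) (use that M0[of j] in auto)
    finally show ?thesis by (simp add: y_def)
  qed
  have low: "y j r \<le> 0" if "2 * r \<le> (1/2) ^ j" for j r
  proof -
    have "3/2 = (3 * 2 ^ j) * ((1/2::real) ^ j / 2)" by (simp add: power_one_over)
    also have "\<dots> \<le> M j * ((1/2) ^ j - r)"
      by (rule mult_mono[OF M]) (use that M0[of j] in auto)
    finally show ?thesis by (simp add: y_def algebra_simps)
  qed
  have loc: "\<exists>J. \<forall>j\<ge>J. \<forall>r>a. f j r = (1/4) ^ j \<and> f1 j r = 0 \<and> f2 j r = 0" if a: "a > 0" for a
  proof -
    obtain J where J: "(1/2::real) ^ J < a / 2" using real_arch_pow_inv[of "a/2" "1/2"] a by auto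
    have "y j r \<ge> 3" if "j \<ge> J" "r > a" for j r
    proof -
      have "(1/2::real) ^ j \<le> (1/2) ^ J" using that by (intro power_decreasing) auto
      then show ?thesis using that(2) J by (intro high) linarith
    qed
    then show ?thesis by (intro exI[of _ J]) (simp add: f_def f1_def f2_def cubic_step_high)
  qed
  have sc: "summable (\<lambda>j. (1/4::real) ^ j)" "summable (\<lambda>j. (1/2::real) ^ j)" by (simp_all add: summable_geometric)
  have loc1: "\<exists>J. \<forall>j\<ge>J. \<forall>r>a. f j r = (1/4) ^ j \<and> f1 j r = 0" 
    and loc2: "\<exists>J. \<forall>j\<ge>J. \<forall>r>a. f1 j r = 0 \<and> f2 j r = 0" 
    and loc3: "\<exists>J. \<forall>j\<ge>J. \<forall>r>a. f2 j r = 0" if "a > 0" for a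
    using loc[OF that] by blast+
  define S where "S r = (\<Sum>j. f j r)" for r
  define S1 where "S1 r = (\<Sum>j. f1 j r)" for r
  define S2 where "S2 r = (\<Sum>j. f2 j r)" for r
  have f1nn: "f1 j r \<ge> 0" for j r using M0[of j] cubic_step1_nonneg by (simp add: f1_def)
  have fnn: "f j r \<ge> 0" for j r using cubic_step_bounds by (simp add: f_def)
  have sf: "summable (\<lambda>j. f j r)" "summable (\<lambda>j. f1 j r)" if r: "r > 0" for r
  proof -
    obtain J where "\<forall>j\<ge>J. \<forall>s>r/2. f j s = (1/4) ^ j \<and> f1 j s = 0" using loc1[of "r/2"] r by auto
    then have J: "\<And>j. j \<ge> J \<Longrightarrow> f j r = (1/4) ^ j" "\<And>j. j \<ge> J \<Longrightarrow> f1 j r = 0" using r by auto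
    show "summable (\<lambda>j. f j r)" by (rule suminf_eventually_constant(1)[where f=f, OF sc(1) J(1)])
    show "summable (\<lambda>j. f1 j r)" by (rule suminf_eventually_constant(1)[where f=f1, OF summable_zero J(2)])
  qed
  show ?thesis
  proof (rule that[of S S1 S2])
    fix r :: real assume r: "r > 0"
    show "(S has_real_derivative S1 r) (at r)"
      unfolding S_def[abs_def] S1_def by (rule locally_constant_series_deriv[where f=f and f'=f1, OF fd sc(1) loc1 r])
    show "(S1 has_real_derivative S2 r) (at r)"
      unfolding S1_def[abs_def] S2_def by (rule locally_constant_series_deriv[where f=f1 and f'=f2, OF f1d summable_zero loc2 r])
    show "isCont S2 r"
      unfolding S2_def[abs_def] by (rule locally_zero_series_cont[where f=f2, OF f2c loc3 r])
    show "S1 r \<ge> 0" unfolding S1_def by (rule suminf_nonneg[OF sf(2)[OF r] f1nn])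
    show "0 \<le> S r" unfolding S_def by (rule suminf_nonneg[OF sf(1)[OF r] fnn])
    have "S r \<le> (\<Sum>j. 2 * r * (1/2) ^ j)" unfolding S_def
    proof (rule suminf_le)
      show "f j r \<le> 2 * r * (1/2) ^ j" for j
      proof (cases "2 * r \<le> (1/2) ^ j")
        case True
        then show ?thesis using r low[OF True] by (simp add: f_def cubic_step_low)
      next
        case False
        have "f j r \<le> (1/4) ^ j * 1" unfolding f_def by (intro mult_left_mono cubic_step_bounds) auto
        also have "\<dots> = (1/2) ^ j * (1/2) ^ j" by (simp add: power_mult_distrib[symmetric])
        also have "\<dots> \<le> (2 * r) * (1/2) ^ j" using False by (intro mult_right_mono) auto
        finally show ?thesis .
      qed
    qed (use sf(1)[OF r] sc in \<open>auto intro: summable_mult\<close>)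
    also have "\<dots> = 4 * r" using suminf_geometric[of "1/2::real"] sc(2) by (simp add: suminf_mult)
    finally show "S r \<le> 4 * r" .
    have "S r \<le> (\<Sum>j. (1/2) ^ j)" unfolding S_def
    proof (rule suminf_le)
      show "f j r \<le> (1/2) ^ j" for j
      proof -
        have "f j r \<le> (1/4) ^ j * 1" unfolding f_def by (intro mult_left_mono cubic_step_bounds) auto
        also have "\<dots> \<le> (1/2) ^ j" by (simp add: power_mono)
        finally show ?thesis .
      qed
    qed (use sf(1)[OF r] sc in auto)
    then show "S r \<le> 2" using suminf_geometric[of "1/2::real"] by simp
  next
    fix j
    have "(\<Sum>i\<in>{j}. f1 i ((1/2) ^ j)) \<le> S1 ((1/2) ^ j)"
      unfolding S1_def by (rule sum_le_suminf[OF sf(2)]) (use f1nn in auto)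
    then show "(1/4) ^ j * M j * (3/4) \<le> S1 ((1/2) ^ j)"
      by (simp add: f1_def y_def cubic_step1_mid)
  qed
qed

section \<open>The solution\<close>

lemma antiderivative_on_positives:
  fixes w :: "real \<Rightarrow> real"
  assumes w: "\<And>r. r > 0 \<Longrightarrow> isCont w r"
  obtains v where "\<And>r. r > 0 \<Longrightarrow> (v has_real_derivative w r) (at r)" "v 1 = 0"
proof -
  define v where "v r = (if r \<ge> 1 then integral {1..r} w else - integral {r..1} w)" for r
  have "(v has_real_derivative w r) (at r)" if r: "r > 0" for r
  proof -
    define a where "a = min r 1 / 2"
    define b where "b = max r 1 + 1"
    have ab: "0 < a" "a < r" "r < b" "a < 1" "1 < b" using r by (auto simp: a_def b_def)
    have cont: "continuous_on {a..b} w"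
      using w ab by (intro continuous_at_imp_continuous_on) auto
    have int: "w integrable_on {c..d}" if "a \<le> c" "d \<le> b" for c d
      by (rule integrable_continuous_real, rule continuous_on_subset[OF cont]) (use that in auto)
    have "((\<lambda>x. integral {a..x} w) has_real_derivative w r) (at r within {a..b})"
      by (rule integral_has_real_derivative[OF cont]) (use ab in auto)
    then have "((\<lambda>x. integral {a..x} w) has_real_derivative w r) (at r)"
      using ab by (simp add: at_within_Icc_at)
    then have "((\<lambda>x. integral {a..x} w - integral {a..1} w) has_real_derivative w r) (at r)"
      by (auto intro!: derivative_eq_intros)
    then show ?thesis
    proof (rule has_field_derivative_transform_within_open[where S="{a<..<b}"])
      fix s assume s: "s \<in> {a<..<b}"
      show "integral {a..s} w - integral {a..1} w = v s"
      proof (cases "s \<ge> 1")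
        case True
        then show ?thesis
          using Henstock_Kurzweil_Integration.integral_combine[of a 1 s w] int[of a s] s ab by (simp add: v_def)
      next
        case False
        then show ?thesis
          using Henstock_Kurzweil_Integration.integral_combine[of a s 1 w] int[of a 1] s ab by (simp add: v_def)
      qed
    qed (use ab in auto)
  qed
  moreover have "v 1 = 0" by (simp add: v_def)
  ultimately show ?thesis using that by blast
qed

text \<open>The Riccati inequality for \<open>F = W - H/r\<close>, where \<open>W = w'/w\<close>. Multiplied by \<open>r\<^sup>2\<close>, the difference of its
two sides is \<open>r H1 + r W ((1-k) + (k+1) H) - (n-k) + (n-k-1) H - H\<^sup>2\<close>. Here \<open>d\<close> stands for the possibly
huge slope of \<open>\<delta>\<close>, which enters \<open>W\<close> and, through \<open>Y = l exp (- (k+1) \<delta>)\<close>, the derivative \<open>H1\<close> of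
\<open>H\<close>. The choice of \<open>\<rho>\<close> makes the two contributions cancel, and what remains is
\<open>(k+1) m Y - (l - Y)\<^sup>2\<close> plus the gap in the Hardy inequality. The term with \<open>m\<close> is the room that the
logarithm provides, and \<open>l - Y\<close> measures the perturbation.\<close>

lemma riccati_algebra:
  fixes r k n \<rho> l d m Y W W' H H1 :: real
  assumes r: "r > 0" and k: "k \<ge> 1"
    and rho: "(k + 1) * \<rho> = k - 1" and lam: "2 * l = n - 2 * k - 2 - 2 * \<rho>"
    and kap: "(n - k) - (n - k - 1) * \<rho> + \<rho>\<^sup>2 \<le> l\<^sup>2"
    and H: "H = \<rho> + Y" and H1: "H1 = - (Y * ((k + 1) * d))" and W: "W = d - 1 / r + m / r"
    and main: "(l - Y)\<^sup>2 \<le> (k + 1) * m * Y"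
  shows "(n - 1) * (W - H / r) / r + (k - 1) * (W - 1 / r) * (W - H / r) + (W' - H1 / r + H / r\<^sup>2) + (W - H / r)\<^sup>2
     \<le> k * W\<^sup>2 + (n - 2 * k + 1) * W / r - (n - k) / r\<^sup>2 + W'"
proof -
  define Z where "Z = r * W"
  have Z: "Z = r * d - 1 + m" using r by (simp add: Z_def W field_simps)
  have WZ: "W = Z / r" using r by (simp add: Z_def)
  have "k * W\<^sup>2 + (n - 2 * k + 1) * W / r - (n - k) / r\<^sup>2 + W'
     - ((n - 1) * (W - H / r) / r + (k - 1) * (W - 1 / r) * (W - H / r) + (W' - H1 / r + H / r\<^sup>2) + (W - H / r)\<^sup>2)
    = (r * H1 + Z * ((1 - k) + (k + 1) * H) - (n - k) + (n - k - 1) * H - H\<^sup>2) / r\<^sup>2"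
    unfolding WZ using r by (simp add: field_simps power2_eq_square)
  also have "r * H1 + Z * ((1 - k) + (k + 1) * H) - (n - k) + (n - k - 1) * H - H\<^sup>2
     = ((k + 1) * m * Y - (l - Y)\<^sup>2) + (l\<^sup>2 - ((n - k) - (n - k - 1) * \<rho> + \<rho>\<^sup>2))"
  proof -
    have e1: "(1 - k) + (k + 1) * H = (k + 1) * Y" unfolding H using rho by (simp add: algebra_simps)
    have e2: "n = 2 * l + 2 * k + 2 + 2 * \<rho>" using lam by simp
    have "r * H1 + Z * ((1 - k) + (k + 1) * H) = (k + 1) * Y * (m - 1)"
      unfolding e1 H1 Z by (simp add: algebra_simps)
    then show ?thesis unfolding H using rho by (simp add: e2 algebra_simps power2_eq_square)
  qed
  also have "(((k + 1) * m * Y - (l - Y)\<^sup>2) + (l\<^sup>2 - ((n - k) - (n - k - 1) * \<rho> + \<rho>\<^sup>2))) / r\<^sup>2 \<ge> 0"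
    using main kap by simp
  finally show ?thesis by (simp only: diff_ge_0_iff_ge)
qed

text \<open>With \<open>s = n - 2k\<close> the difference of the two sides of the second inequality is \<open>s (s - 8) / 4\<close>: this is
where the dimension enters.\<close>

lemma hardy_constants:
  fixes k n \<rho> l :: real
  assumes k: "k \<ge> 1" and n: "n \<ge> 2 * k + 8"
    and rho: "\<rho> = (k - 1) / (k + 1)" and l: "l = (n - 2 * k - 2) / 2 - \<rho>"
  shows "l \<ge> 2" "(n - k) - (n - k - 1) * \<rho> + \<rho>\<^sup>2 \<le> l\<^sup>2"
proof -
  have r1: "\<rho> \<le> 1" using k by (simp add: rho)
  then show "l \<ge> 2" using n unfolding l by (simp add: field_simps)
  define s where "s = n - 2 * k"
  have s: "s \<ge> 8" using n by (simp add: s_def)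
  have kr: "(k + 1) * \<rho> = k - 1" using k by (simp add: rho)
  have ll: "l = (s - 2) / 2 - \<rho>" by (simp add: l s_def)
  have nn: "n = s + 2 * k" by (simp add: s_def)
  have "l\<^sup>2 - ((n - k) - (n - k - 1) * \<rho> + \<rho>\<^sup>2) = (s - 2)\<^sup>2 / 4 - (s + k) + (k + 1) * \<rho>"
    unfolding ll nn by (simp add: field_simps power2_eq_square)
  also have "\<dots> = s * (s - 8) / 4" unfolding kr by (simp add: field_simps power2_eq_square)
  also have "\<dots> \<ge> 0" using s by simp
  finally show "(n - k) - (n - k - 1) * \<rho> + \<rho>\<^sup>2 \<le> l\<^sup>2" by simp
qed

text \<open>If \<open>w\<close> contains the factor \<open>1/L\<close>, then \<open>w'/w\<close> contains \<open>1 / (r (1 + r) L)\<close>, and the last bound makes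
this gain comparable with a staircase that is bounded by a multiple of \<open>r\<close>.\<close>

lemma log_weight:
  fixes r :: real
  assumes r: "r > 0"
  defines "L \<equiv> \<lambda>r. 1 + ln (1 + 1 / r)"
  shows "L r \<ge> 1" "(L has_real_derivative - (1 / (r * (r + 1)))) (at r)"
    "r \<le> 1 \<Longrightarrow> 1 / ((1 + r) * L r) \<ge> r / 4"
proof -
  show L1: "L r \<ge> 1" using r by (simp add: L_def)
  show "(L has_real_derivative - (1 / (r * (r + 1)))) (at r)"
  proof -
    have p: "1 + 1 / r > 0" using r by (simp add: add_pos_pos)
    have "((\<lambda>r. 1 + 1 / r) has_real_derivative - (1 / r\<^sup>2)) (at r)"
      using r by (auto intro!: derivative_eq_intros simp: power2_eq_square)
    from DERIV_chain2[where f=ln and g="\<lambda>r. 1 + 1 / r", OF DERIV_ln[OF p] this]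
    have "(L has_real_derivative 0 + inverse (1 + 1 / r) * - (1 / r\<^sup>2)) (at r)"
      unfolding L_def by (intro DERIV_add DERIV_const)
    moreover have "0 + inverse (1 + 1 / r) * - (1 / r\<^sup>2) = - (1 / (r * (r + 1)))"
      using r by (simp add: field_simps power2_eq_square)
    ultimately show ?thesis by simp
  qed
  show "1 / ((1 + r) * L r) \<ge> r / 4" if r1: "r \<le> 1"
  proof -
    have "ln (1 + 1 / r) \<le> 1 / r" using ln_add_one_self_le_self[of "1/r"] r by simp
    then have "L r \<le> (1 + r) / r" using r by (simp add: L_def field_simps)
    then have "(1 + r) * L r \<le> (1 + r) * ((1 + r) / r)" using r by (intro mult_left_mono) auto
    also have "\<dots> \<le> 2 * (2 / r)" using r r1 by (intro mult_mono divide_right_mono) auto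
    finally have "(1 + r) * L r \<le> 4 / r" by simp
    moreover have "(1 + r) * L r > 0" using r L1 by simp
    ultimately show ?thesis using r by (simp add: field_simps)
  qed
qed

text \<open>Here \<open>w = exp (c S) / (r L)\<close>. With \<open>X = (k+1) c S\<close> the remaining inequality of \<open>riccati_algebra\<close> is
\<open>l (e\<^sup>X - 1)\<^sup>2 / e\<^sup>X \<le> (k+1) / ((1 + r) L)\<close>. The left-hand side is at most \<open>4 l X\<^sup>2\<close>, and the value
of \<open>c\<close> is such that \<open>X \<le> r / (4 l)\<close>. The last conclusion holds because the slope of \<open>c S\<close> is a summand
of \<open>w'/w\<close> whose only negative companion is \<open>- 1/r\<close>.\<close>

lemma semistable_profile:
  fixes k :: nat and S S1 S2 :: "real \<Rightarrow> real"
  assumes k: "k \<ge> 1" and n: "CARD('n) \<ge> 2 * k + 8"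
    and S: "\<And>r. r > 0 \<Longrightarrow> (S has_real_derivative S1 r) (at r)"
    and S1: "\<And>r. r > 0 \<Longrightarrow> (S1 has_real_derivative S2 r) (at r)"
    and S2: "\<And>r. r > 0 \<Longrightarrow> isCont S2 r"
    and S1nn: "\<And>r. r > 0 \<Longrightarrow> S1 r \<ge> 0" and Snn: "\<And>r. r > 0 \<Longrightarrow> 0 \<le> S r"
    and Sle: "\<And>r. r > 0 \<Longrightarrow> S r \<le> 4 * r" and S2le: "\<And>r. r > 0 \<Longrightarrow> S r \<le> 2"
    and c: "c = 1 / (16 * ((real CARD('n) - 2 * real k - 2) / 2 - (real k - 1) / (real k + 1)) * (real k + 1))"
  obtains v where
    "semistable_radial_solution k (\<lambda>x::real^'n. v (norm x)) v"
    "(\<lambda>x::real^'n. v (norm x)) \<in> weighted_sobolev (ball 0 1) (k + 1) (\<lambda>x. norm x powr (1 - real k))"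
    "strict_mono_on {0<..1} v"
    "\<And>r. 0 < r \<Longrightarrow> r \<le> 1 \<Longrightarrow> c * S1 r \<ge> 1 / r \<Longrightarrow>
        rderiv (rderiv v) r \<ge> (c * S1 r - 1 / r) / (r * (1 + ln (1 + 1 / r)))"
proof -
  define kk where "kk = real k"
  define N where "N = real CARD('n)"
  define \<rho> where "\<rho> = (kk - 1) / (kk + 1)"
  define l where "l = (N - 2 * kk - 2) / 2 - \<rho>"
  have kk: "kk \<ge> 1" using k by (simp add: kk_def)
  have NN: "N \<ge> 2 * kk + 8" using n by (simp add: N_def kk_def)
  have l2: "l \<ge> 2" and kap: "(N - kk) - (N - kk - 1) * \<rho> + \<rho>\<^sup>2 \<le> l\<^sup>2"
    using hardy_constants[OF kk NN \<rho>_def l_def] by auto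
  have cl: "c = 1 / (16 * l * (kk + 1))" by (simp add: c l_def \<rho>_def kk_def N_def)
  have c0: "c > 0" using l2 kk by (simp add: cl)
  define L where "L = (\<lambda>r::real. 1 + ln (1 + 1 / r))"
  have L1: "L r \<ge> 1" if "r > 0" for r using log_weight(1)[OF that] by (simp add: L_def)
  have L_deriv: "(L has_real_derivative - (1 / (r * (r + 1)))) (at r)" if "r > 0" for r
    using log_weight(2)[OF that] by (simp add: L_def)
  have L_low: "1 / ((1 + r) * L r) \<ge> r / 4" if "r > 0" "r \<le> 1" for r
    using log_weight(3)[OF that] by (simp add: L_def)
  define \<delta> where "\<delta> r = c * S r" for r
  define \<delta>1 where "\<delta>1 r = c * S1 r" for r
  define \<delta>2 where "\<delta>2 r = c * S2 r" for r
  have d: "(\<delta> has_real_derivative \<delta>1 r) (at r)" "(\<delta>1 has_real_derivative \<delta>2 r) (at r)" if "r > 0" for r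
    unfolding \<delta>_def[abs_def] \<delta>1_def[abs_def] \<delta>2_def using S[OF that] S1[OF that]
    by (auto intro!: derivative_eq_intros)
  have d_nn: "\<delta> r \<ge> 0" "\<delta>1 r \<ge> 0" if "r > 0" for r
    using c0 Snn[OF that] S1nn[OF that] by (auto simp: \<delta>_def \<delta>1_def)
  have X_le: "(kk + 1) * \<delta> r \<le> 1" if "r > 0" for r
  proof -
    have "(kk + 1) * \<delta> r = S r / (16 * l)" using kk l2 by (simp add: \<delta>_def cl divide_simps)
    also have "\<dots> \<le> 2 / (16 * l)" using S2le[OF that] l2 by (intro divide_right_mono) auto
    also have "\<dots> \<le> 1" using l2 by (simp add: divide_le_eq)
    finally show ?thesis .
  qed
  have X_le': "(kk + 1) * \<delta> r \<le> r / (4 * l)" if "r > 0" for r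
  proof -
    have "(kk + 1) * \<delta> r = S r / (16 * l)" using kk l2 by (simp add: \<delta>_def cl divide_simps)
    also have "\<dots> \<le> (4 * r) / (16 * l)" using Sle[OF that] l2 by (intro divide_right_mono) auto
    finally show ?thesis by simp
  qed
  define w where "w r = exp (\<delta> r) / (r * L r)" for r
  define m where "m r = 1 / ((r + 1) * L r)" for r
  define m1 where "m1 r = - ((L r - 1 / r) / ((r + 1) * L r)\<^sup>2)" for r
  define W where "W r = \<delta>1 r - 1 / r + m r / r" for r
  define W1 where "W1 r = \<delta>2 r + 1 / r\<^sup>2 + (m1 r / r - m r / r\<^sup>2)" for r
  define w1 where "w1 r = w r * W r" for r
  define w2 where "w2 r = w r * W r * W r + w r * W1 r" for r
  have w0: "w r > 0" if "r > 0" for r using L1[OF that] that by (simp add: w_def)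
  have m_deriv: "(m has_real_derivative m1 r) (at r)" if r: "r > 0" for r
  proof -
    have "((\<lambda>r. (r + 1) * L r) has_real_derivative 1 * L r + - (1 / (r * (r + 1))) * (r + 1)) (at r)"
      by (rule DERIV_mult[OF _ L_deriv[OF r]]) (auto intro!: derivative_eq_intros)
    then have "((\<lambda>r. (r + 1) * L r) has_real_derivative L r - 1 / r) (at r)"
      by (rule DERIV_cong) (use r in \<open>simp add: divide_simps\<close>)
    from DERIV_inverse_fun[OF this]
    show ?thesis unfolding m_def[abs_def] m1_def using L1[OF r] r
      by (simp add: inverse_eq_divide power2_eq_square)
  qed
  have w_deriv: "(w has_real_derivative w1 r) (at r)" if r: "r > 0" for r
  proof -
    have "((\<lambda>r. r * L r) has_real_derivative 1 * L r + - (1 / (r * (r + 1))) * r) (at r)"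
      by (rule DERIV_mult[OF DERIV_ident L_deriv[OF r]])
    from DERIV_divide[OF DERIV_chain2[OF DERIV_exp d(1)[OF r]] this]
    have "(w has_real_derivative (exp (\<delta> r) * \<delta>1 r * (r * L r) - exp (\<delta> r) * (1 * L r + - (1 / (r * (r + 1))) * r))
        / ((r * L r) * (r * L r))) (at r)" unfolding w_def[abs_def] using r L1[OF r] by auto
    moreover have "(exp (\<delta> r) * \<delta>1 r * (r * L r) - exp (\<delta> r) * (1 * L r + - (1 / (r * (r + 1))) * r))
        / ((r * L r) * (r * L r)) = w1 r"
    proof -
      have "r \<noteq> 0" "L r \<noteq> 0" "r + 1 \<noteq> 0" using r L1[OF r] by auto
      then show ?thesis unfolding w1_def w_def W_def m_def by (simp add: divide_simps) (simp add: algebra_simps)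
    qed
    ultimately show ?thesis by simp
  qed
  have W_deriv: "(W has_real_derivative W1 r) (at r)" if r: "r > 0" for r
  proof -
    have "((\<lambda>r. 1 / r) has_real_derivative - (1 / r\<^sup>2)) (at r)"
      using r by (auto intro!: derivative_eq_intros simp: power2_eq_square)
    moreover have "((\<lambda>r. m r / r) has_real_derivative m1 r / r - m r / r\<^sup>2) (at r)"
      by (rule DERIV_cong[OF DERIV_divide[OF m_deriv[OF r] DERIV_ident]])
         (use r in \<open>auto simp: field_simps power2_eq_square\<close>)
    ultimately have "((\<lambda>r. \<delta>1 r - 1 / r + m r / r) has_real_derivative \<delta>2 r - - (1 / r\<^sup>2) + (m1 r / r - m r / r\<^sup>2)) (at r)"
      by (intro DERIV_add DERIV_diff d(2) r)
    then show ?thesis unfolding W_def[abs_def] W1_def by simp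
  qed
  have w1_deriv: "(w1 has_real_derivative w2 r) (at r)" if r: "r > 0" for r
    unfolding w1_def[abs_def] w2_def
    by (rule DERIV_cong[OF DERIV_mult[OF w_deriv[OF r] W_deriv[OF r]]]) (simp add: w1_def)
  have cont: "isCont w r" "isCont W r" "isCont m r" "isCont L r" "isCont \<delta>1 r" "isCont \<delta> r" if "r > 0" for r
    using that DERIV_isCont[OF w_deriv] DERIV_isCont[OF W_deriv] DERIV_isCont[OF m_deriv] DERIV_isCont[OF L_deriv]
      DERIV_isCont[OF d(1)] DERIV_isCont[OF d(2)] by auto
  have \<delta>2_cont: "isCont \<delta>2 r" if "r > 0" for r unfolding \<delta>2_def[abs_def] by (intro continuous_intros S2 that)
  have W1_cont: "isCont W1 r" if r: "r > 0" for r
    unfolding W1_def[abs_def] m1_def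
    by (intro continuous_intros cont \<delta>2_cont r) (use r L1[OF r] in auto)
  have w2_cont: "isCont w2 r" if r: "r > 0" for r
    unfolding w2_def[abs_def] by (intro continuous_intros cont W1_cont r)
  obtain v where v: "\<And>r. r > 0 \<Longrightarrow> (v has_real_derivative w r) (at r)" and v1: "v 1 = 0"
    using antiderivative_on_positives[of w] cont(1) by blast
  have mono: "v a < v b" if "0 < a" "a < b" for a b
  proof (rule DERIV_pos_imp_increasing[OF that(2)])
    fix x assume "a \<le> x" "x \<le> b"
    then have "x > 0" using that by simp
    then show "\<exists>y. DERIV v x :> y \<and> y > 0" using v w0 by blast
  qed
  have w_low: "w r \<ge> 1 / (r * L r)" if "r > 0" for r
    unfolding w_def using d_nn(1)[OF that] L1[OF that] that by (intro divide_right_mono) auto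
  have w_high: "w r \<le> 3 / r" if "r > 0" for r
  proof -
    have "1 * \<delta> r \<le> (kk + 1) * \<delta> r" using kk d_nn(1)[OF that] by (intro mult_right_mono) auto
    then have "exp (\<delta> r) \<le> exp 1" using X_le[OF that] by simp
    also have "\<dots> \<le> 3" by (rule exp_le)
    finally have "exp (\<delta> r) \<le> 3" .
    moreover have "r * 1 \<le> r * L r" using L1[OF that] that by (intro mult_left_mono) auto
    ultimately show ?thesis unfolding w_def using that by (intro frac_le) auto
  qed
  \<comment> \<open>Comparison with \<open>- ln (L r)\<close> near \<open>0\<close> and with \<open>ln r / L 1\<close> near infinity, both unbounded.\<close>
  have surj: "\<exists>r>0. v r = s" for s
  proof -
    define r1 where "r1 = exp (- exp (ln (L 1) - s))"
    define r2 where "r2 = exp (L 1 * max 0 s)"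
    have r1: "0 < r1" "r1 \<le> 1" by (auto simp: r1_def)
    have r2: "1 \<le> r2" using L1[of 1] by (auto simp: r2_def)
    have Lp: "L r > 0" if "r > 0" for r using L1[OF that] by simp
    have "v r1 + ln (L r1) \<le> v 1 + ln (L 1)"
    proof (rule DERIV_nonneg_imp_nondecreasing[OF r1(2)])
      fix x assume "r1 \<le> x" "x \<le> 1"
      then have x: "x > 0" using r1 by simp
      have "((\<lambda>x. v x + ln (L x)) has_real_derivative w x + inverse (L x) * - (1 / (x * (x + 1)))) (at x)"
        by (intro DERIV_add v x DERIV_chain2[OF DERIV_ln L_deriv] Lp)
      moreover have "inverse (L x) * (1 / (x * (x + 1))) \<le> 1 / (x * L x)"
        using x Lp[OF x] by (simp add: divide_simps)
      ultimately show "\<exists>y. ((\<lambda>x. v x + ln (L x)) has_real_derivative y) (at x) \<and> 0 \<le> y"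
        using w_low[OF x] by (intro exI conjI) (assumption, simp)
    qed
    moreover have "ln (L r1) \<ge> ln (L 1) - s"
    proof -
      have "ln (1 / r1) \<le> ln (1 + 1 / r1)" using r1 by (subst ln_le_cancel_iff) (auto simp: add_pos_pos)
      moreover have "ln (1 / r1) = exp (ln (L 1) - s)" using r1 by (simp add: ln_div r1_def)
      ultimately have "exp (ln (L 1) - s) \<le> L r1" by (simp add: L_def)
      then show ?thesis using Lp[OF r1(1)] by (simp add: ln_ge_iff)
    qed
    ultimately have low: "v r1 \<le> s" using v1 by simp
    have "v 1 - ln 1 / L 1 \<le> v r2 - ln r2 / L 1"
    proof (rule DERIV_nonneg_imp_nondecreasing[OF r2])
      fix x assume x1: "1 \<le> x" "x \<le> r2"
      then have x: "x > 0" by simp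
      have "((\<lambda>x. v x - ln x / L 1) has_real_derivative w x - (1 / x) / L 1) (at x)"
        by (intro DERIV_diff v x DERIV_cdivide DERIV_ln_divide)
      moreover have "(1 / x) / L 1 \<le> 1 / (x * L x)"
      proof -
        have "1 + 1 / x \<le> 1 + 1 / 1" using x1 by simp
        then have "L x \<le> L 1" unfolding L_def using x by (simp add: add_pos_pos)
        then show ?thesis using x Lp[OF x] Lp[of 1] by (simp add: divide_simps)
      qed
      ultimately show "\<exists>y. ((\<lambda>x. v x - ln x / L 1) has_real_derivative y) (at x) \<and> 0 \<le> y"
        using w_low[OF x] by (intro exI conjI) (assumption, simp)
    qed
    then have high: "s \<le> v r2" using v1 Lp[of 1] by (simp add: r2_def)
    have "\<exists>r\<ge>r1. r \<le> r2 \<and> v r = s"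
      by (rule IVT[where f=v, OF low high]) (use r1 r2 in \<open>auto intro!: DERIV_isCont[OF v]\<close>)
    then obtain r where r: "r1 \<le> r" "v r = s" by blast
    have "r > 0" using r(1) r1(1) by linarith
    then show ?thesis using r(2) by blast
  qed
  define Y where "Y r = l * exp (- ((kk + 1) * \<delta> r))" for r
  define H where "H r = \<rho> + Y r" for r
  define H1 where "H1 r = - (Y r * ((kk + 1) * \<delta>1 r))" for r
  define F where "F r = W r - H r / r" for r
  define F1 where "F1 r = W1 r - H1 r / r + H r / r\<^sup>2" for r
  have H_deriv: "(H has_real_derivative H1 r) (at r)" if r: "r > 0" for r
    unfolding H_def[abs_def] H1_def Y_def[abs_def]
    by (rule DERIV_cong[OF DERIV_add[OF DERIV_const DERIV_mult[OF DERIV_const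
         DERIV_chain2[OF DERIV_exp DERIV_minus[OF DERIV_mult[OF DERIV_const d(1)[OF r]]]]]]])
       (simp add: algebra_simps)
  have F_deriv: "(F has_real_derivative F1 r) (at r)" if r: "r > 0" for r
    unfolding F_def[abs_def] F1_def
    by (rule DERIV_cong[OF DERIV_diff[OF W_deriv[OF r] DERIV_divide[OF H_deriv[OF r] DERIV_ident]]])
       (use r in \<open>auto simp: field_simps power2_eq_square\<close>)
  have F1_cont: "isCont F1 r" if r: "r > 0" for r
    unfolding F1_def[abs_def] H1_def Y_def
    by (intro continuous_intros W1_cont cont r DERIV_isCont[OF H_deriv]) (use r in auto)
  have riccati: "(real CARD('n) - 1) * F r / r + (real k - 1) * (w1 r / w r - 1 / r) * F r + F1 r + (F r)\<^sup>2
       \<le> real k * (w1 r / w r)\<^sup>2 + (real CARD('n) - 2 * real k + 1) * (w1 r / w r) / r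
          - (real CARD('n) - real k) / r\<^sup>2 + (w2 r / w r - (w1 r / w r)\<^sup>2)" if r: "0 < r" "r < 1" for r
  proof -
    have e1: "w1 r / w r = W r" using w0[OF r(1)] by (simp add: w1_def)
    have e2: "w2 r / w r - (W r)\<^sup>2 = W1 r"
      using w0[OF r(1)] by (simp add: w2_def field_simps power2_eq_square)
    have main: "(l - Y r)\<^sup>2 \<le> (kk + 1) * m r * Y r"
    proof -
      define X where "X = (kk + 1) * \<delta> r"
      have X: "0 \<le> X" "X \<le> 1" "X \<le> r / (4 * l)"
        using X_le[OF r(1)] X_le'[OF r(1)] d_nn(1)[OF r(1)] kk by (auto simp: X_def)
      have E: "exp X \<ge> 1" "exp X \<le> 1 + 2 * X"
      proof -
        show "exp X \<ge> 1" using X by simp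
        have "X\<^sup>2 \<le> X" using X by (simp add: power2_eq_square mult_left_le)
        then show "exp X \<le> 1 + 2 * X" using exp_bound[OF X(1,2)] by linarith
      qed
      have "l * (exp X - 1)\<^sup>2 / exp X \<le> l * (exp X - 1)\<^sup>2 / 1"
        by (rule divide_left_mono) (use E l2 in auto)
      also have "\<dots> \<le> l * (2 * X)\<^sup>2"
        using E l2 by (simp only: div_by_1) (intro mult_left_mono power_mono, auto)
      also have "\<dots> \<le> l * (2 * (r / (4 * l)))\<^sup>2" using X l2 by (intro mult_left_mono power_mono) auto
      also have "\<dots> = (r * r) / (4 * l)" using l2 by (simp add: power2_eq_square field_simps)
      also have "\<dots> \<le> (r * 1) / (4 * 1)" using r l2 by (intro frac_le mult_left_mono) auto
      also have "\<dots> \<le> m r" using L_low[of r] r by (simp add: m_def add.commute)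
      also have "\<dots> \<le> (kk + 1) * m r"
      proof -
        have "m r \<ge> 0" using r L1[OF r(1)] by (simp add: m_def)
        then have "1 * m r \<le> (kk + 1) * m r" using kk by (intro mult_right_mono) auto
        then show ?thesis by simp
      qed
      finally have a: "l * (exp X - 1)\<^sup>2 / exp X \<le> (kk + 1) * m r" .
      have Yr: "Y r = l / exp X" by (simp add: Y_def X_def exp_minus divide_inverse)
      have Y0: "Y r \<ge> 0" using l2 by (simp add: Yr)
      have "(l - Y r)\<^sup>2 = (l * (exp X - 1)\<^sup>2 / exp X) * Y r"
        unfolding Yr by (simp add: field_simps power2_eq_square)
      also have "\<dots> \<le> (kk + 1) * m r * Y r" by (rule mult_right_mono[OF a Y0])
      finally show ?thesis .
    qed
    have rho: "(kk + 1) * \<rho> = kk - 1" using kk by (simp add: \<rho>_def)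
    have lam: "2 * l = N - 2 * kk - 2 - 2 * \<rho>" by (simp add: l_def)
    show ?thesis
      unfolding e1 e2 F_def F1_def N_def[symmetric] kk_def[symmetric]
      by (rule riccati_algebra[OF r(1) kk rho lam kap H_def H1_def W_def main])
  qed
  have slope: "w1 r \<ge> - (w r / r)" if r: "r > 0" for r
  proof -
    have "m r \<ge> 0" using r L1[OF r] by (simp add: m_def)
    then have "W r \<ge> - (1 / r)" using d_nn(2)[OF r] r by (simp add: W_def)
    then have "w r * W r \<ge> w r * (- (1 / r))" using w0[OF r] by (intro mult_left_mono) auto
    then show ?thesis by (simp add: w1_def)
  qed
  have sol: "semistable_radial_solution k (\<lambda>x::real^'n. v (norm x)) v"
    by (rule semistable_radial_solutionI[where w=w and ?w1.0=w1 and ?w2.0=w2 and F=F and ?F1.0=F1])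
       (use k n v w_deriv w1_deriv w2_cont w0 surj slope F_deriv F1_cont riccati in auto)
  have sob: "(\<lambda>x::real^'n. v (norm x)) \<in> weighted_sobolev (ball 0 1) (k + 1) (\<lambda>x. norm x powr (1 - real k))"
  proof (rule radial_weighted_sobolev[where w=w and M=3])
    fix r :: real assume r: "0 < r" "r < 1"
    show "\<bar>w r\<bar> \<le> 3 / r" using w0[OF r(1)] w_high[OF r(1)] by simp
    have "v r - 3 * ln r \<ge> v 1 - 3 * ln 1"
    proof (rule DERIV_nonpos_imp_nonincreasing[of r 1 "\<lambda>r. v r - 3 * ln r"])
      fix x assume "r \<le> x" "x \<le> 1"
      then have x: "x > 0" using r by simp
      have "((\<lambda>r. v r - 3 * ln r) has_real_derivative w x - 3 * (1 / x)) (at x)"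
        by (intro DERIV_diff v x DERIV_cmult DERIV_ln_divide)
      then show "\<exists>y. ((\<lambda>r. v r - 3 * ln r) has_real_derivative y) (at x) \<and> y \<le> 0"
        using w_high[OF x] by (intro exI conjI) (assumption, simp)
    qed (use r in auto)
    moreover have "v r \<le> 0" using mono[OF r] v1 by simp
    ultimately show "\<bar>v r\<bar> \<le> 3 * - ln r" using v1 by simp
  qed (use v cont k n in auto)
  have smono: "strict_mono_on {0<..1} v" using mono by (auto simp: strict_mono_on_def)
  have spike: "rderiv (rderiv v) r \<ge> (c * S1 r - 1 / r) / (r * (1 + ln (1 + 1 / r)))"
    if r: "0 < r" "r \<le> 1" and big: "c * S1 r \<ge> 1 / r" for r
  proof -
    have a: "rderiv v s = w s" if "s \<in> {0<..1}" for s using rderiv_eq(1)[OF that v, of v] that by auto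
    have "rderiv (rderiv v) r = w1 r" using rderiv_eq(1)[of r w "w1 r" "rderiv v"] w_deriv r a by auto
    moreover have "m r / r \<ge> 0" using r L1[OF r(1)] by (simp add: m_def)
    then have "W r \<ge> c * S1 r - 1 / r" by (simp add: W_def \<delta>1_def)
    then have "(1 / (r * L r)) * (c * S1 r - 1 / r) \<le> w r * W r"
      using w_low[OF r(1)] w0[OF r(1)] big by (intro mult_mono) auto
    ultimately show ?thesis by (simp add: w1_def L_def)
  qed
  show ?thesis by (rule that[OF sol sob smono spike])
qed

theorem corollary4p4:
  fixes k :: nat
  assumes "k \<ge> 1" and "CARD('n::finite) \<ge> 2 * k + 8"
  shows "\<not> (\<exists>\<phi> :: real \<Rightarrow> real. (\<forall>r\<in>{0<..1}. 0 < \<phi> r) \<and>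
    (\<forall>(u :: real^'n \<Rightarrow> real) v.
       u \<in> weighted_sobolev (ball 0 1) (k + 1) (\<lambda>x. norm x powr (1 - real k)) \<and>
       semistable_radial_solution k u v \<and> strict_mono_on {0<..1} v \<longrightarrow>
       (\<exists>C>0. \<exists>\<epsilon>\<in>{0<..1}. \<forall>r\<in>{0<..\<epsilon>}. \<bar>rderiv (rderiv v) r\<bar> \<le> C * \<phi> r)))"
proof
  assume "\<exists>\<phi> :: real \<Rightarrow> real. (\<forall>r\<in>{0<..1}. 0 < \<phi> r) \<and>
    (\<forall>(u :: real^'n \<Rightarrow> real) v.
       u \<in> weighted_sobolev (ball 0 1) (k + 1) (\<lambda>x. norm x powr (1 - real k)) \<and>
       semistable_radial_solution k u v \<and> strict_mono_on {0<..1} v \<longrightarrow>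
       (\<exists>C>0. \<exists>\<epsilon>\<in>{0<..1}. \<forall>r\<in>{0<..\<epsilon>}. \<bar>rderiv (rderiv v) r\<bar> \<le> C * \<phi> r))"
  then obtain \<phi> :: "real \<Rightarrow> real" where pos: "\<And>r. r \<in> {0<..1} \<Longrightarrow> 0 < \<phi> r"
    and bound: "\<And>(u :: real^'n \<Rightarrow> real) v.
       u \<in> weighted_sobolev (ball 0 1) (k + 1) (\<lambda>x. norm x powr (1 - real k)) \<Longrightarrow>
       semistable_radial_solution k u v \<Longrightarrow> strict_mono_on {0<..1} v \<Longrightarrow>
       (\<exists>C>0. \<exists>\<epsilon>\<in>{0<..1}. \<forall>r\<in>{0<..\<epsilon>}. \<bar>rderiv (rderiv v) r\<bar> \<le> C * \<phi> r)"
    by blast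
  define c where "c = 1 / (16 * ((real CARD('n) - 2 * real k - 2) / 2 - (real k - 1) / (real k + 1)) * (real k + 1))"
  have c0: "c > 0"
  proof -
    define l where "l = (real CARD('n) - 2 * real k - 2) / 2 - (real k - 1) / (real k + 1)"
    have "l \<ge> 2"
      by (rule hardy_constants(1)[of "real k" "real CARD('n)", OF _ _ refl]) (use assms in \<open>auto simp: l_def\<close>)
    then show ?thesis unfolding c_def l_def[symmetric] by (intro divide_pos_pos mult_pos_pos) auto
  qed
  define p :: "nat \<Rightarrow> real" where "p j = (1/2) ^ j" for j
  have p: "0 < p j" "p j \<le> 1" for j by (auto simp: p_def power_le_one)
  define T where "T j = real j * \<phi> (p j) * (p j * (1 + ln (1 + 1 / p j))) + 1 / p j" for j
  \<comment> \<open>The second entry is what makes \<open>c S1 - 1/r\<close> at least \<open>j \<phi>(r) r L(r)\<close> at \<open>r = 2^(-j)\<close>.\<close>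
  define M where "M j = max (3 * 2 ^ j) (4 / 3 * 4 ^ j / c * T j)" for j
  obtain S S1 S2 where
    S: "\<And>r. r > 0 \<Longrightarrow> (S has_real_derivative S1 r) (at r)"
    "\<And>r. r > 0 \<Longrightarrow> (S1 has_real_derivative S2 r) (at r)"
    "\<And>r. r > 0 \<Longrightarrow> isCont S2 r"
    "\<And>r. r > 0 \<Longrightarrow> S1 r \<ge> 0" "\<And>r. r > 0 \<Longrightarrow> 0 \<le> S r"
    "\<And>r. r > 0 \<Longrightarrow> S r \<le> 4 * r" "\<And>r. r > 0 \<Longrightarrow> S r \<le> 2"
    and S1: "\<And>j. S1 ((1/2) ^ j) \<ge> (1/4) ^ j * M j * (3/4)"
    using staircase[of M] by (auto simp: M_def)
  obtain v where v: "semistable_radial_solution k (\<lambda>x::real^'n. v (norm x)) v"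
    "(\<lambda>x::real^'n. v (norm x)) \<in> weighted_sobolev (ball 0 1) (k + 1) (\<lambda>x. norm x powr (1 - real k))"
    "strict_mono_on {0<..1} v"
    and spike: "\<And>r. 0 < r \<Longrightarrow> r \<le> 1 \<Longrightarrow> c * S1 r \<ge> 1 / r \<Longrightarrow>
        rderiv (rderiv v) r \<ge> (c * S1 r - 1 / r) / (r * (1 + ln (1 + 1 / r)))"
    using semistable_profile[OF assms S c_def] by blast
  have big: "rderiv (rderiv v) (p j) \<ge> real j * \<phi> (p j)" for j
  proof -
    have L: "p j * (1 + ln (1 + 1 / p j)) > 0" 
      by (rule mult_pos_pos[OF p(1)]) (use log_weight(1)[OF p(1)[of j]] in linarith)
    have ph: "\<phi> (p j) > 0" using pos p by simp
    have "T j = c * ((1/4) ^ j * (4 / 3 * 4 ^ j / c * T j) * (3/4))"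
      using c0 by (simp add: power_one_over)
    also have "\<dots> \<le> c * ((1/4) ^ j * M j * (3/4))"
      using c0 by (intro mult_left_mono mult_right_mono) (auto simp: M_def)
    also have "\<dots> \<le> c * S1 (p j)" unfolding p_def using S1[of j] c0 by (intro mult_left_mono) auto
    finally have T: "T j \<le> c * S1 (p j)" .
    have a: "real j * \<phi> (p j) * (p j * (1 + ln (1 + 1 / p j))) \<le> c * S1 (p j) - 1 / p j" using T by (simp add: T_def)
    moreover have "0 \<le> real j * \<phi> (p j) * (p j * (1 + ln (1 + 1 / p j)))" using L ph by simp
    ultimately have "c * S1 (p j) \<ge> 1 / p j" by linarith
    from spike[OF p(1) p(2) this]
    have "(c * S1 (p j) - 1 / p j) / (p j * (1 + ln (1 + 1 / p j))) \<le> rderiv (rderiv v) (p j)" .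
    moreover have "real j * \<phi> (p j) \<le> (c * S1 (p j) - 1 / p j) / (p j * (1 + ln (1 + 1 / p j)))"
      using a L by (simp add: pos_le_divide_eq)
    ultimately show ?thesis by linarith
  qed
  obtain C \<epsilon> where C: "C > 0" "\<epsilon> \<in> {0<..1}"
    "\<And>r. r \<in> {0<..\<epsilon>} \<Longrightarrow> \<bar>rderiv (rderiv v) r\<bar> \<le> C * \<phi> r"
    using bound[OF v(2,1,3)] by blast
  obtain J where J: "(1/2::real) ^ J < \<epsilon>" using real_arch_pow_inv[of \<epsilon> "1/2"] C by auto
  obtain i :: nat where i: "C < real i" using reals_Archimedean2 by blast
  define j where "j = max i J"
  have "p j \<le> (1/2) ^ J" unfolding p_def j_def by (intro power_decreasing) auto
  then have "p j \<in> {0<..\<epsilon>}" using J p(1)[of j] by simp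
  then have "\<bar>rderiv (rderiv v) (p j)\<bar> \<le> C * \<phi> (p j)" by (rule C(3))
  also have "\<dots> < real j * \<phi> (p j)"
    using i pos[of "p j"] p[of j] by (intro mult_strict_right_mono) (auto simp: j_def)
  also have "\<dots> \<le> rderiv (rderiv v) (p j)" by (rule big)
  finally show False by simp
qed

end
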